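(* Let $(Q,\mathcal{A})$ be a marked lattice polygon in $\mathbb{R}^2$ such that $Q$ has exactly one interior lattice point. Let $u=(u_{ij})_{(i,j)\in\mathcal{A}}\in\mathbb{R}^{\mathcal{A}}$ be such that the plane tropical curve $\mathcal{C}_F$ defined by $$F:\mathbb{R}^2\to\mathbb{R},\quad (x,y)\mapsto\min\{u_{ij}+i\cdot x+j\cdot y\mid (i,j)\in\mathcal{A}\}$$ has a cycle. Then $$\operatorname{val}_j(u)=-j_{\operatorname{trop}}(u).$$ Moreover, if in addition $u$ lies in (the interior of) a top-dimensional cone of the secondary fan of $\mathcal{A}$ and $f=\sum_{(i,j)\in\mathcal{A}}a_{ij}x^iy^j$ is a Laurent polynomial over $\mathbb{K}$ with $\operatorname{val}(a_{ij})=u_{ij}$ for all $(i,j)\in\mathcal{A}$, then $$\operatorname{val}\big(j(f)\big)=-j_{\operatorname{trop}}(\mathcal{C}_F)=-j_{\operatorname{trop}}\big(\operatorname{Trop}(C_f)\big).$$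
   Context: **Base field.** $\mathbb{K}$ is a field with a non-archimedean valuation $\operatorname{val}:\mathbb{K}^*\to\mathbb{R}$, extended by $\operatorname{val}(0)=\infty$ (in examples: the field of Puiseux series over $\mathbb{C}$ with the order as valuation). **Marked polygons and curves.** A marked (lattice) polygon $(Q,\mathcal{A})$ is a convex lattice polygon $Q\subset\mathbb{R}^2$ together with a subset $\mathcal{A}\subseteq Q\cap\mathbb{Z}^2$ containing at least the vertices of $Q$. It defines a polarized toric surface $X_{\mathcal{A}}\subset\mathbb{P}_{\mathbb{K}}^{|\mathcal{A}|-1}$ containing the torus $(\mathbb{K}^* )^2$. A Laurent polynomial $f=\sum_{(i,j)\in\mathcal{A}}a_{ij}x^iy^j$ defines the hyperplane section $C_f\subset X_{\mathcal{A}}$ cut out by $\sum a_{ij}z_{ij}=0$; inside the torus it is the zero locus of $f$. If $Q$ has exactly one interior lattice point, then for general $f$ the curve $C_f$ is a smooth elliptic curve. **$j$-invariant.** Let $Q$ have exactly one interior lattice point and write $\underline{a}=(a_{ij}\mid(i,j)\in\mathcal{A})$. The $j$-invariant of $C_f$ is given by a quotient $j(f)=j(C_f)=A_{\mathcal{A}}/B_{\mathcal{A}}$ of two homogeneous polynomials $A_{\mathcal{A}},B_{\mathcal{A}}\in\mathbb{Q}[\underline{a}]$ of degree $12$, evaluated at the coefficients of $f$. (Up to integral unimodular affine transformations, every such $(Q,\mathcal{A})$ has $\mathcal{A}$ contained in one of the sets $\mathcal{A}_a,\mathcal{A}_b,\mathcal{A}_c$ of all lattice points of, respectively, the triangle with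 vertices $(0,0),(4,0),(0,2)$, the square with vertices $(0,0),(2,0),(2,2),(0,2)$, and the triangle with vertices $(0,0),(3,0),(0,3)$; $A_{\mathcal{A}}$ and $B_{\mathcal{A}}$ are obtained from the polynomials for these three sets by setting the missing coefficients equal to $0$.) **Generic valuation.** For $0\neq H=\sum_\omega H_\omega\underline{a}^\omega\in\mathbb{Q}[\underline{a}]$ put $\operatorname{val}_H:\mathbb{R}^{\mathcal{A}}\to\mathbb{R}$, $\operatorname{val}_H(u)=\min\{u\cdot\omega\mid H_\omega\neq0\}$, where $u\cdot\omega=\sum_{(i,j)\in\mathcal{A}}u_{ij}\omega_{ij}$. The generic valuation of the $j$-invariant is $\operatorname{val}_j(u)=\operatorname{val}_{A_{\mathcal{A}}}(u)-\operatorname{val}_{B_{\mathcal{A}}}(u)$. (It does not depend on common factors of $A_{\mathcal{A}}$ and $B_{\mathcal{A}}$.) **Tropical curves and dual subdivisions.** For a plane tropical Laurent polynomial $F=\min\{u_{ij}+ix+jy\mid(i,j)\in\mathcal{A}'\}$ ($\mathcal{A}'\subset\mathbb{Z}^2$ finite, $u_{ij}\in\mathbb{R}$), the plane tropical curve $\mathcal{C}_F\subset\mathbb{R}^2$ is the set of points where the minimum is attained at least twice. The convex hull of $\mathcal{A}'$ is the Newton polygon of $F$. Projecting the lower faces of the convex hull of $\{(i,j,u_{ij})\mid(i,j)\in\mathcal{A}'\}$ to the plane subdivides the Newton polygon into polygons $Q_1,\dots,Q_l$; each $Q_k$ is marked by the set $\mathcal{A}_k$ of those $(i,j)\in\mathcal{A}'$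 for which $(i,j,u_{ij})$ lies in the corresponding lower face. This is the marked subdivision induced by $F$. It is dual to $\mathcal{C}_F$: each $Q_k$ corresponds to a vertex of $\mathcal{C}_F$ (the point where the linear terms of its marked points attain the common minimum), and each edge $e$ of a $Q_k$ corresponds to an edge $E$ of $\mathcal{C}_F$ orthogonal to $e$, which is unbounded iff $e$ lies in the boundary of the Newton polygon. If $e$ has end points $(x_1,y_1),(x_2,y_2)$, the direction vector of $E$ is $v(E)=(y_2-y_1,x_1-x_2)$ (up to sign), and the lattice length of a bounded edge $E$ is $l(E)=\|E\|/\|v(E)\|$ (Euclidean lengths). **Cycle and tropical $j$-invariant.** An interior lattice point $\tilde\omega$ of the Newton polygon determines a cycle of $\mathcal{C}_F$ if it is a vertex of every polygon $Q_k$ of the subdivision which contains it. The cycle is then the union of the edges of $\mathcal{C}_F$ dual to the edges of the subdivision emanating from $\tilde\omega$, and its lattice length is the sum of the lattice lengths of these edges. If the Newton polygon has exactly one interior lattice point, $\mathcal{C}_F$ has at most one cycle. Its tropical $j$-invariant $j_{\operatorname{trop}}(\mathcal{C}_F)$ is the lattice length of the cycle if there is one, and $0$ otherwise. For $u\in\mathbb{R}^{\mathcal{A}}$ put $j_{\operatorname{trop}}(u)=j_{\operatorname{trop}}(\mathcal{C}_{F_u})$ with $F_u=\min\{u_{ij}+ix+jy\mid(i,j)\in\mathcal{A}\}$. **Secondary fan.** The secondary fan of $\mathcal{A}$ is the complete fan in $\mathbb{R}^{\mathcal{A}}$ such that $u,u'$ lie in the relative interior of the same cone iff $F_u$ and $F_{u'}$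 induce the same marked subdivision of $(Q,\mathcal{A})$. The interiors of its top-dimensional cones correspond to marked subdivisions that are triangulations in which the marked points are exactly the vertices of the triangles. **Tropicalization.** $\operatorname{Trop}(C_f)=\overline{\operatorname{val}(C_f\cap(\mathbb{K}^* )^2)}\subseteq\mathbb{R}^2$ (coordinatewise valuation, Euclidean closure). By Kapranov's Theorem it is identified with the plane tropical curve defined by $\operatorname{trop}(f)=\min\{\operatorname{val}(a_{ij})+ix+jy\mid a_{ij}\neq0\}$, and $j_{\operatorname{trop}}(\operatorname{Trop}(C_f))$ is computed from $\operatorname{trop}(f)$. *)

theory Defs
  imports "HOL-Analysis.Analysis" "HOL-Library.Poly_Mapping"
begin

section \<open>Valued fields\<close>

definition nonarch_valuation :: "('k::field \<Rightarrow> ereal) \<Rightarrow> bool" where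
  "nonarch_valuation val \<longleftrightarrow>
     (\<forall>x. val x = \<infinity> \<longleftrightarrow> x = 0) \<and> (\<forall>x. val x \<noteq> -\<infinity>) \<and>
     (\<forall>x y. val (x * y) = val x + val y) \<and> (\<forall>x y. min (val x) (val y) \<le> val (x + y))"

section \<open>Marked lattice polygons\<close>

definition pt :: "int \<times> int \<Rightarrow> real \<times> real" where
  "pt p = (of_int (fst p), of_int (snd p))"

definition lattice_polygon :: "(real \<times> real) set \<Rightarrow> bool" where
  "lattice_polygon Q \<longleftrightarrow> (\<exists>V. finite V \<and> Q = convex hull (pt ` V)) \<and> interior Q \<noteq> {}"

definition marked_polygon :: "(real \<times> real) set \<Rightarrow> (int \<times> int) set \<Rightarrow> bool" where
  "marked_polygon Q A \<longleftrightarrow>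
     lattice_polygon Q \<and> pt ` A \<subseteq> Q \<and> {v. v extreme_point_of Q} \<subseteq> pt ` A"

definition interior_lattice_points :: "(real \<times> real) set \<Rightarrow> (int \<times> int) set" where
  "interior_lattice_points Q = {\<omega>. pt \<omega> \<in> interior Q}"

section \<open>Tropical polynomials, dual subdivisions and cycles\<close>

text \<open>
  A tropical Laurent polynomial is given by its finite support \<open>A\<close> and its coefficients \<open>u\<close>;
  the values of \<open>u\<close> outside \<open>A\<close> are irrelevant in all definitions below.
\<close>

definition trop_term :: "(int \<times> int \<Rightarrow> real) \<Rightarrow> int \<times> int \<Rightarrow> real \<times> real \<Rightarrow> real" where
  "trop_term u p w = u p + of_int (fst p) * fst w + of_int (snd p) * snd w"

definition trop_fun ::
  "(int \<times> int) set \<Rightarrow> (int \<times> int \<Rightarrow> real) \<Rightarrow> real \<times> real \<Rightarrow> real" where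
  "trop_fun A u w = Min ((\<lambda>p. trop_term u p w) ` A)"

definition newton_polygon :: "(int \<times> int) set \<Rightarrow> (real \<times> real) set" where
  "newton_polygon A = convex hull (pt ` A)"

definition lift_pt :: "(int \<times> int \<Rightarrow> real) \<Rightarrow> int \<times> int \<Rightarrow> (real \<times> real) \<times> real" where
  "lift_pt u p = (pt p, u p)"

text \<open>
  A lower face is the set of minimizers of a linear functional whose last coefficient is
  positive, hence, after scaling, equal to \<open>1\<close>.
\<close>

definition lower_faces ::
  "(int \<times> int) set \<Rightarrow> (int \<times> int \<Rightarrow> real) \<Rightarrow> ((real \<times> real) \<times> real) set set" where
  "lower_faces A u =
     {{z \<in> convex hull (lift_pt u ` A).
         \<forall>z' \<in> convex hull (lift_pt u ` A). inner (w, 1) z \<le> inner (w, 1) z'} | w. True}"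

definition marked_subdivision ::
  "(int \<times> int) set \<Rightarrow> (int \<times> int \<Rightarrow> real) \<Rightarrow> ((real \<times> real) set \<times> (int \<times> int) set) set" where
  "marked_subdivision A u =
     {(fst ` L, {p \<in> A. lift_pt u p \<in> L}) | L. L \<in> lower_faces A u \<and> interior (fst ` L) \<noteq> {}}"

definition determines_cycle ::
  "(int \<times> int) set \<Rightarrow> (int \<times> int \<Rightarrow> real) \<Rightarrow> int \<times> int \<Rightarrow> bool" where
  "determines_cycle A u \<omega> \<longleftrightarrow>
     \<omega> \<in> interior_lattice_points (newton_polygon A) \<and>
     (\<forall>(R, M) \<in> marked_subdivision A u. pt \<omega> \<in> R \<longrightarrow> pt \<omega> extreme_point_of R)"

definition has_cycle :: "(int \<times> int) set \<Rightarrow> (int \<times> int \<Rightarrow> real) \<Rightarrow> bool" where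
  "has_cycle A u \<longleftrightarrow> (\<exists>\<omega>. determines_cycle A u \<omega>)"

text \<open>
  The points \<open>q\<close> such that the segment from \<open>\<omega>\<close> to \<open>q\<close> is an edge of the subdivision.
\<close>

definition edge_ends ::
  "(int \<times> int) set \<Rightarrow> (int \<times> int \<Rightarrow> real) \<Rightarrow> int \<times> int \<Rightarrow> (int \<times> int) set" where
  "edge_ends A u \<omega> =
     {q \<in> A. \<exists>(R, M) \<in> marked_subdivision A u. closed_segment (pt \<omega>) (pt q) edge_of R}"

text \<open>
  The edge of the tropical curve dual to the edge of the subdivision with end points \<open>p\<close> and
  \<open>q\<close>: a closed segment (or ray), consisting of the points where the terms of both \<open>p\<close> and
  \<open>q\<close> attain the minimum.
\<close>

definition dual_edge ::
  "(int \<times> int) set \<Rightarrow> (int \<times> int \<Rightarrow> real) \<Rightarrow> int \<times> int \<Rightarrow> int \<times> int \<Rightarrow> (real \<times> real) set" where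
  "dual_edge A u p q =
     {w. trop_term u p w = trop_fun A u w \<and> trop_term u q w = trop_fun A u w}"

definition direction_vector :: "int \<times> int \<Rightarrow> int \<times> int \<Rightarrow> real \<times> real" where
  "direction_vector p q = (of_int (snd q - snd p), of_int (fst p - fst q))"

text \<open>Used for bounded dual edges only; the length of a segment is its diameter.\<close>

definition lattice_length ::
  "(int \<times> int) set \<Rightarrow> (int \<times> int \<Rightarrow> real) \<Rightarrow> int \<times> int \<Rightarrow> int \<times> int \<Rightarrow> real" where
  "lattice_length A u p q = diameter (dual_edge A u p q) / norm (direction_vector p q)"

definition cycle_length ::
  "(int \<times> int) set \<Rightarrow> (int \<times> int \<Rightarrow> real) \<Rightarrow> int \<times> int \<Rightarrow> real" where
  "cycle_length A u \<omega> = (\<Sum>q \<in> edge_ends A u \<omega>. lattice_length A u \<omega> q)"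

text \<open>Meaningful if the Newton polygon has exactly one interior lattice point.\<close>

definition j_trop :: "(int \<times> int) set \<Rightarrow> (int \<times> int \<Rightarrow> real) \<Rightarrow> real" where
  "j_trop A u =
     (if has_cycle A u then cycle_length A u (THE \<omega>. determines_cycle A u \<omega>) else 0)"

section \<open>The secondary fan\<close>

text \<open>
  Each cone is the closure of its relative interior, which is a set of all \<open>u\<close> inducing the same
  marked subdivision. Vectors of \<open>\<real>\<^sup>A\<close> are represented by functions on the whole lattice, so a
  cone in \<open>\<real>\<^sup>A\<close> is represented by the cylinder over it. In the product topology, interior and
  closure of a cylinder over a finite set of coordinates are the cylinders over the interior and
  the closure in \<open>\<real>\<^sup>A\<close>.
\<close>

definition secondary_fan :: "(int \<times> int) set \<Rightarrow> (int \<times> int \<Rightarrow> real) set set" where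
  "secondary_fan A =
     {closure {u'. marked_subdivision A u' = marked_subdivision A u} | u. True}"

definition top_dimensional :: "(int \<times> int \<Rightarrow> real) set \<Rightarrow> bool" where
  "top_dimensional \<sigma> \<longleftrightarrow> interior \<sigma> \<noteq> {}"

section \<open>The $j$-invariant for the three maximal polygons\<close>

text \<open>
  Coefficients \<open>(a\<^sub>1, a\<^sub>2, a\<^sub>3, a\<^sub>4, a\<^sub>6)\<close> of a Weierstrass equation
  \<open>y\<^sup>2 + a\<^sub>1 x y + a\<^sub>3 y = x\<^sup>3 + a\<^sub>2 x\<^sup>2 + a\<^sub>4 x + a\<^sub>6\<close> with the usual invariants; its
  $j$-invariant is \<open>c\<^sub>4\<^sup>3\<close> divided by the discriminant.
\<close>

type_synonym 'r weierstrass = "'r \<times> 'r \<times> 'r \<times> 'r \<times> 'r"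

definition weier_c4 :: "'r::comm_ring_1 weierstrass \<Rightarrow> 'r" where
  "weier_c4 = (\<lambda>(a1, a2, a3, a4, a6). (a1^2 + 4 * a2)^2 - 24 * (2 * a4 + a1 * a3))"

definition weier_disc :: "'r::comm_ring_1 weierstrass \<Rightarrow> 'r" where
  "weier_disc = (\<lambda>(a1, a2, a3, a4, a6).
     let b2 = a1^2 + 4 * a2;
         b4 = 2 * a4 + a1 * a3;
         b6 = a3^2 + 4 * a6;
         b8 = a1^2 * a6 + 4 * a2 * a6 - a1 * a3 * a4 + a2 * a3^2 - a4^2
     in 9 * b2 * b4 * b6 - b2^2 * b8 - 8 * b4^3 - 27 * b6^2)"

text \<open>
  The functions below give the Weierstrass form of the Jacobian of a curve of genus one, which
  need not have a rational point. They have integral coefficients, so they make sense in every characteristic.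

  For \<open>y\<^sup>2 + (l x\<^sup>2 + m x + n) y = a x\<^sup>4 + b x\<^sup>3 + c x\<^sup>2 + d x + e\<close> they are obtained from the
  invariants \<open>I = c\<^sub>4\<close> and \<open>J = 2 c\<^sub>6\<close> of the binary quartic
  \<open>(l x\<^sup>2 + m x + n)\<^sup>2 + 4 (a x\<^sup>4 + b x\<^sup>3 + c x\<^sup>2 + d x + e)\<close>.
\<close>

definition weier_double_cover ::
  "'r::comm_ring_1 \<Rightarrow> 'r \<Rightarrow> 'r \<Rightarrow> 'r \<Rightarrow> 'r \<Rightarrow> 'r \<Rightarrow> 'r \<Rightarrow> 'r \<Rightarrow> 'r weierstrass" where
  "weier_double_cover l m n a b c d e =
    (m,
     c - l * n,
     l * d + n * b,
     b * d - 4 * a * e - a * n^2 - c * l * n - e * l^2,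
     a * d * m * n + a * d^2 - 4 * a * c * e - a * c * n^2 - a * e * m^2
       - b * d * l * n + b * e * l * m + b^2 * e - c * e * l^2)"

text \<open>
  If \<open>f = \<alpha> y\<^sup>2 + \<beta> y + \<gamma>\<close> with polynomials \<open>\<alpha>, \<beta>, \<gamma>\<close> in \<open>x\<close> then \<open>\<eta> = \<alpha> y\<close> satisfies
  \<open>\<eta>\<^sup>2 + \<beta> \<eta> = - \<alpha> \<gamma>\<close>. This applies with \<open>deg \<alpha> = 0\<close>, \<open>deg \<beta> = 2\<close>, \<open>deg \<gamma> = 4\<close> to the triangle
  with vertices \<open>(0,0), (4,0), (0,2)\<close>, and with \<open>deg \<alpha> = deg \<beta> = deg \<gamma> = 2\<close> to the square. The
  argument \<open>f\<close> maps an exponent to the corresponding coefficient.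
\<close>

definition weier_triangle_42 :: "(int \<times> int \<Rightarrow> 'r::comm_ring_1) \<Rightarrow> 'r weierstrass" where
  "weier_triangle_42 f =
     weier_double_cover (f (2,1)) (f (1,1)) (f (0,1))
       (- f (0,2) * f (4,0)) (- f (0,2) * f (3,0)) (- f (0,2) * f (2,0))
       (- f (0,2) * f (1,0)) (- f (0,2) * f (0,0))"

definition weier_square :: "(int \<times> int \<Rightarrow> 'r::comm_ring_1) \<Rightarrow> 'r weierstrass" where
  "weier_square f =
     weier_double_cover (f (2,1)) (f (1,1)) (f (0,1))
       (- (f (2,2) * f (2,0)))
       (- (f (2,2) * f (1,0) + f (1,2) * f (2,0)))
       (- (f (2,2) * f (0,0) + f (1,2) * f (1,0) + f (0,2) * f (2,0)))
       (- (f (1,2) * f (0,0) + f (0,2) * f (1,0)))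
       (- (f (0,2) * f (0,0)))"

text \<open>
  For plane cubics these are the formulas of Artin, Rodriguez-Villegas and Tate (On the Jacobians
  of plane cubics). Here \<open>c\<^sub>4\<close> and \<open>c\<^sub>6\<close> are the Aronhold invariants of degrees 4 and 6.
\<close>

definition weier_cubic :: "(int \<times> int \<Rightarrow> 'r::comm_ring_1) \<Rightarrow> 'r weierstrass" where
  "weier_cubic f =
    (let a = f (3,0); b = f (0,3); c = f (0,0);
         a2 = f (2,1); a3 = f (2,0); b1 = f (1,2); b3 = f (0,2); c1 = f (1,0); c2 = f (0,1);
         m = f (1,1)
     in
     (m,
      - (a2 * c2 + a3 * b3 + b1 * c1),
      9 * a * b * c - (a * b3 * c2 + b * a3 * c1 + c * a2 * b1) - (a2 * b3 * c1 + a3 * b1 * c2),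
      c * a2^2 * b3 + c * a3 * b1^2 + a2 * a3 * b3 * c2 + b * a3^2 * c2 + a2 * b1 * c1 * c2
      + a * b1 * c2^2 + a3 * b1 * b3 * c1 + a * b3^2 * c1 + b * a2 * c1^2 - 3 * a * c * b1 * b3
      - 3 * b * c * a2 * a3 - 3 * a * b * c1 * c2,
      9 * a^2 * b * c * b3 * c2 + 3 * a * b * c * a3 * b1 * c2 + 2 * b * c * a2^2 * a3 * c2
      + m * a * c * b1^2 * c2 + 3 * a * b * c * a2 * b3 * c1 + 2 * b * c * a2 * a3^2 * b3
      + 2 * a * c * b1^2 * b3 * c1 + m * c * a2 * a3 * b1 * b3 + m * a * c * a2 * b3^2
      + 2 * a * c * a3 * b1 * b3^2 + m * b * c * a2^2 * c1 + m * b * c * a3^2 * b1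
      + m^3 * a * b * c + 9 * a * b^2 * c * a3 * c1 + 9 * a * b * c^2 * a2 * b1
      + m * a * b1 * b3 * c1 * c2 + m * b * a2 * a3 * c1 * c2 + 2 * a * b * b1 * c1^2 * c2
      + 2 * a * b * a2 * c1 * c2^2 + m * a * b * a3 * c2^2 + m * a * b * b3 * c1^2
      - a * c * a2 * b1 * b3 * c2 - 3 * m * a * b * c * a2 * c2 - c * a2 * a3 * b1^2 * c2
      - 3 * m * a * b * c * a3 * b3 - c * a2^2 * b1 * b3 * c1 - m^2 * a * c * b1 * b3
      - c * a3^2 * b1^2 * b3 - c * a2^2 * a3 * b3^2 - a^2 * c * b3^3
      - 3 * m * a * b * c * b1 * c1 - b * c * a2 * a3 * b1 * c1 - m^2 * b * c * a2 * a3
      - b^2 * c * a3^3 - b * c^2 * a2^3 - 27 * a^2 * b^2 * c^2 - a * c^2 * b1^3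
      - a * b * a3 * b3 * c1 * c2 - a2 * a3 * b1 * b3 * c1 * c2 - a * a2 * b3^2 * c1 * c2
      - m^2 * a * b * c1 * c2 - b * a3^2 * b1 * c1 * c2 - b * a2^2 * c1^2 * c2
      - a * a3 * b1 * b3 * c2^2 - b * a2 * a3^2 * c2^2 - a * b1^2 * c1 * c2^2 - a^2 * b * c2^3
      - b * a2 * a3 * b3 * c1^2 - a * b1 * b3^2 * c1^2 - a * b^2 * c1^3))"

text \<open>
  Up to unimodular affine transformations, the marking of a polygon with exactly one interior
  lattice point is contained in one of the following three sets.
\<close>

datatype shape = Triangle_42 | Square | Triangle_33

fun shape_points :: "shape \<Rightarrow> (int \<times> int) set" where
  "shape_points Triangle_42 = {p. pt p \<in> convex hull (pt ` {(0,0), (4,0), (0,2)})}"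
| "shape_points Square = {p. pt p \<in> convex hull (pt ` {(0,0), (2,0), (2,2), (0,2)})}"
| "shape_points Triangle_33 = {p. pt p \<in> convex hull (pt ` {(0,0), (3,0), (0,3)})}"

fun shape_weier :: "shape \<Rightarrow> (int \<times> int \<Rightarrow> 'r::comm_ring_1) \<Rightarrow> 'r weierstrass" where
  "shape_weier Triangle_42 = weier_triangle_42"
| "shape_weier Square = weier_square"
| "shape_weier Triangle_33 = weier_cubic"

section \<open>The $j$-invariant of a marked polygon and its generic valuation\<close>

definition unimodular_affine :: "(int \<times> int \<Rightarrow> int \<times> int) \<Rightarrow> bool" where
  "unimodular_affine \<phi> \<longleftrightarrow>
     (\<exists>a b c d r s. \<bar>a * d - b * c\<bar> = 1 \<and> (\<forall>i j. \<phi> (i, j) = (a * i + b * j + r, c * i + d * j + s)))"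

definition normal_form ::
  "(int \<times> int) set \<Rightarrow> shape \<times> (int \<times> int \<Rightarrow> int \<times> int) \<Rightarrow> bool" where
  "normal_form A N \<longleftrightarrow> unimodular_affine (snd N) \<and> snd N ` A \<subseteq> shape_points (fst N)"

text \<open>
  Polynomials in variables \<open>a\<^bsub>p\<^esub>\<close> indexed by lattice points \<open>p\<close>; monomials are finitely
  supported exponent functions.
\<close>

type_synonym coeff_poly = "(int \<times> int \<Rightarrow>\<^sub>0 nat) \<Rightarrow>\<^sub>0 int"

definition coeff_var :: "int \<times> int \<Rightarrow> coeff_poly" where
  "coeff_var p = Poly_Mapping.single (Poly_Mapping.single p 1) 1"

text \<open>
  The coefficients of the transform under \<open>\<phi>\<close> of the generic polynomial with support \<open>A\<close>. As
  \<open>\<phi>\<close> is injective, the sum has at most one summand; it is \<open>0\<close> for the missing coefficients.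
\<close>

definition generic_coeff ::
  "(int \<times> int) set \<Rightarrow> (int \<times> int \<Rightarrow> int \<times> int) \<Rightarrow> int \<times> int \<Rightarrow> coeff_poly" where
  "generic_coeff A \<phi> q = (\<Sum>p \<in> {p \<in> A. \<phi> p = q}. coeff_var p)"

text \<open>
  Every \<open>A\<close> belonging to a marked polygon with exactly one interior lattice point has a normal
  form. The $j$-invariant does not depend on which one is chosen.
\<close>

definition generic_weier :: "(int \<times> int) set \<Rightarrow> coeff_poly weierstrass" where
  "generic_weier A =
     (let N = (SOME N. normal_form A N) in shape_weier (fst N) (generic_coeff A (snd N)))"

definition j_numerator :: "(int \<times> int) set \<Rightarrow> coeff_poly" where
  "j_numerator A = weier_c4 (generic_weier A) ^ 3"

definition j_denominator :: "(int \<times> int) set \<Rightarrow> coeff_poly" where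
  "j_denominator A = weier_disc (generic_weier A)"

definition eval_coeff_poly :: "(int \<times> int \<Rightarrow> 'k::comm_ring_1) \<Rightarrow> coeff_poly \<Rightarrow> 'k" where
  "eval_coeff_poly a H =
     (\<Sum>\<omega> \<in> Poly_Mapping.keys H. of_int (Poly_Mapping.lookup H \<omega>) *
        (\<Prod>p \<in> Poly_Mapping.keys \<omega>. a p ^ Poly_Mapping.lookup \<omega> p))"

text \<open>
  A Laurent polynomial \<open>f\<close> in two variables is a finitely supported function on exponents.
\<close>

definition j_invariant :: "(int \<times> int) set \<Rightarrow> (int \<times> int \<Rightarrow>\<^sub>0 'k::field) \<Rightarrow> 'k" where
  "j_invariant A f =
     eval_coeff_poly (Poly_Mapping.lookup f) (j_numerator A) /
     eval_coeff_poly (Poly_Mapping.lookup f) (j_denominator A)"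

definition val_poly :: "(int \<times> int) set \<Rightarrow> coeff_poly \<Rightarrow> (int \<times> int \<Rightarrow> real) \<Rightarrow> real" where
  "val_poly A H u =
     Min ((\<lambda>\<omega>. \<Sum>p \<in> A. u p * of_nat (Poly_Mapping.lookup \<omega> p)) ` Poly_Mapping.keys H)"

definition val_j :: "(int \<times> int) set \<Rightarrow> (int \<times> int \<Rightarrow> real) \<Rightarrow> real" where
  "val_j A u = val_poly A (j_numerator A) u - val_poly A (j_denominator A) u"

text \<open>
  The tropical $j$-invariant of the tropicalization of the curve defined by \<open>f\<close>; it is computed
  from the tropical polynomial whose support is that of \<open>f\<close> and whose coefficients are the
  valuations of the coefficients of \<open>f\<close>.
\<close>

definition j_trop_Trop :: "('k::field \<Rightarrow> ereal) \<Rightarrow> (int \<times> int \<Rightarrow>\<^sub>0 'k) \<Rightarrow> real" where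
  "j_trop_Trop val f =
     j_trop (Poly_Mapping.keys f) (\<lambda>p. real_of_ereal (val (Poly_Mapping.lookup f p)))"

end

theory Submission
  imports Defs
begin

text \<open>
  Let \<open>h\<close> be the heights relative to the interior lattice point, which becomes the origin. The
  cycle is the boundary of the polygon \<open>P\<close> of all \<open>w\<close> with \<open>h q + \<langle>q, w\<rangle> \<ge> 0\<close> for all marked
  points \<open>q \<noteq> 0\<close>. These lie on the boundary of one of three polygons, with corners \<open>v\<^sub>k\<close>. The edges
  of \<open>P\<close> dual to the points of one side form the graph of a concave function, so the sum of their
  lattice lengths is the length of an interval, and the length of the cycle telescopes to
  \<open>- \<Sum> l\<^sub>k \<langle>v\<^sub>k, w\<^sub>k\<rangle>\<close>, where \<open>w\<^sub>k\<close> minimizes \<open>v\<^sub>k\<close> on \<open>P\<close> and \<open>l\<^sub>k\<close> is a multiplicity.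

  The numerator is \<open>m\<^bsup>12\<^esup>\<close> plus heavier terms, where \<open>m\<close> is the coefficient of the interior point.
  The factors of each monomial of the discriminant can be distributed among the corners such that
  the factors given to \<open>v\<^sub>k\<close> add up to \<open>l\<^sub>k v\<^sub>k\<close>. As \<open>w\<^sub>k \<in> P\<close>, its weight is at least the length of the
  cycle. The bound is attained: \<open>w\<^sub>k\<close> lies on two edges of \<open>P\<close> whose normals span a cone around
  \<open>v\<^sub>k\<close>, and expressing each \<open>v\<^sub>k\<close> by these normals yields a monomial, which has coefficient \<open>\<plusminus> 1\<close> for
  all of the finitely many configurations of such cones. In a top-dimensional cone of the
  secondary fan it is the only monomial of minimal weight, and the coefficient \<open>\<plusminus> 1\<close> makes this
  sufficient in every residue characteristic.
\<close>

section \<open>Executable sparse polynomials\<close>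

text \<open>The discriminant of a generic plane cubic is too long to be inspected monomial by
  monomial. The Weierstrass form with \<open>a1 = m\<close> reduces the task to five products of
  \<open>a1, a2, a3, a4, a6\<close> with coefficients \<open>1\<close> or \<open>-1\<close>. All
  monomials in \<open>a2, a3, a4, a6\<close> have their barycentre at the interior point, so they
  outweigh the power of \<open>m\<close> of the same degree. The margin comes from an interior point
  of \<open>P\<close>, which exists because there is a cycle.

  The other obstacle is degeneracy. A corner of the shape need not be a marked point, and if it is
  one, \<open>P\<close> may have a whole edge orthogonal to it. So the minimizer at a corner need
  not be unique and the corner need not span a ray of the normal fan of \<open>P\<close>; hence the
  lexicographic choice of the minimizers, and hence cones that contain the corner, possibly on their
  boundary. Cones of one fan do not overlap, which limits the configurations to be tested.

  The leading monomial depends only on the marked subdivision. It is therefore minimal for all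
  vectors of a cone of the secondary fan at once, and this is what makes it unique in the interior
  of the cone.\<close>

text \<open>Terms are pairs of a coefficient and the list of the factors; like terms need not be combined.\<close>

type_synonym lpt = "int \<times> int"
type_synonym sparse = "(int \<times> lpt list) list"

definition sp_eval :: "(lpt \<Rightarrow> 'r::comm_ring_1) \<Rightarrow> sparse \<Rightarrow> 'r" where
  "sp_eval f xs = (\<Sum>x\<leftarrow>xs. of_int (fst x) * (\<Prod>q\<leftarrow>snd x. f q))"

definition sp_mul :: "sparse \<Rightarrow> sparse \<Rightarrow> sparse" where
  "sp_mul xs ys = concat (map (\<lambda>x. map (\<lambda>y. (fst x * fst y, snd x @ snd y)) ys) xs)"

definition sp_scale :: "int \<Rightarrow> sparse \<Rightarrow> sparse" where
  "sp_scale c xs = map (\<lambda>x. (c * fst x, snd x)) xs"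

abbreviation sp_var :: "lpt \<Rightarrow> sparse" where "sp_var q \<equiv> [(1, [q])]"

fun sp_pow :: "sparse \<Rightarrow> nat \<Rightarrow> sparse" where
  "sp_pow xs 0 = [(1, [])]"
| "sp_pow xs (Suc n) = sp_mul xs (sp_pow xs n)"

lemma sp_eval_append [simp]: "sp_eval f (xs @ ys) = sp_eval f xs + sp_eval f ys"
  by (simp add: sp_eval_def)

lemma sp_eval_scale [simp]: "sp_eval f (sp_scale c xs) = of_int c * sp_eval f xs"
  by (induction xs) (simp_all add: sp_eval_def sp_scale_def algebra_simps)

lemma sp_eval_mul [simp]: "sp_eval f (sp_mul xs ys) = sp_eval f xs * sp_eval f ys"
proof (induction xs)
  case (Cons x xs)
  have "sp_eval f (map (\<lambda>y. (fst x * fst y, snd x @ snd y)) ys)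
      = of_int (fst x) * (\<Prod>q\<leftarrow>snd x. f q) * sp_eval f ys"
    by (induction ys) (simp_all add: sp_eval_def algebra_simps)
  with Cons show ?case
    by (simp add: sp_mul_def sp_eval_def algebra_simps)
qed (simp add: sp_mul_def sp_eval_def)

lemma sp_eval_pow [simp]: "sp_eval f (sp_pow xs n) = sp_eval f xs ^ n"
  by (induction n) (simp_all, simp add: sp_eval_def)

text \<open>Only \<open>a2, a3, a4, a6\<close> are listed, because \<open>a1\<close> is the variable
  at \<open>(1,1)\<close> for all three shapes.\<close>

definition sp_double_cover ::
  "sparse \<Rightarrow> sparse \<Rightarrow> sparse \<Rightarrow> sparse \<Rightarrow> sparse \<Rightarrow> sparse \<Rightarrow> sparse \<Rightarrow> sparse
     \<Rightarrow> sparse \<times> sparse \<times> sparse \<times> sparse" where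
  "sp_double_cover l m n a b c d e =
    (let S = sp_scale in
    (c @ S (-1) (sp_mul l n),
     sp_mul l d @ sp_mul n b,
     sp_mul b d @ S (-4) (sp_mul a e) @ S (-1) (sp_mul a (sp_mul n n))
       @ S (-1) (sp_mul c (sp_mul l n)) @ S (-1) (sp_mul e (sp_mul l l)),
     sp_mul a (sp_mul d (sp_mul m n)) @ sp_mul a (sp_mul d d) @ S (-4) (sp_mul a (sp_mul c e))
       @ S (-1) (sp_mul a (sp_mul c (sp_mul n n))) @ S (-1) (sp_mul a (sp_mul e (sp_mul m m)))
       @ S (-1) (sp_mul b (sp_mul d (sp_mul l n))) @ sp_mul b (sp_mul e (sp_mul l m))
       @ sp_mul b (sp_mul b e) @ S (-1) (sp_mul c (sp_mul e (sp_mul l l)))))"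

definition sp_triangle_42 :: "sparse \<times> sparse \<times> sparse \<times> sparse" where
  "sp_triangle_42 = sp_double_cover (sp_var (2,1)) (sp_var (1,1)) (sp_var (0,1))
     [(-1, [(0,2), (4,0)])] [(-1, [(0,2), (3,0)])] [(-1, [(0,2), (2,0)])]
     [(-1, [(0,2), (1,0)])] [(-1, [(0,2), (0,0)])]"

definition sp_square :: "sparse \<times> sparse \<times> sparse \<times> sparse" where
  "sp_square = sp_double_cover (sp_var (2,1)) (sp_var (1,1)) (sp_var (0,1))
     [(-1, [(2,2), (2,0)])]
     [(-1, [(2,2), (1,0)]), (-1, [(1,2), (2,0)])]
     [(-1, [(2,2), (0,0)]), (-1, [(1,2), (1,0)]), (-1, [(0,2), (2,0)])]
     [(-1, [(1,2), (0,0)]), (-1, [(0,2), (1,0)])]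
     [(-1, [(0,2), (0,0)])]"

definition sp_cubic :: "sparse \<times> sparse \<times> sparse \<times> sparse" where
  "sp_cubic =
    (let a = (3,0); b = (0,3); c = (0,0);
         a2 = (2,1); a3 = (2,0); b1 = (1,2); b3 = (0,2); c1 = (1,0); c2 = (0,1);
         m = (1,1)
     in
     ([(-1, [a2, c2]), (-1, [a3, b3]), (-1, [b1, c1])],
      [(9, [a, b, c]), (-1, [a, b3, c2]), (-1, [b, a3, c1]), (-1, [c, a2, b1]),
       (-1, [a2, b3, c1]), (-1, [a3, b1, c2])],
      [(1, [c, a2, a2, b3]), (1, [c, a3, b1, b1]), (1, [a2, a3, b3, c2]), (1, [b, a3, a3, c2]),
       (1, [a2, b1, c1, c2]), (1, [a, b1, c2, c2]), (1, [a3, b1, b3, c1]), (1, [a, b3, b3, c1]),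
       (1, [b, a2, c1, c1]), (-3, [a, c, b1, b3]), (-3, [b, c, a2, a3]), (-3, [a, b, c1, c2])],
      [(9, [a, a, b, c, b3, c2]), (3, [a, b, c, a3, b1, c2]), (2, [b, c, a2, a2, a3, c2]),
       (1, [m, a, c, b1, b1, c2]), (3, [a, b, c, a2, b3, c1]), (2, [b, c, a2, a3, a3, b3]),
       (2, [a, c, b1, b1, b3, c1]), (1, [m, c, a2, a3, b1, b3]), (1, [m, a, c, a2, b3, b3]),
       (2, [a, c, a3, b1, b3, b3]), (1, [m, b, c, a2, a2, c1]), (1, [m, b, c, a3, a3, b1]),
       (1, [m, m, m, a, b, c]), (9, [a, b, b, c, a3, c1]), (9, [a, b, c, c, a2, b1]),
       (1, [m, a, b1, b3, c1, c2]), (1, [m, b, a2, a3, c1, c2]), (2, [a, b, b1, c1, c1, c2]),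
       (2, [a, b, a2, c1, c2, c2]), (1, [m, a, b, a3, c2, c2]), (1, [m, a, b, b3, c1, c1]),
       (-1, [a, c, a2, b1, b3, c2]), (-3, [m, a, b, c, a2, c2]), (-1, [c, a2, a3, b1, b1, c2]),
       (-3, [m, a, b, c, a3, b3]), (-1, [c, a2, a2, b1, b3, c1]), (-1, [m, m, a, c, b1, b3]),
       (-1, [c, a3, a3, b1, b1, b3]), (-1, [c, a2, a2, a3, b3, b3]),
       (-1, [a, a, c, b3, b3, b3]), (-3, [m, a, b, c, b1, c1]), (-1, [b, c, a2, a3, b1, c1]),
       (-1, [m, m, b, c, a2, a3]), (-1, [b, b, c, a3, a3, a3]), (-1, [b, c, c, a2, a2, a2]),
       (-27, [a, a, b, b, c, c]), (-1, [a, c, c, b1, b1, b1]), (-1, [a, b, a3, b3, c1, c2]),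
       (-1, [a2, a3, b1, b3, c1, c2]), (-1, [a, a2, b3, b3, c1, c2]),
       (-1, [m, m, a, b, c1, c2]), (-1, [b, a3, a3, b1, c1, c2]), (-1, [b, a2, a2, c1, c1, c2]),
       (-1, [a, a3, b1, b3, c2, c2]), (-1, [b, a2, a3, a3, c2, c2]),
       (-1, [a, b1, b1, c1, c2, c2]), (-1, [a, a, b, c2, c2, c2]),
       (-1, [b, a2, a3, b3, c1, c1]), (-1, [a, b1, b3, b3, c1, c1]),
       (-1, [a, b, b, c1, c1, c1])]))"

fun sp_shape :: "shape \<Rightarrow> sparse \<times> sparse \<times> sparse \<times> sparse" where
  "sp_shape Triangle_42 = sp_triangle_42"
| "sp_shape Square = sp_square"
| "sp_shape Triangle_33 = sp_cubic"

lemma sp_eval_Nil: "sp_eval f [] = 0"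
  by (simp add: sp_eval_def)

lemma sp_eval_Cons: "sp_eval f (x # xs) = of_int (fst x) * (\<Prod>q\<leftarrow>snd x. f q) + sp_eval f xs"
  by (simp add: sp_eval_def)

lemma shape_weier_sparse:
  "shape_weier \<sigma> f = (case sp_shape \<sigma> of (A2, A3, A4, A6) \<Rightarrow>
     (f (1,1), sp_eval f A2, sp_eval f A3, sp_eval f A4, sp_eval f A6))"
proof (cases \<sigma>)
  case Triangle_42
  then show ?thesis
    by (simp add: weier_triangle_42_def weier_double_cover_def sp_triangle_42_def sp_double_cover_def
        sp_eval_Nil sp_eval_Cons power2_eq_square algebra_simps)
next
  case Square
  then show ?thesis
    by (simp add: weier_square_def weier_double_cover_def sp_square_def sp_double_cover_def
        sp_eval_Nil sp_eval_Cons power2_eq_square algebra_simps)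
next
  case Triangle_33
  then show ?thesis
    by (simp add: weier_cubic_def sp_cubic_def Let_def sp_eval_Nil sp_eval_Cons
        power2_eq_square power3_eq_cube algebra_simps)
qed

section \<open>The discriminant as a sum of terms\<close>

text \<open>
  The corners \<open>v\<close> of the three polygons relative to \<open>(1,1)\<close>, counterclockwise. The side starting at
  \<open>v\<close> ends at \<open>v + n d\<close>, and the multiplicity \<open>l\<close> is given by \<open>d - d' = - l v\<close>, where \<open>d'\<close> is the
  direction of the preceding side.
\<close>

fun frame :: "shape \<Rightarrow> (lpt \<times> lpt \<times> int \<times> int) list" where
  "frame Triangle_42 =
     [((-1,-1), (1,0), 4, 1), ((3,-1), (-2,1), 2, 1), ((-1,1), (0,-1), 2, 2)]"
| "frame Square =
     [((-1,-1), (1,0), 2, 1), ((1,-1), (0,1), 2, 1), ((1,1), (-1,0), 2, 1), ((-1,1), (0,-1), 2, 1)]"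
| "frame Triangle_33 =
     [((-1,-1), (1,0), 3, 1), ((2,-1), (-1,1), 3, 1), ((-1,2), (0,-1), 3, 1)]"

definition corner_mults :: "shape \<Rightarrow> (lpt \<times> int) list" where
  "corner_mults \<sigma> = map (\<lambda>(v, d, n, l). (v, l)) (frame \<sigma>)"

definition l1_norm :: "lpt \<Rightarrow> int" where
  "l1_norm p = \<bar>fst p\<bar> + \<bar>snd p\<bar>"

fun subtract_one :: "lpt \<Rightarrow> lpt list \<Rightarrow> lpt list list" where
  "subtract_one q [] = []"
| "subtract_one q (t # ts) = ((fst t - fst q, snd t - snd q) # ts) # map ((#) t) (subtract_one q ts)"

text \<open>
  Can the list of factors be split into groups with the prescribed sums? The comparison of the
  norms only prunes the search.
\<close>

fun distributable :: "lpt list \<Rightarrow> lpt list \<Rightarrow> bool" where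
  "distributable ts [] = list_all (\<lambda>t. t = (0,0)) ts"
| "distributable ts (q # qs) \<longleftrightarrow>
     sum_list (map l1_norm ts) \<le> sum_list (map l1_norm (q # qs)) \<and>
     list_ex (\<lambda>ts'. distributable ts' qs) (subtract_one q ts)"

definition centred :: "lpt list \<Rightarrow> lpt list" where
  "centred m = map (\<lambda>q. (fst q - 1, snd q - 1)) (filter (\<lambda>q. q \<noteq> (1,1)) m)"

text \<open>The prescribed sums are the corners with their multiplicities. Long factors are placed
  first, since they leave the least choice.\<close>

definition admissible :: "shape \<Rightarrow> lpt list \<Rightarrow> bool" where
  "admissible \<sigma> m \<longleftrightarrow>
     distributable (map (\<lambda>(v, l). (l * fst v, l * snd v)) (corner_mults \<sigma>)) (rev (sort_key l1_norm (centred m)))"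

text \<open>Powers are tested on the diagonal only: a power of a sum of monomials has no lighter
  monomial than the same power of a lightest summand.\<close>

definition disc_terms_admissible :: "shape \<Rightarrow> bool" where
  "disc_terms_admissible \<sigma> \<longleftrightarrow> (case sp_shape \<sigma> of (A2, A3, A4, A6) \<Rightarrow>
     list_all (\<lambda>x. admissible \<sigma> (snd x)) A6 \<and>
     list_all (\<lambda>x. list_all (\<lambda>y. admissible \<sigma> (snd x @ snd y)) A4) A3 \<and>
     list_all (\<lambda>x. list_all (\<lambda>y. admissible \<sigma> (snd x @ snd y @ snd y)) A3) A2 \<and>
     list_all (\<lambda>x. admissible \<sigma> (snd x @ snd x)) A4 \<and>
     list_all (\<lambda>x. admissible \<sigma> (snd x @ snd x @ snd x)) A3)"

text \<open>The barycentre is \<open>(1,1)\<close>, so adding to the weights a linear function of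
  the position relative to \<open>(1,1)\<close> does not change the weight of the monomial.
  Nonemptiness excludes powers of \<open>m\<close>.\<close>

definition balanced :: "nat \<Rightarrow> lpt list \<Rightarrow> bool" where
  "balanced d m \<longleftrightarrow> length m = d \<and> centred m \<noteq> [] \<and>
     sum_list (map fst (centred m)) = 0 \<and> sum_list (map snd (centred m)) = 0"

lemma balanced_sparse:
  "case sp_shape \<sigma> of (A2, A3, A4, A6) \<Rightarrow>
     list_all (\<lambda>x. balanced 2 (snd x)) A2 \<and> list_all (\<lambda>x. balanced 3 (snd x)) A3 \<and>
     list_all (\<lambda>x. balanced 4 (snd x)) A4 \<and> list_all (\<lambda>x. balanced 6 (snd x)) A6"
  by (cases \<sigma>) (simp only:; code_simp)+

section \<open>Configurations of cones\<close>

definition det2 :: "lpt \<Rightarrow> lpt \<Rightarrow> int" where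
  "det2 p q = fst p * snd q - snd p * fst q"

text \<open>Each side omits its end point, which is the starting point of the next side.\<close>

definition boundary :: "shape \<Rightarrow> lpt list" where
  "boundary \<sigma> = concat (map (\<lambda>(v, d, n, l).
     map (\<lambda>j. (fst v + j * fst d, snd v + j * snd d)) [0..n - 1]) (frame \<sigma>))"

definition cones_around :: "shape \<Rightarrow> lpt \<Rightarrow> (lpt \<times> lpt) list" where
  "cones_around \<sigma> v = filter (\<lambda>(q, r). det2 q r > 0 \<and> det2 q v \<ge> 0 \<and> det2 v r \<ge> 0)
     (List.product (boundary \<sigma>) (boundary \<sigma>))"

definition inside_cone :: "lpt \<times> lpt \<Rightarrow> lpt \<Rightarrow> bool" where
  "inside_cone p q \<longleftrightarrow> det2 (fst p) q > 0 \<and> det2 q (snd p) > 0"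

text \<open>The cones will be normal cones at vertices of a single polygon, and such cones contain
  no bounding ray of one another in their interiors.\<close>

definition compatible :: "lpt \<times> lpt \<Rightarrow> lpt \<times> lpt \<Rightarrow> bool" where
  "compatible p q \<longleftrightarrow> p = q \<or>
     (\<not> inside_cone p (fst q) \<and> \<not> inside_cone p (snd q) \<and>
      \<not> inside_cone q (fst p) \<and> \<not> inside_cone q (snd p))"

text \<open>
  The coefficients in \<open>l v = x p + y r\<close>, multiplied by \<open>12\<close> because all determinants that occur
  divide \<open>12\<close>.
\<close>

definition cone_vector :: "shape \<Rightarrow> lpt \<times> int \<Rightarrow> lpt \<times> lpt \<Rightarrow> int list" where
  "cone_vector \<sigma> = (\<lambda>(v, l) (p, r). map (\<lambda>q.
     l * (12 div det2 p r) * ((if q = p then det2 v r else 0) + (if q = r then det2 p v else 0)))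
     (boundary \<sigma>))"

fun configurations ::
  "'a list \<Rightarrow> ((lpt \<times> lpt) \<times> 'a::plus list) list list \<Rightarrow> ((lpt \<times> lpt) list \<times> 'a list) list" where
  "configurations z [] = [([], z)]"
| "configurations z (ps # pss) = concat (map (\<lambda>c.
     map (\<lambda>p. (fst p # fst c, map2 (+) (snd p) (snd c)))
       (filter (\<lambda>p. list_all (compatible (fst p)) (fst c)) ps)) (configurations z pss))"

definition all_configurations :: "shape \<Rightarrow> ((lpt \<times> lpt) list \<times> int list) list" where
  "all_configurations \<sigma> = configurations (map (\<lambda>q. 0) (boundary \<sigma>))
     (map (\<lambda>x. map (\<lambda>p. (p, cone_vector \<sigma> x p)) (cones_around \<sigma> (fst x))) (corner_mults \<sigma>))"

definition lead_monomial :: "shape \<Rightarrow> int list \<Rightarrow> lpt list" where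
  "lead_monomial \<sigma> e = concat (map (\<lambda>x. replicate (nat (snd x div 12)) (fst (fst x) + 1, snd (fst x) + 1))
     (zip (boundary \<sigma>) e))"

text \<open>Factors \<open>(1,1)\<close> are ignored, as their number is determined by the degree.\<close>

fun cancel :: "lpt list \<Rightarrow> lpt list \<Rightarrow> lpt list option" where
  "cancel [] n = Some n"
| "cancel (q # m) n = (if q = (1,1) then cancel m n
     else if q \<in> set n then cancel m (remove1 q n) else None)"

function product_coeff :: "sparse \<Rightarrow> sparse list \<Rightarrow> lpt list \<Rightarrow> int" where
  "product_coeff [] Ls n = 0"
| "product_coeff (x # L) Ls n =
     (case cancel (snd x) n of
        None \<Rightarrow> 0
      | Some n' \<Rightarrow> fst x * (case Ls of [] \<Rightarrow> if n' = [] then 1 else 0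
                            | L' # Ls' \<Rightarrow> product_coeff L' Ls' n'))
     + product_coeff L Ls n"
  by pat_completeness auto
termination by (relation "measures [\<lambda>(L, Ls, n). length Ls, \<lambda>(L, Ls, n). length L]") auto

text \<open>The signs are those of the five products of least weight in the discriminant; the powers
  of \<open>a1\<close> drop out because factors \<open>(1,1)\<close> are ignored.\<close>

definition disc_coeff :: "shape \<Rightarrow> lpt list \<Rightarrow> int" where
  "disc_coeff \<sigma> n = (case sp_shape \<sigma> of (A2, A3, A4, A6) \<Rightarrow>
     product_coeff A3 [A4] n - product_coeff A6 [] n - product_coeff A2 [A3, A3] n
     + product_coeff A4 [A4] n + product_coeff A3 [A3, A3] n)"

definition lead_ok :: "shape \<Rightarrow> int list \<Rightarrow> bool" where
  "lead_ok \<sigma> e \<longleftrightarrow> list_all (\<lambda>k. 0 \<le> k \<and> 12 dvd k) e \<and> length (lead_monomial \<sigma> e) \<le> 12 \<and>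
     \<bar>disc_coeff \<sigma> (lead_monomial \<sigma> e)\<bar> = 1"

text \<open>Different configurations may yield the same vector; the accumulator spares repeated
  evaluations of \<open>P\<close>.\<close>

fun all_distinct :: "('a \<Rightarrow> bool) \<Rightarrow> 'a list \<Rightarrow> 'a list \<Rightarrow> bool" where
  "all_distinct P acc [] \<longleftrightarrow> True"
| "all_distinct P acc (x # xs) \<longleftrightarrow> (if x \<in> set acc then all_distinct P acc xs else P x \<and> all_distinct P (x # acc) xs)"

section \<open>The filtration by weight\<close>

definition weight :: "lpt set \<Rightarrow> (lpt \<Rightarrow> real) \<Rightarrow> (lpt \<Rightarrow>\<^sub>0 nat) \<Rightarrow> real" where
  "weight A u e = (\<Sum>p\<in>A. u p * real (Poly_Mapping.lookup e p))"

text \<open>The condition on the support ensures that \<open>weight\<close>, a sum over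
  \<open>A\<close>, sees every variable that occurs.\<close>

definition heavy :: "lpt set \<Rightarrow> (lpt \<Rightarrow> real) \<Rightarrow> real \<Rightarrow> coeff_poly set" where
  "heavy A u r = {H. \<forall>e\<in>Poly_Mapping.keys H. Poly_Mapping.keys e \<subseteq> A \<and> r \<le> weight A u e}"

lemma weight_0 [simp]: "weight A u 0 = 0"
  by (simp add: weight_def)

lemma weight_add: "weight A u (d + e) = weight A u d + weight A u e"
  by (simp add: weight_def lookup_add algebra_simps sum.distrib)

lemma heavy_0 [simp]: "0 \<in> heavy A u r"
  by (simp add: heavy_def)

lemma heavy_mono: "H \<in> heavy A u r \<Longrightarrow> s \<le> r \<Longrightarrow> H \<in> heavy A u s"
  by (force simp: heavy_def)

lemma heavy_add: "H \<in> heavy A u r \<Longrightarrow> K \<in> heavy A u r \<Longrightarrow> H + K \<in> heavy A u r"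
  using Poly_Mapping.keys_add[of H K] by (auto simp: heavy_def)

lemma heavy_uminus: "H \<in> heavy A u r \<Longrightarrow> - H \<in> heavy A u r"
  by (simp add: heavy_def)

lemma heavy_diff: "H \<in> heavy A u r \<Longrightarrow> K \<in> heavy A u r \<Longrightarrow> H - K \<in> heavy A u r"
  using heavy_add[of H A u r "- K"] heavy_uminus[of K] by simp

lemma heavy_mult:
  assumes "H \<in> heavy A u r" "K \<in> heavy A u s"
  shows "H * K \<in> heavy A u (r + s)"
proof -
  have "Poly_Mapping.keys e \<subseteq> A \<and> r + s \<le> weight A u e" if "e \<in> Poly_Mapping.keys (H * K)" for e
  proof -
    obtain a b where ab: "e = a + b" "a \<in> Poly_Mapping.keys H" "b \<in> Poly_Mapping.keys K"
      using Poly_Mapping.keys_mult[of H K] \<open>e \<in> _\<close> by blast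
    with assms have "Poly_Mapping.keys a \<subseteq> A" "Poly_Mapping.keys b \<subseteq> A"
        "r \<le> weight A u a" "s \<le> weight A u b"
      by (auto simp: heavy_def)
    then show ?thesis
      using Poly_Mapping.keys_add[of a b] unfolding \<open>e = a + b\<close> weight_add by auto
  qed
  then show ?thesis
    by (simp add: heavy_def)
qed

lemma of_int_eq_single: "(of_int c :: coeff_poly) = Poly_Mapping.single 0 c"
proof -
  have "Poly_Mapping.single 0 (of_int c :: int) = (of_int c :: coeff_poly)"
    by (rule single_of_int)
  then show ?thesis
    unfolding of_int_eq_id id_apply by (rule sym)
qed

lemma heavy_of_int: "of_int c \<in> heavy A u 0"
  by (simp add: heavy_def of_int_eq_single)

lemma heavy_numeral: "numeral c \<in> heavy A u 0"
  using heavy_of_int[of "numeral c"] by simp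

lemma heavy_1: "1 \<in> heavy A u 0"
  using heavy_of_int[of 1] by simp

lemma heavy_power: "H \<in> heavy A u r \<Longrightarrow> H ^ n \<in> heavy A u (real n * r)"
proof (induction n)
  case (Suc n)
  then show ?case
    using heavy_mult[of H A u r "H ^ n" "real n * r"] by (simp add: algebra_simps)
qed (simp add: heavy_1)

lemma weight_single: "finite A \<Longrightarrow> p \<in> A \<Longrightarrow> weight A u (Poly_Mapping.single p n) = u p * real n"
  by (simp add: weight_def lookup_single when_def if_distrib sum.delta cong: if_cong)

lemma heavy_coeff_var: "finite A \<Longrightarrow> p \<in> A \<Longrightarrow> coeff_var p \<in> heavy A u (u p)"
  by (simp add: heavy_def coeff_var_def weight_single)

lemmas heavy_monomial = heavy_mult heavy_power heavy_numeral

text \<open>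
  In a Weierstrass equation whose coefficients \<open>a2, a3, a4, a6\<close> are heavier than the corresponding
  powers of \<open>a1\<close>, the terms of minimal weight of the discriminant are among the five terms
  subtracted here.
\<close>

lemma weier_disc_expansion:
  fixes a1 a2 a3 a4 a6 :: "'r::comm_ring_1"
  shows "weier_disc (a1, a2, a3, a4, a6) - (a1^5 * a3 * a4 - a1^6 * a6 - a1^4 * a2 * a3^2 + a1^4 * a4^2 + a1^3 * a3^3) =
      72 * a1^2 * a4 * a6 + 36 * a1^3 * a3 * a6 + 288 * a2 * a4 * a6 + 144 * a1 * a2 * a3 * a6
      - 12 * a1^4 * a2 * a6 - 48 * a1^2 * a2^2 * a6 - 64 * a2^3 * a6 - 216 * a3^2 * a6
      - 432 * a6^2 - 30 * a1^2 * a3^2 * a4 + 72 * a2 * a3^2 * a4 + 8 * a1^3 * a2 * a3 * a4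
      + 16 * a1 * a2^2 * a3 * a4 - 96 * a1 * a3 * a4^2 + 36 * a1 * a2 * a3^3 - 8 * a1^2 * a2^2 * a3^2
      - 16 * a2^3 * a3^2 + 8 * a1^2 * a2 * a4^2 + 16 * a2^2 * a4^2 - 64 * a4^3 - 27 * a3^4"
  unfolding weier_disc_def Let_def prod.case
  by (simp add: algebra_simps eval_nat_numeral)

lemma weier_c4_cube_expansion:
  fixes a1 a2 a3 a4 a6 :: "'r::comm_ring_1"
  assumes "x = 8 * a1^2 * a2 + 16 * a2^2 - 48 * a4 - 24 * a1 * a3"
  shows "weier_c4 (a1, a2, a3, a4, a6) ^ 3 - a1^12 = 3 * a1^8 * x + 3 * a1^4 * x^2 + x^3"
proof -
  have "weier_c4 (a1, a2, a3, a4, a6) = a1^4 + x"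
    unfolding assms weier_c4_def by (simp add: algebra_simps eval_nat_numeral)
  then show ?thesis
    by (simp add: algebra_simps eval_nat_numeral)
qed

text \<open>Each remaining term of the expansion arises from one of the five by exchanging a power
  of \<open>a1\<close> for coefficients of the same degree, and every such exchange gains at least
  \<open>\<epsilon>\<close>. For instance \<open>a2 * a4 * a6\<close> comes from
  \<open>a1^6 * a6\<close>.\<close>

lemma disc_minus_lead_heavy:
  assumes h: "a1 \<in> heavy A u c" "a2 \<in> heavy A u \<alpha>2" "a3 \<in> heavy A u \<alpha>3" "a4 \<in> heavy A u \<alpha>4"
      "a6 \<in> heavy A u \<alpha>6"
    and le: "2 * c + \<epsilon> \<le> \<alpha>2" "3 * c + \<epsilon> \<le> \<alpha>3" "4 * c + \<epsilon> \<le> \<alpha>4" "6 * c + \<epsilon> \<le> \<alpha>6" "0 \<le> \<epsilon>"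
    and R: "R \<le> 6 * c + \<alpha>6" "R \<le> 5 * c + \<alpha>3 + \<alpha>4" "R \<le> 4 * c + \<alpha>2 + 2 * \<alpha>3"
      "R \<le> 4 * c + 2 * \<alpha>4" "R \<le> 3 * c + 3 * \<alpha>3"
  defines "lead \<equiv> a1^5 * a3 * a4 - a1^6 * a6 - a1^4 * a2 * a3^2 + a1^4 * a4^2 + a1^3 * a3^3"
  shows "lead \<in> heavy A u R" and "weier_disc (a1, a2, a3, a4, a6) - lead \<in> heavy A u (R + \<epsilon>)"
proof -
  show "lead \<in> heavy A u R"
    unfolding lead_def
    apply (intro heavy_add heavy_diff)
        apply (rule heavy_mono, (rule heavy_monomial h)+, insert le R, simp)+
    done
  show "weier_disc (a1, a2, a3, a4, a6) - lead \<in> heavy A u (R + \<epsilon>)"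
    unfolding lead_def weier_disc_expansion
    apply (intro heavy_add heavy_diff)
    apply (rule heavy_mono, (rule heavy_monomial h)+, insert le R, simp)+
    done
qed

lemma c4_cube_heavy:
  assumes h: "a1 \<in> heavy A u c" "a2 \<in> heavy A u \<alpha>2" "a3 \<in> heavy A u \<alpha>3" "a4 \<in> heavy A u \<alpha>4"
      "a6 \<in> heavy A u \<alpha>6"
    and le: "2 * c + \<epsilon> \<le> \<alpha>2" "3 * c + \<epsilon> \<le> \<alpha>3" "4 * c + \<epsilon> \<le> \<alpha>4" "0 \<le> \<epsilon>"
  shows "weier_c4 (a1, a2, a3, a4, a6) ^ 3 - a1^12 \<in> heavy A u (12 * c + \<epsilon>)"
proof -
  define x where "x = 8 * a1^2 * a2 + 16 * a2^2 - 48 * a4 - 24 * a1 * a3"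
  have x: "x \<in> heavy A u (4 * c + \<epsilon>)"
    unfolding x_def
    apply (intro heavy_add heavy_diff)
       apply (rule heavy_mono, (rule heavy_monomial h)+, insert le, simp)+
    done
  have "weier_c4 (a1, a2, a3, a4, a6) ^ 3 - a1^12 = 3 * a1^8 * x + 3 * a1^4 * x^2 + x^3"
    by (rule weier_c4_cube_expansion) (simp add: x_def)
  also have "\<dots> \<in> heavy A u (12 * c + \<epsilon>)"
    apply (intro heavy_add heavy_diff)
      apply (rule heavy_mono, (rule heavy_monomial h x)+, insert le, simp)+
    done
  finally show ?thesis .
qed

lemma prod_list_heavy:
  assumes "\<And>q. f q \<in> heavy A u (U q)"
  shows "(\<Prod>q\<leftarrow>m. f q) \<in> heavy A u (\<Sum>q\<leftarrow>m. U q)"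
  using assms by (induction m) (simp_all add: heavy_1 heavy_mult)

lemma sp_eval_heavy:
  assumes "\<And>q. f q \<in> heavy A u (U q)" and "\<And>x. x \<in> set xs \<Longrightarrow> r \<le> (\<Sum>q\<leftarrow>snd x. U q)"
  shows "sp_eval f xs \<in> heavy A u r"
  using assms(2)
proof (induction xs)
  case (Cons x xs)
  have "of_int (fst x) * (\<Prod>q\<leftarrow>snd x. f q) \<in> heavy A u (0 + (\<Sum>q\<leftarrow>snd x. U q))"
    by (intro heavy_mult heavy_of_int prod_list_heavy assms)
  then have "of_int (fst x) * (\<Prod>q\<leftarrow>snd x. f q) \<in> heavy A u r"
    by (rule heavy_mono) (use Cons.prems[of x] in simp)
  with Cons show ?case
    by (simp add: sp_eval_Cons heavy_add)
qed (simp add: sp_eval_Nil)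

section \<open>Lower bounds for the weights of monomials\<close>

definition pairing :: "lpt \<Rightarrow> real \<times> real \<Rightarrow> real" where
  "pairing q w = of_int (fst q) * fst w + of_int (snd q) * snd w"

text \<open>Linearity of the pairing: taking \<open>q\<close> away from the target of one corner
  costs the pairing of \<open>q\<close> with the point of that corner.\<close>

lemma subtract_one_pairing:
  assumes "ts' \<in> set (subtract_one q ts)" "length ws = length ts"
  shows "\<exists>w\<in>set ws. (\<Sum>x\<leftarrow>zip ts ws. pairing (fst x) (snd x))
     = (\<Sum>x\<leftarrow>zip ts' ws. pairing (fst x) (snd x)) + pairing q w \<and> length ts' = length ts"
  using assms
proof (induction ts arbitrary: ts' ws)
  case (Cons t ts)
  then obtain w ws' where ws: "ws = w # ws'" "length ws' = length ts"
    by (cases ws) auto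
  from Cons.prems(1) consider "ts' = (fst t - fst q, snd t - snd q) # ts"
    | ts'' where "ts' = t # ts''" "ts'' \<in> set (subtract_one q ts)"
    by auto
  then show ?case
  proof cases
    case 1
    then show ?thesis
      by (intro bexI[of _ w]) (simp_all add: ws pairing_def algebra_simps)
  next
    case 2
    from Cons.IH[OF 2(2) ws(2)] show ?thesis
      by (auto simp: ws 2)
  qed
qed simp

text \<open>Weak duality. A factor \<open>q\<close> assigned to a corner with point \<open>w\<close>
  satisfies \<open>- pairing q w \<le> h q\<close>, and the sum of these inequalities involves only
  the prescribed sums.\<close>

lemma distributable_bound:
  assumes "distributable ts qs" "length ws = length ts"
    and "\<And>q w. q \<in> set qs \<Longrightarrow> w \<in> set ws \<Longrightarrow> - pairing q w \<le> h q"
  shows "- (\<Sum>x\<leftarrow>zip ts ws. pairing (fst x) (snd x)) \<le> (\<Sum>q\<leftarrow>qs. h q)"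
  using assms
proof (induction ts qs rule: distributable.induct)
  case (1 ts)
  have "pairing (fst x) (snd x) = 0" if "x \<in> set (zip ts ws)" for x
    using 1(1) that by (cases x) (auto simp: list_all_iff pairing_def dest!: set_zip_leftD)
  then have "(\<Sum>x\<leftarrow>zip ts ws. pairing (fst x) (snd x)) = 0"
    by (metis (mono_tags, lifting) map_eq_conv sum_list_0)
  then show ?case
    by simp
next
  case (2 ts q qs)
  then obtain ts' where ts': "ts' \<in> set (subtract_one q ts)" "distributable ts' qs"
    by (auto simp: list_ex_iff)
  obtain w where w: "w \<in> set ws" "(\<Sum>x\<leftarrow>zip ts ws. pairing (fst x) (snd x))
     = (\<Sum>x\<leftarrow>zip ts' ws. pairing (fst x) (snd x)) + pairing q w" "length ts' = length ts"
    using subtract_one_pairing[OF ts'(1) 2(3)] by blast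
  have "- (\<Sum>x\<leftarrow>zip ts' ws. pairing (fst x) (snd x)) \<le> (\<Sum>q\<leftarrow>qs. h q)"
    using 2 ts' w(3) by (intro 2(1)) auto
  moreover have "- pairing q w \<le> h q"
    using 2(4) w(1) by simp
  ultimately show ?case
    using w(2) by simp
qed

lemma sum_centred:
  fixes U :: "lpt \<Rightarrow> real"
  shows "(\<Sum>q\<leftarrow>centred m. U (fst q + 1, snd q + 1) - U (1,1)) = (\<Sum>q\<leftarrow>m. U q) - real (length m) * U (1,1)"
  by (induction m) (auto simp: centred_def algebra_simps)

text \<open>The length of the cycle if the points \<open>ws\<close> are the minimizers at the corners.\<close>

definition excess :: "shape \<Rightarrow> (real \<times> real) list \<Rightarrow> real" where
  "excess \<sigma> ws = - (\<Sum>x\<leftarrow>zip (corner_mults \<sigma>) ws. of_int (snd (fst x)) * pairing (fst (fst x)) (snd x))"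

lemma sum_list_sort_rev: "(\<Sum>q\<leftarrow>rev (sort_key g xs). (h q :: real)) = (\<Sum>q\<leftarrow>xs. h q)"
  by (metis mset_map mset_rev mset_sort sum_mset_sum_list)

lemma admissible_bound:
  assumes "admissible \<sigma> m" "length ws = length (frame \<sigma>)"
    and "\<And>q w. w \<in> set ws \<Longrightarrow> U (1,1) - pairing (fst q - 1, snd q - 1) w \<le> U q"
  shows "real (length m) * U (1,1) + excess \<sigma> ws \<le> (\<Sum>q\<leftarrow>m. U q)"
proof -
  define ts where "ts = map (\<lambda>(v, l). (l * fst v, l * snd v)) (corner_mults \<sigma>)"
  have "- (\<Sum>x\<leftarrow>zip ts ws. pairing (fst x) (snd x))
      \<le> (\<Sum>q\<leftarrow>rev (sort_key l1_norm (centred m)). U (fst q + 1, snd q + 1) - U (1,1))"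
  proof (rule distributable_bound)
    show "distributable ts (rev (sort_key l1_norm (centred m)))"
      using assms(1) by (simp add: admissible_def ts_def)
    show "length ws = length ts"
      using assms(2) by (simp add: ts_def corner_mults_def)
    show "- pairing q w \<le> U (fst q + 1, snd q + 1) - U (1,1)" if "w \<in> set ws" for q w
      using assms(3)[OF that, of "(fst q + 1, snd q + 1)"] by simp
  qed
  moreover have "(\<Sum>x\<leftarrow>zip ts ws. pairing (fst x) (snd x)) = - excess \<sigma> ws"
    unfolding ts_def excess_def zip_map1 map_map
    by (simp add: case_prod_beta comp_def pairing_def algebra_simps)
  ultimately show ?thesis
    using sum_centred[of U m] by (simp add: sum_list_sort_rev)
qed

text \<open>Every factor other than \<open>(1,1)\<close> contributes at least
  \<open>\<epsilon>\<close> minus its pairing with \<open>w\<close>. The pairings cancel by balance,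
  and at least one \<open>\<epsilon>\<close> remains.\<close>

lemma balanced_bound:
  assumes "balanced d m" "0 \<le> \<epsilon>"
    and "\<And>q. q \<noteq> (1,1) \<Longrightarrow> U (1,1) - pairing (fst q - 1, snd q - 1) w + \<epsilon> \<le> U q"
  shows "real d * U (1,1) + \<epsilon> \<le> (\<Sum>q\<leftarrow>m. U q)"
proof -
  have ge: "\<epsilon> - pairing q w \<le> U (fst q + 1, snd q + 1) - U (1,1)" if qm: "q \<in> set (centred m)" for q
  proof -
    obtain p where "p \<noteq> (1,1)" "q = (fst p - 1, snd p - 1)"
      using qm unfolding centred_def set_map set_filter by blast
    then show ?thesis
      using assms(3)[of p] by simp
  qed
  have "real (length xs) * \<epsilon> - (of_int (sum_list (map fst xs)) * fst w + of_int (sum_list (map snd xs)) * snd w)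
      \<le> (\<Sum>q\<leftarrow>xs. U (fst q + 1, snd q + 1) - U (1,1))" if "set xs \<subseteq> set (centred m)" for xs
    using that
  proof (induction xs)
    case (Cons q xs)
    then show ?case
      using ge[of q] by (simp add: pairing_def algebra_simps)
  qed simp
  from this[of "centred m"] have "real (length (centred m)) * \<epsilon> \<le> (\<Sum>q\<leftarrow>m. U q) - real d * U (1,1)"
    using assms(1) sum_centred[of U m] by (simp add: balanced_def)
  moreover have "\<epsilon> \<le> real (length (centred m)) * \<epsilon>"
    using assms(1,2) by (cases "centred m") (auto simp: balanced_def algebra_simps)
  ultimately show ?thesis
    by linarith
qed

definition min_weight :: "(lpt \<Rightarrow> real) \<Rightarrow> sparse \<Rightarrow> real" where
  "min_weight U xs = Min ((\<lambda>x. \<Sum>q\<leftarrow>snd x. U q) ` set xs)"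

lemma min_weight_le: "x \<in> set xs \<Longrightarrow> min_weight U xs \<le> (\<Sum>q\<leftarrow>snd x. U q)"
  unfolding min_weight_def by (intro Min_le) auto

lemma min_weight_attained:
  assumes "xs \<noteq> []"
  obtains x where "x \<in> set xs" "min_weight U xs = (\<Sum>q\<leftarrow>snd x. U q)"
proof -
  have "min_weight U xs \<in> (\<lambda>x. \<Sum>q\<leftarrow>snd x. U q) ` set xs"
    unfolding min_weight_def using assms by (intro Min_in) auto
  with that show thesis
    by blast
qed

lemma disc_terms: "disc_terms_admissible \<sigma>"
  by (cases \<sigma>) (simp only:; code_simp)+

lemma sparse_nonempty:
  "case sp_shape \<sigma> of (A2, A3, A4, A6) \<Rightarrow> A2 \<noteq> [] \<and> A3 \<noteq> [] \<and> A4 \<noteq> [] \<and> A6 \<noteq> []"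
  by (cases \<sigma>) (simp only:; code_simp)+

definition disc_lead :: "'r::comm_ring_1 weierstrass \<Rightarrow> 'r" where
  "disc_lead = (\<lambda>(a1, a2, a3, a4, a6).
     a1^5 * a3 * a4 - a1^6 * a6 - a1^4 * a2 * a3^2 + a1^4 * a4^2 + a1^3 * a3^3)"

text \<open>Two kinds of points enter. The points \<open>ws\<close> of \<open>P\<close> bound the
  five leading products through the distribution of their factors; the strictly feasible
  \<open>w0\<close> gives the margin \<open>\<epsilon>\<close> by which the other terms are
  heavier.\<close>

lemma shape_heavy:
  assumes f: "\<And>q. f q \<in> heavy A u (U q)" and len: "length ws = length (frame \<sigma>)" and "0 \<le> \<epsilon>"
    and ws: "\<And>q w. w \<in> set ws \<Longrightarrow> U (1,1) - pairing (fst q - 1, snd q - 1) w \<le> U q"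
    and w0: "\<And>q. q \<noteq> (1,1) \<Longrightarrow> U (1,1) - pairing (fst q - 1, snd q - 1) w0 + \<epsilon> \<le> U q"
  defines "R \<equiv> 12 * U (1,1) + excess \<sigma> ws"
  shows "disc_lead (shape_weier \<sigma> f) \<in> heavy A u R"
    and "weier_disc (shape_weier \<sigma> f) - disc_lead (shape_weier \<sigma> f) \<in> heavy A u (R + \<epsilon>)"
    and "weier_c4 (shape_weier \<sigma> f) ^ 3 - f (1,1) ^ 12 \<in> heavy A u (12 * U (1,1) + \<epsilon>)"
proof -
  obtain A2 A3 A4 A6 where sp: "sp_shape \<sigma> = (A2, A3, A4, A6)"
    by (metis prod_cases4)
  note bal = balanced_sparse[of \<sigma>, unfolded sp prod.case list_all_iff]
  note ne = sparse_nonempty[of \<sigma>, unfolded sp prod.case]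
  note adm = disc_terms[of \<sigma>, unfolded disc_terms_admissible_def sp prod.case list_all_iff]
  let ?c = "U (1,1)" and ?\<alpha> = "min_weight U"
  have sw: "shape_weier \<sigma> f = (f (1,1), sp_eval f A2, sp_eval f A3, sp_eval f A4, sp_eval f A6)"
    by (simp add: shape_weier_sparse sp)
  have h: "f (1,1) \<in> heavy A u ?c" "sp_eval f A2 \<in> heavy A u (?\<alpha> A2)" "sp_eval f A3 \<in> heavy A u (?\<alpha> A3)"
    "sp_eval f A4 \<in> heavy A u (?\<alpha> A4)" "sp_eval f A6 \<in> heavy A u (?\<alpha> A6)"
    by (auto intro!: sp_eval_heavy f min_weight_le)
  have le: "real d * ?c + \<epsilon> \<le> ?\<alpha> xs" if xs: "xs \<noteq> []" "\<forall>x\<in>set xs. balanced d (snd x)" for xs d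
  proof -
    obtain x where x: "x \<in> set xs" "?\<alpha> xs = (\<Sum>q\<leftarrow>snd x. U q)"
      using min_weight_attained[OF xs(1), of U] by blast
    show ?thesis
      unfolding x(2) using xs(2) x(1) by (intro balanced_bound[OF _ \<open>0 \<le> \<epsilon>\<close> w0]) auto
  qed
  have le': "2 * ?c + \<epsilon> \<le> ?\<alpha> A2" "3 * ?c + \<epsilon> \<le> ?\<alpha> A3" "4 * ?c + \<epsilon> \<le> ?\<alpha> A4" "6 * ?c + \<epsilon> \<le> ?\<alpha> A6"
    using le[of A2 2] le[of A3 3] le[of A4 4] le[of A6 6] bal ne by auto
  have len_bal: "length m = d" if "balanced d m" for d m
    using that by (simp add: balanced_def)
  note bound = admissible_bound[OF _ len ws]
  obtain x2 where x2: "x2 \<in> set A2" "?\<alpha> A2 = (\<Sum>q\<leftarrow>snd x2. U q)"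
    using min_weight_attained ne by metis
  obtain x3 where x3: "x3 \<in> set A3" "?\<alpha> A3 = (\<Sum>q\<leftarrow>snd x3. U q)"
    using min_weight_attained ne by metis
  obtain x4 where x4: "x4 \<in> set A4" "?\<alpha> A4 = (\<Sum>q\<leftarrow>snd x4. U q)"
    using min_weight_attained ne by metis
  obtain x6 where x6: "x6 \<in> set A6" "?\<alpha> A6 = (\<Sum>q\<leftarrow>snd x6. U q)"
    using min_weight_attained ne by metis
  have lens: "length (snd x2) = 2" "length (snd x3) = 3" "length (snd x4) = 4" "length (snd x6) = 6"
    using bal x2 x3 x4 x6 len_bal by auto
  have "admissible \<sigma> (snd x6)" "admissible \<sigma> (snd x3 @ snd x4)" "admissible \<sigma> (snd x2 @ snd x3 @ snd x3)"
    "admissible \<sigma> (snd x4 @ snd x4)" "admissible \<sigma> (snd x3 @ snd x3 @ snd x3)"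
    using adm x2(1) x3(1) x4(1) x6(1) by blast+
  from this[THEN bound] have R: "R \<le> 6 * ?c + ?\<alpha> A6" "R \<le> 5 * ?c + ?\<alpha> A3 + ?\<alpha> A4"
      "R \<le> 4 * ?c + ?\<alpha> A2 + 2 * ?\<alpha> A3" "R \<le> 4 * ?c + 2 * ?\<alpha> A4" "R \<le> 3 * ?c + 3 * ?\<alpha> A3"
    unfolding R_def x2(2) x3(2) x4(2) x6(2) map_append sum_list_append length_append lens by simp_all
  show "disc_lead (shape_weier \<sigma> f) \<in> heavy A u R"
    unfolding sw disc_lead_def prod.case
    by (rule disc_minus_lead_heavy(1)[OF h le' \<open>0 \<le> \<epsilon>\<close> R])
  show "weier_disc (shape_weier \<sigma> f) - disc_lead (shape_weier \<sigma> f) \<in> heavy A u (R + \<epsilon>)"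
    unfolding sw disc_lead_def prod.case
    by (rule disc_minus_lead_heavy(2)[OF h le' \<open>0 \<le> \<epsilon>\<close> R])
  show "weier_c4 (shape_weier \<sigma> f) ^ 3 - f (1,1) ^ 12 \<in> heavy A u (12 * ?c + \<epsilon>)"
    unfolding sw by (rule c4_cube_heavy[OF h le'(1-3) \<open>0 \<le> \<epsilon>\<close>])
qed

section \<open>Coefficients of the discriminant\<close>

text \<open>The map \<open>\<psi>\<close> leads from the points of the normal form back to the
  variables of the original marking.\<close>

definition expo :: "(lpt \<Rightarrow> lpt) \<Rightarrow> lpt list \<Rightarrow> lpt \<Rightarrow>\<^sub>0 nat" where
  "expo \<psi> m = (\<Sum>q\<leftarrow>m. Poly_Mapping.single (\<psi> q) 1)"

lemma expo_simps [simp]: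
  "expo \<psi> [] = 0" "expo \<psi> (q # m) = Poly_Mapping.single (\<psi> q) 1 + expo \<psi> m"
  "expo \<psi> (m @ n) = expo \<psi> m + expo \<psi> n"
  by (simp_all add: expo_def)

lemma lookup_expo: "inj \<psi> \<Longrightarrow> Poly_Mapping.lookup (expo \<psi> m) (\<psi> q) = count (mset m) q"
  by (induction m) (simp_all add: lookup_add lookup_single when_def inj_eq)

lemma expo_mset: "expo \<psi> m = (\<Sum>q\<in>#mset m. Poly_Mapping.single (\<psi> q) 1)"
  by (induction m) simp_all

lemma expo_eq_iff: "inj \<psi> \<Longrightarrow> expo \<psi> m = expo \<psi> n \<longleftrightarrow> mset m = mset n"
proof
  assume "inj \<psi>" "expo \<psi> m = expo \<psi> n"
  then show "mset m = mset n"
    by (metis lookup_expo multiset_eqI)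
next
  assume "mset m = mset n"
  then show "expo \<psi> m = expo \<psi> n"
    by (simp add: expo_mset)
qed

lemma weight_expo:
  assumes "finite A" "\<psi> ` set m \<subseteq> A"
  shows "weight A u (expo \<psi> m) = (\<Sum>q\<leftarrow>m. u (\<psi> q))"
  using assms(2) by (induction m) (simp_all add: weight_add weight_single assms(1))

lemma prod_list_coeff_var:
  "(\<Prod>q\<leftarrow>m. coeff_var (\<psi> q)) = Poly_Mapping.single (expo \<psi> m) 1"
  by (induction m) (simp_all add: coeff_var_def mult_single)

lemma lookup_prod_list:
  assumes "inj \<psi>" "\<And>q. f q = (if q \<in> S then coeff_var (\<psi> q) else 0)" "set n \<subseteq> S"
  shows "Poly_Mapping.lookup (\<Prod>q\<leftarrow>m. f q) (expo \<psi> n) = (if mset m = mset n then 1 else 0)"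
proof (cases "set m \<subseteq> S")
  case True
  then have "(\<Prod>q\<leftarrow>m. f q) = (\<Prod>q\<leftarrow>m. coeff_var (\<psi> q))"
    using assms(2) by (intro arg_cong[of _ _ prod_list] map_cong) auto
  then show ?thesis
    using assms(1) by (simp add: prod_list_coeff_var lookup_single when_def expo_eq_iff)
next
  case False
  then have "(\<Prod>q\<leftarrow>m. f q) = 0"
    using assms(2) by (induction m) auto
  moreover have "mset m \<noteq> mset n"
    using False assms(3) by (metis set_mset_mset)
  ultimately show ?thesis
    by simp
qed

abbreviation strip :: "lpt list \<Rightarrow> lpt list" where
  "strip m \<equiv> filter (\<lambda>q. q \<noteq> (1,1)) m"

definition sp_coeff :: "sparse \<Rightarrow> lpt list \<Rightarrow> int" where
  "sp_coeff xs n = (\<Sum>x\<leftarrow>xs. if mset (strip (snd x)) = mset n then fst x else 0)"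

lemma cancel_Some: "cancel m n = Some n' \<Longrightarrow> mset n = mset (strip m) + mset n'"
proof (induction m n rule: cancel.induct)
  case (2 q m n)
  show ?case
  proof (cases "q = (1,1)")
    case True
    with 2 show ?thesis
      by simp
  next
    case False
    with 2 have "q \<in> set n" "mset (remove1 q n) = mset (strip m) + mset n'"
      by (auto split: if_splits)
    then have "mset n = add_mset q (mset (strip m) + mset n')"
      by (metis insert_DiffM mset_remove1 set_mset_mset)
    with False show ?thesis
      by simp
  qed
qed simp

lemma cancel_None: "cancel m n = None \<Longrightarrow> mset n \<noteq> mset (strip m) + K"
proof (induction m n rule: cancel.induct)
  case (2 q m n)
  consider "q = (1,1)" | "q \<noteq> (1,1)" "q \<notin> set n" | "q \<noteq> (1,1)" "q \<in> set n"
    by blast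
  then show ?case
  proof cases
    case 1
    with 2 show ?thesis
      by simp
  next
    case 2
    then have "mset (strip (q # m)) + K = add_mset q (mset (strip m) + K)"
      by simp
    with 2(2) show ?thesis
      by (metis set_mset_mset union_single_eq_member)
  next
    case 3
    with 2 have "mset (remove1 q n) \<noteq> mset (strip m) + K"
      by simp
    with 3 show ?thesis
      by auto
  qed
qed simp

lemma sp_coeff_Nil [simp]: "sp_coeff [] n = 0"
  by (simp add: sp_coeff_def)

lemma sp_coeff_append: "sp_coeff (xs @ ys) n = sp_coeff xs n + sp_coeff ys n"
  by (simp add: sp_coeff_def)

lemma sp_mul_Cons: "sp_mul (x # xs) ys = map (\<lambda>y. (fst x * fst y, snd x @ snd y)) ys @ sp_mul xs ys"
  by (simp add: sp_mul_def)

lemma sp_coeff_monomial_mult: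
  "sp_coeff (map (\<lambda>y. (fst x * fst y, snd x @ snd y)) ys) n =
     (case cancel (snd x) n of None \<Rightarrow> 0 | Some n' \<Rightarrow> fst x * sp_coeff ys n')"
proof (cases "cancel (snd x) n")
  case None
  then show ?thesis
    using cancel_None[OF None, THEN not_sym] by (induction ys) (auto simp: sp_coeff_def)
next
  case (Some n')
  show ?thesis
    unfolding Some option.case using cancel_Some[OF Some]
    by (induction ys) (auto simp: sp_coeff_def algebra_simps)
qed

lemma product_coeff: "product_coeff L Ls n = sp_coeff (foldr sp_mul (L # Ls) [(1, [])]) n"
proof (induction L Ls n rule: product_coeff.induct)
  case (2 x L Ls n)
  have "(case cancel (snd x) n of None \<Rightarrow> 0
      | Some n' \<Rightarrow> fst x * (case Ls of [] \<Rightarrow> if n' = [] then 1 else 0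
                            | L' # Ls' \<Rightarrow> product_coeff L' Ls' n'))
    = (case cancel (snd x) n of None \<Rightarrow> 0
      | Some n' \<Rightarrow> fst x * sp_coeff (foldr sp_mul Ls [(1, [])]) n')"
  proof (cases "cancel (snd x) n")
    case (Some n')
    show ?thesis
    proof (cases Ls)
      case Nil
      with Some show ?thesis
        by (auto simp: sp_coeff_def)
    next
      case (Cons L' Ls')
      with Some 2(1)[OF Some Cons] show ?thesis
        by simp
    qed
  qed simp
  with 2(2) show ?case
    by (simp only: product_coeff.simps foldr_Cons o_apply sp_mul_Cons sp_coeff_append
        sp_coeff_monomial_mult)
qed (simp add: sp_mul_def)

lemma lookup_of_int_times:
  fixes H :: "'a::monoid_add \<Rightarrow>\<^sub>0 int"
  shows "Poly_Mapping.lookup (of_int c * H) e = c * Poly_Mapping.lookup H e"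
proof -
  have nat: "Poly_Mapping.lookup (of_nat n * H) e = int n * Poly_Mapping.lookup H e" for n
    by (induction n) (simp_all add: lookup_add algebra_simps)
  show ?thesis
    by (cases c) (simp_all only: nat of_int_of_nat_eq of_int_minus lookup_uminus minus_mult_left[symmetric])
qed

text \<open>Completing both monomials to degree \<open>12\<close> by factors \<open>(1,1)\<close>
  makes them comparable: by homogeneity, agreement away from \<open>(1,1)\<close> forces agreement
  at \<open>(1,1)\<close>.\<close>

lemma lookup_sp_eval:
  assumes "inj \<psi>" "\<And>q. f q = (if q \<in> S then coeff_var (\<psi> q) else 0)" "set n \<subseteq> S" "(1,1) \<in> S"
    "(1,1) \<notin> set n" "length n \<le> 12" "\<And>x. x \<in> set xs \<Longrightarrow> length (snd x) = d" "d \<le> 12"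
  shows "Poly_Mapping.lookup (sp_eval f xs * f (1,1) ^ (12 - d)) (expo \<psi> (n @ replicate (12 - length n) (1,1)))
    = sp_coeff xs n"
proof -
  let ?n = "n @ replicate (12 - length n) (1,1)"
  have iff: "mset (m @ replicate (12 - d) (1,1)) = mset ?n \<longleftrightarrow> mset (strip m) = mset n"
    if "length m = d" for m
  proof
    assume "mset (m @ replicate (12 - d) (1,1)) = mset ?n"
    then have "mset (strip (m @ replicate (12 - d) (1,1))) = mset (strip ?n)"
      by (metis mset_filter)
    moreover have "strip n = n"
      using assms(5) by (auto simp: filter_id_conv)
    ultimately show "mset (strip m) = mset n"
      by (simp del: mset_filter)
  next
    assume *: "mset (strip m) = mset n"
    have rep: "replicate_mset (i + j) x = replicate_mset i x + replicate_mset j x" for i j and x :: lpt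
      by (induction i) simp_all
    have m: "mset m = mset (strip m) + replicate_mset (count (mset m) (1,1)) (1,1)" for m :: "lpt list"
      by (induction m) simp_all
    from arg_cong[OF this[of m], of size] have "d = length n + count (mset m) (1,1)"
      using that arg_cong[OF *, of size] by (simp only: size_union size_mset size_replicate_mset)
    moreover from this have "12 - length n = count (mset m) (1,1) + (12 - d)"
      using assms(8) by simp
    ultimately show "mset (m @ replicate (12 - d) (1,1)) = mset ?n"
      unfolding mset_append mset_replicate by (subst m) (simp only: * rep add.assoc)
  qed
  have "Poly_Mapping.lookup ((\<Prod>q\<leftarrow>m. f q) * f (1,1) ^ (12 - d)) (expo \<psi> ?n)
      = (if mset (strip m) = mset n then 1 else 0)" if "length m = d" for m
  proof -
    have "(\<Prod>q\<leftarrow>m. f q) * f (1,1) ^ (12 - d) = (\<Prod>q\<leftarrow>m @ replicate (12 - d) (1,1). f q)"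
      by (simp add: prod_list_replicate)
    moreover have "set ?n \<subseteq> S"
      using assms(3,4) by auto
    ultimately show ?thesis
      using lookup_prod_list[OF assms(1,2), of ?n "m @ replicate (12 - d) (1,1)"] iff[OF that]
      by (simp only:)
  qed
  with assms(7) show ?thesis
  proof (induction xs)
    case (Cons x xs)
    then show ?case
      by (simp add: sp_eval_Cons sp_coeff_def lookup_add distrib_right mult.assoc lookup_of_int_times)
  qed (simp add: sp_eval_Nil)
qed

definition homogeneous :: "nat \<Rightarrow> sparse \<Rightarrow> bool" where
  "homogeneous d xs \<longleftrightarrow> (\<forall>x\<in>set xs. length (snd x) = d)"

lemma homogeneous_mul:
  "homogeneous d xs \<Longrightarrow> homogeneous e ys \<Longrightarrow> homogeneous (d + e) (sp_mul xs ys)"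
  by (auto simp: homogeneous_def sp_mul_def)

lemma lookup_disc_lead:
  assumes "inj \<psi>" "\<And>q. f q = (if q \<in> S then coeff_var (\<psi> q) else 0)" "set n \<subseteq> S" "(1,1) \<in> S"
    "(1,1) \<notin> set n" "length n \<le> 12"
  shows "Poly_Mapping.lookup (disc_lead (shape_weier \<sigma> f)) (expo \<psi> (n @ replicate (12 - length n) (1,1)))
    = disc_coeff \<sigma> n"
proof -
  obtain A2 A3 A4 A6 where sp: "sp_shape \<sigma> = (A2, A3, A4, A6)"
    by (metis prod_cases4)
  have h: "homogeneous 2 A2" "homogeneous 3 A3" "homogeneous 4 A4" "homogeneous 6 A6"
    using balanced_sparse[of \<sigma>] by (auto simp: sp list_all_iff balanced_def homogeneous_def)
  have h0: "homogeneous 0 [(1, [])]"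
    by (simp add: homogeneous_def)
  have one: "sp_eval f [(1, [])] = 1"
    by (simp add: sp_eval_def)
  define N where "N = expo \<psi> (n @ replicate (12 - length n) (1,1))"
  let ?m = "f (1,1)" and ?e = "sp_eval f"
  have look: "Poly_Mapping.lookup (?e (foldr sp_mul Ls [(1, [])]) * ?m ^ k) N
      = sp_coeff (foldr sp_mul Ls [(1, [])]) n"
    if "homogeneous d (foldr sp_mul Ls [(1, [])])" "d + k = 12" for Ls d k
  proof -
    from that(2) have "k = 12 - d" "d \<le> 12"
      by simp_all
    with that(1) show ?thesis
      unfolding N_def by (simp only:, intro lookup_sp_eval[OF assms]) (auto simp: homogeneous_def)
  qed
  have "Poly_Mapping.lookup (?e A3 * ?e A4 * ?m ^ 5) N = product_coeff A3 [A4] n"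
    using look[of "3 + (4 + 0)" "[A3, A4]" 5] homogeneous_mul[OF h(2) homogeneous_mul[OF h(3) h0]]
    by (simp add: product_coeff one)
  moreover have "Poly_Mapping.lookup (?e A6 * ?m ^ 6) N = product_coeff A6 [] n"
    using look[of "6 + 0" "[A6]" 6] homogeneous_mul[OF h(4) h0] by (simp add: product_coeff one)
  moreover have "Poly_Mapping.lookup (?e A2 * ?e A3 * ?e A3 * ?m ^ 4) N = product_coeff A2 [A3, A3] n"
    using look[of "2 + (3 + (3 + 0))" "[A2, A3, A3]" 4]
      homogeneous_mul[OF h(1) homogeneous_mul[OF h(2) homogeneous_mul[OF h(2) h0]]]
    by (simp add: product_coeff one mult.assoc)
  moreover have "Poly_Mapping.lookup (?e A4 * ?e A4 * ?m ^ 4) N = product_coeff A4 [A4] n"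
    using look[of "4 + (4 + 0)" "[A4, A4]" 4] homogeneous_mul[OF h(3) homogeneous_mul[OF h(3) h0]]
    by (simp add: product_coeff one)
  moreover have "Poly_Mapping.lookup (?e A3 * ?e A3 * ?e A3 * ?m ^ 3) N = product_coeff A3 [A3, A3] n"
    using look[of "3 + (3 + (3 + 0))" "[A3, A3, A3]" 3]
      homogeneous_mul[OF h(2) homogeneous_mul[OF h(2) homogeneous_mul[OF h(2) h0]]]
    by (simp add: product_coeff one mult.assoc)
  moreover have "disc_lead (shape_weier \<sigma> f) = ?e A3 * ?e A4 * ?m ^ 5 - ?e A6 * ?m ^ 6
      - ?e A2 * ?e A3 * ?e A3 * ?m ^ 4 + ?e A4 * ?e A4 * ?m ^ 4 + ?e A3 * ?e A3 * ?e A3 * ?m ^ 3"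
    by (simp add: shape_weier_sparse sp disc_lead_def power2_eq_square power3_eq_cube mult_ac)
  ultimately show ?thesis
    unfolding N_def[symmetric] by (simp add: disc_coeff_def sp lookup_add lookup_minus)
qed

theorem lookup_disc:
  assumes "finite A" "inj \<psi>" and f: "\<And>q. f q = (if q \<in> S then coeff_var (\<psi> q) else 0)"
    and "\<psi> ` S \<subseteq> A" and n: "set n \<subseteq> S" "(1,1) \<in> S" "(1,1) \<notin> set n" "length n \<le> 12"
    and len: "length ws = length (frame \<sigma>)" and "0 < \<epsilon>"
    and ws: "\<And>q w. q \<in> S \<Longrightarrow> w \<in> set ws \<Longrightarrow> u (\<psi> (1,1)) - pairing (fst q - 1, snd q - 1) w \<le> u (\<psi> q)"
    and w0: "\<And>q. q \<in> S - {(1,1)} \<Longrightarrow> u (\<psi> (1,1)) - pairing (fst q - 1, snd q - 1) w0 + \<epsilon> \<le> u (\<psi> q)"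
  defines "R \<equiv> 12 * u (\<psi> (1,1)) + excess \<sigma> ws" and "N \<equiv> expo \<psi> (n @ replicate (12 - length n) (1,1))"
  shows "weier_disc (shape_weier \<sigma> f) \<in> heavy A u R"
    and "weight A u N = R \<Longrightarrow> Poly_Mapping.lookup (weier_disc (shape_weier \<sigma> f)) N = disc_coeff \<sigma> n"
    and "weier_c4 (shape_weier \<sigma> f) ^ 3 - f (1,1) ^ 12 \<in> heavy A u (12 * u (\<psi> (1,1)) + \<epsilon>)"
proof -
  define c where "c = u (\<psi> (1,1))"
  \<comment> \<open>Where \<open>f\<close> vanishes any weight is allowed, so off \<open>S\<close>
    the bound \<open>U\<close> is taken large enough for the inequalities at \<open>w0\<close> and
    at all of \<open>ws\<close>.\<close>
  define U where "U q = (if q \<in> S then u (\<psi> q) else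
     c + (\<Sum>w\<in>insert w0 (set ws). \<bar>pairing (fst q - 1, snd q - 1) w\<bar>) + \<epsilon>)" for q
  have abs_le: "- pairing (fst q - 1, snd q - 1) w
      \<le> (\<Sum>w\<in>insert w0 (set ws). \<bar>pairing (fst q - 1, snd q - 1) w\<bar>)"
    if "w \<in> insert w0 (set ws)" for q w
    using member_le_sum[OF that, of "\<lambda>w. \<bar>pairing (fst q - 1, snd q - 1) w\<bar>"] by simp
  have U1: "U (1,1) = c"
    using n by (simp add: U_def c_def)
  have "f q \<in> heavy A u (U q)" for q
    using assms(4) by (auto simp: f U_def intro!: heavy_coeff_var[OF \<open>finite A\<close>])
  moreover have "U (1,1) - pairing (fst q - 1, snd q - 1) w \<le> U q" if "w \<in> set ws" for q w
    using ws[of q w] abs_le[of w q] that \<open>0 < \<epsilon>\<close> unfolding U1 by (simp add: U_def c_def)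
  moreover have "U (1,1) - pairing (fst q - 1, snd q - 1) w0 + \<epsilon> \<le> U q" if "q \<noteq> (1,1)" for q
    using w0[of q] abs_le[of w0 q] that unfolding U1 by (simp add: U_def c_def)
  ultimately have heavy: "disc_lead (shape_weier \<sigma> f) \<in> heavy A u R"
      "weier_disc (shape_weier \<sigma> f) - disc_lead (shape_weier \<sigma> f) \<in> heavy A u (R + \<epsilon>)"
      "weier_c4 (shape_weier \<sigma> f) ^ 3 - f (1,1) ^ 12 \<in> heavy A u (12 * c + \<epsilon>)"
    using shape_heavy[of f A u U ws \<sigma> \<epsilon> w0] len \<open>0 < \<epsilon>\<close> U1 by (simp_all add: R_def c_def)
  show "weier_disc (shape_weier \<sigma> f) \<in> heavy A u R"
    using heavy_add[OF heavy(1) heavy_mono[OF heavy(2)]] \<open>0 < \<epsilon>\<close> by simp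
  show "weier_c4 (shape_weier \<sigma> f) ^ 3 - f (1,1) ^ 12 \<in> heavy A u (12 * u (\<psi> (1,1)) + \<epsilon>)"
    using heavy(3) by (simp add: c_def)
  \<comment> \<open>All terms outside \<open>disc_lead\<close> weigh at least
    \<open>R + \<epsilon>\<close> and cannot contribute to a monomial of weight
    \<open>R\<close>.\<close>
  assume "weight A u N = R"
  then have "N \<notin> Poly_Mapping.keys (weier_disc (shape_weier \<sigma> f) - disc_lead (shape_weier \<sigma> f))"
    using heavy(2) \<open>0 < \<epsilon>\<close> by (auto simp: heavy_def)
  then have "Poly_Mapping.lookup (weier_disc (shape_weier \<sigma> f)) N
      = Poly_Mapping.lookup (disc_lead (shape_weier \<sigma> f)) N"
    by (simp add: in_keys_iff lookup_minus)
  then show "Poly_Mapping.lookup (weier_disc (shape_weier \<sigma> f)) N = disc_coeff \<sigma> n"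
    unfolding N_def using lookup_disc_lead[OF assms(2) f n] by simp
qed

section \<open>Cells of the subdivision and the length of the cycle\<close>

lemma trop_term_eq: "trop_term u p w = u p + pt p \<bullet> w"
  by (simp add: trop_term_def pt_def inner_prod_def)

lemma pt_eq_iff [simp]: "pt p = pt q \<longleftrightarrow> p = q"
  by (simp add: pt_def prod_eq_iff)

definition minimizers :: "(int \<times> int) set \<Rightarrow> (int \<times> int \<Rightarrow> real) \<Rightarrow> real \<times> real \<Rightarrow> (int \<times> int) set" where
  "minimizers A u w = {p \<in> A. \<forall>q\<in>A. trop_term u p w \<le> trop_term u q w}"

lemma trop_fun_eq_iff:
  assumes "finite A" "p \<in> A"
  shows "trop_term u p w = trop_fun A u w \<longleftrightarrow> p \<in> minimizers A u w"
proof -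
  have "trop_term u p w = trop_fun A u w \<longleftrightarrow> (\<forall>q\<in>A. trop_term u p w \<le> trop_term u q w)"
    unfolding trop_fun_def using assms by (subst eq_commute, subst Min_eq_iff) auto
  then show ?thesis
    using assms by (simp add: minimizers_def)
qed

lemma dual_edge_eq:
  assumes "finite A" "p \<in> A" "q \<in> A"
  shows "dual_edge A u p q = {w. p \<in> minimizers A u w \<and> q \<in> minimizers A u w}"
  using trop_fun_eq_iff[OF assms(1,2)] trop_fun_eq_iff[OF assms(1,3)] by (simp add: dual_edge_def)

text \<open>A convex combination attains the minimum only if its coefficients vanish at all points
  that do not.\<close>

lemma convex_hull_minimizers:
  fixes X :: "'a::euclidean_space set"
  assumes "finite X"
  shows "{z \<in> convex hull X. \<forall>z' \<in> convex hull X. a \<bullet> z \<le> a \<bullet> z'} = convex hull {x \<in> X. \<forall>y\<in>X. a \<bullet> x \<le> a \<bullet> y}"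
    (is "?L = convex hull ?M")
proof
  have ge: "m \<le> a \<bullet> z" if "z \<in> convex hull X" "\<And>y. y \<in> X \<Longrightarrow> m \<le> a \<bullet> y" for m z
  proof -
    have "convex hull X \<subseteq> {z. a \<bullet> z \<ge> m}"
      using that(2) by (intro hull_minimal convex_halfspace_ge) auto
    with that(1) show ?thesis
      by blast
  qed
  show "?L \<subseteq> convex hull ?M"
  proof
    fix z assume z: "z \<in> ?L"
    then obtain c where c: "\<And>x. x \<in> X \<Longrightarrow> 0 \<le> c x" "sum c X = 1" "(\<Sum>x\<in>X. c x *\<^sub>R x) = z"
      unfolding convex_hull_finite[OF assms] by blast
    have le: "a \<bullet> z \<le> a \<bullet> y" if "y \<in> X" for y
      using z that hull_subset[of X convex] by blast
    have "(\<Sum>x\<in>X. c x * (a \<bullet> x - a \<bullet> z)) = a \<bullet> (\<Sum>x\<in>X. c x *\<^sub>R x) - sum c X * (a \<bullet> z)"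
      by (simp add: inner_sum_right sum_subtractf sum_distrib_right right_diff_distrib)
    then have "(\<Sum>x\<in>X. c x * (a \<bullet> x - a \<bullet> z)) = 0"
      using c by simp
    then have "\<forall>x\<in>X. c x * (a \<bullet> x - a \<bullet> z) = 0"
      using c(1) le by (subst (asm) sum_nonneg_eq_0_iff) (auto simp: assms)
    then have zero: "c x = 0" if "x \<in> X - ?M" for x
      using that le by force
    have "sum c ?M = 1" "(\<Sum>x\<in>?M. c x *\<^sub>R x) = z"
      using c(2,3) zero by (subst sum.mono_neutral_left[of X]; auto simp: assms)+
    then show "z \<in> convex hull ?M"
      using c(1) assms by (auto simp: convex_hull_finite)
  qed
  show "convex hull ?M \<subseteq> ?L"
  proof (rule hull_minimal)
    show "?M \<subseteq> ?L"
      using ge hull_subset[of X convex] by fastforce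
    have "?L = (\<Inter>z'\<in>convex hull X. convex hull X \<inter> {z. a \<bullet> z \<le> a \<bullet> z'})" if "convex hull X \<noteq> {}"
      using that by blast
    moreover have "?L = {}" if "convex hull X = {}"
      using that by blast
    moreover have "convex (\<Inter>z'\<in>convex hull X. convex hull X \<inter> {z. a \<bullet> z \<le> a \<bullet> z'})"
      by (intro convex_INT convex_Int convex_convex_hull convex_halfspace_le)
    ultimately show "convex ?L"
      by (cases "convex hull X = {}") simp_all
  qed
qed

text \<open>The functional \<open>(w, 1)\<close> takes at the lifted point of \<open>p\<close> the
  value of the tropical term of \<open>p\<close> at \<open>w\<close>. So the lower faces are indexed
  by points \<open>w\<close> of the tropical plane, and cells are the hulls of the minimizing
  exponents.\<close>

lemma marked_subdivision_eq:
  assumes "finite A"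
  shows "marked_subdivision A u = {(convex hull (pt ` minimizers A u w), minimizers A u w) | w.
     interior (convex hull (pt ` minimizers A u w)) \<noteq> {}}"
proof -
  define L where "L w = {z \<in> convex hull (lift_pt u ` A).
         \<forall>z' \<in> convex hull (lift_pt u ` A). (w, 1) \<bullet> z \<le> (w, 1) \<bullet> z'}" for w
  have lift: "(w, 1) \<bullet> lift_pt u p = trop_term u p w" for w p
    by (simp add: lift_pt_def trop_term_eq inner_commute)
  have L: "L w = convex hull (lift_pt u ` minimizers A u w)" for w
    unfolding L_def convex_hull_minimizers[OF finite_imageI[OF assms]]
    by (rule arg_cong[of _ _ "\<lambda>x. convex hull x"]) (auto simp: lift minimizers_def)
  have fst: "fst ` L w = convex hull (pt ` minimizers A u w)" for w
    unfolding L convex_hull_linear_image[OF linear_fst] image_image by (simp add: lift_pt_def)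
  have snd: "{p \<in> A. lift_pt u p \<in> L w} = minimizers A u w" for w
  proof -
    have "p \<in> minimizers A u w" if "p \<in> A" "lift_pt u p \<in> L w" for p
      using that hull_subset[of "lift_pt u ` A" convex] unfolding L_def by (auto simp: lift[symmetric] minimizers_def)
    moreover have "lift_pt u p \<in> L w" if "p \<in> minimizers A u w" for p
      unfolding L using that by (simp add: hull_inc)
    ultimately show ?thesis
      by (auto simp: minimizers_def)
  qed
  have "lower_faces A u = range L"
    by (auto simp: lower_faces_def L_def)
  then have "marked_subdivision A u =
      (\<lambda>L'. (fst ` L', {p \<in> A. lift_pt u p \<in> L'})) ` {L' \<in> range L. interior (fst ` L') \<noteq> {}}"
    unfolding marked_subdivision_def by (simp only:) blast
  also have "\<dots> = (\<lambda>w. (fst ` L w, {p \<in> A. lift_pt u p \<in> L w})) ` {w. interior (fst ` L w) \<noteq> {}}"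
    by blast
  finally show ?thesis
    unfolding fst snd by (simp only:) blast
qed

text \<open>For small positive \<open>t\<close> the constant term decides the sign, and the slope
  decides where the constant term vanishes.\<close>

lemma eventually_positive:
  fixes a b :: "'a \<Rightarrow> real"
  assumes "finite X" "\<And>x. x \<in> X \<Longrightarrow> 0 < a x \<or> (a x = 0 \<and> 0 < b x)"
  shows "\<forall>\<^sub>F t in at_right 0. \<forall>x\<in>X. 0 < a x + t * b x"
  unfolding eventually_ball_finite_distrib[OF assms(1)]
proof
  fix x assume "x \<in> X"
  with assms(2) consider "0 < a x" | "a x = 0" "0 < b x"
    by blast
  then show "\<forall>\<^sub>F t in at_right 0. 0 < a x + t * b x"
  proof cases
    case 1
    have "((\<lambda>t. a x + t * b x) \<longlongrightarrow> a x + 0 * b x) (at_right 0)"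
      by (intro tendsto_intros)
    with 1 show ?thesis
      by (simp add: order_tendsto_iff)
  next
    case 2
    then show ?thesis
      by (auto intro: eventually_mono[OF eventually_at_right_less])
  qed
qed

lemma eventually_nonnegative:
  fixes a b :: "'a \<Rightarrow> real"
  assumes "finite X" "\<And>x. x \<in> X \<Longrightarrow> 0 < a x \<or> (a x = 0 \<and> 0 \<le> b x)"
  shows "\<forall>\<^sub>F t in at_right 0. \<forall>x\<in>X. 0 \<le> a x + t * b x"
proof -
  have "\<forall>\<^sub>F t in at_right 0. \<forall>x\<in>{x\<in>X. 0 < a x}. 0 < a x + t * b x"
    using assms by (intro eventually_positive) auto
  moreover have "\<forall>\<^sub>F t in at_right (0::real). 0 < t"
    by (rule eventually_at_right_less)
  ultimately show ?thesis
  proof eventually_elim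
    case (elim t)
    then show ?case
      using assms(2) by (metis (mono_tags, lifting) add_0 less_eq_real_def mem_Collect_eq mult_nonneg_nonneg)
  qed
qed

lemma at_right_obtain:
  assumes "\<forall>\<^sub>F t in at_right (0::real). P t"
  obtains t where "0 < t" "P t"
proof -
  have "\<forall>\<^sub>F t in at_right (0::real). 0 < t \<and> P t"
    using assms eventually_at_right_less[of 0] by eventually_elim simp
  then have "\<exists>t. 0 < t \<and> P t"
    using eventually_happens'[OF trivial_limit_at_right_real] by blast
  with that show thesis
    by blast
qed

text \<open>As \<open>z\<close> is interior, in every direction some marked point lies beyond
  \<open>z\<close>, and its constraint bounds \<open>w\<close> in the opposite direction.\<close>

lemma compact_superlevel:
  assumes "finite A" "z \<in> interior (convex hull (pt ` A))"
  shows "compact {w. \<forall>p\<in>A. c \<le> u p + (pt p - z) \<bullet> w}" (is "compact ?P")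
proof -
  obtain e where e: "0 < e" "ball z e \<subseteq> convex hull (pt ` A)"
    using assms(2) mem_interior by blast
  have "A \<noteq> {}"
    using assms(2) by auto
  define K where "K = Min ((\<lambda>p. c - u p) ` A)"
  have K: "K \<le> c - u p" if "p \<in> A" for p
    unfolding K_def using assms(1) that by simp
  have "norm w \<le> max 0 (- 2 * K / e)" if w: "w \<in> ?P" for w
  proof (cases "w = 0")
    case False
    \<comment> \<open>A step from \<open>z\<close> against \<open>w\<close> that stays in the hull:
      it lowers the pairing with \<open>w\<close> by \<open>e / 2 * norm w\<close>, whereas the
      constraints bound this pairing from below on the whole hull.\<close>
    define x where "x = z - (e / 2 / norm w) *\<^sub>R w"
    have "x \<in> ball z e"
      using e(1) False by (simp add: x_def dist_norm)
    then have "x \<in> convex hull (pt ` A)"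
      using e(2) by blast
    moreover have "convex hull (pt ` A) \<subseteq> {x. w \<bullet> x \<ge> K + w \<bullet> z}"
    proof (intro hull_minimal convex_halfspace_ge subsetI)
      fix x assume "x \<in> pt ` A"
      then obtain p where p: "p \<in> A" "x = pt p"
        by blast
      then show "x \<in> {x. w \<bullet> x \<ge> K + w \<bullet> z}"
        using w K[OF p(1)] by (auto simp: inner_diff_left inner_diff_right inner_commute dest!: bspec[of A _ p])
    qed
    ultimately have "w \<bullet> x \<ge> K + w \<bullet> z"
      by blast
    moreover have "w \<bullet> x = w \<bullet> z - e / 2 * norm w"
      using False by (simp add: x_def inner_diff_right power2_norm_eq_inner[symmetric] power2_eq_square)
    ultimately have "norm w \<le> - 2 * K / e"
      using e(1) by (simp add: field_simps)
    then show ?thesis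
      by simp
  qed simp
  then have "bounded ?P"
    unfolding bounded_iff by blast
  moreover have "?P = (\<Inter>p\<in>A. {w. (pt p - z) \<bullet> w \<ge> c - u p})"
    by (auto simp: algebra_simps)
  then have "closed ?P"
    by (simp add: closed_INT closed_halfspace_ge)
  ultimately show ?thesis
    by (simp add: compact_eq_bounded_closed)
qed

section \<open>Cells that contain a given point, and cycles\<close>

lemma trop_term_line: "trop_term u p (w + t *\<^sub>R d) = trop_term u p w + t * (pt p \<bullet> d)"
  by (simp add: trop_term_eq inner_add_right algebra_simps)

lemma trop_fun_le: "finite A \<Longrightarrow> p \<in> A \<Longrightarrow> trop_fun A u w \<le> trop_term u p w"
  by (simp add: trop_fun_def)

lemma trop_fun_minimizer: "finite A \<Longrightarrow> p \<in> minimizers A u w \<Longrightarrow> trop_fun A u w = trop_term u p w"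
  using trop_fun_eq_iff[of A p u w] by (auto simp: minimizers_def)

text \<open>
  The point \<open>w\<close> below is an extreme point of the set of maximizers of
  \<open>\<lambda>w. trop_fun A u w - z \<bullet> w\<close>: optimality makes its cell contain \<open>z\<close>, extremality makes the
  cell two-dimensional.
\<close>

lemma cell_containing:
  assumes "finite A" "z \<in> interior (convex hull (pt ` A))"
  obtains w where "z \<in> convex hull (pt ` minimizers A u w)"
    "interior (convex hull (pt ` minimizers A u w)) \<noteq> {}"
proof -
  have "A \<noteq> {}"
    using assms(2) by auto
  define g where "g w = trop_fun A u w - z \<bullet> w" for w
  have g_ge: "c \<le> g w \<longleftrightarrow> (\<forall>p\<in>A. c \<le> u p + (pt p - z) \<bullet> w)" for c w
  proof -
    have "c \<le> g w \<longleftrightarrow> c + z \<bullet> w \<le> trop_fun A u w"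
      by (auto simp: g_def)
    also have "\<dots> \<longleftrightarrow> (\<forall>p\<in>A. c + z \<bullet> w \<le> trop_term u p w)"
      unfolding trop_fun_def using assms(1) \<open>A \<noteq> {}\<close> by simp
    also have "\<dots> \<longleftrightarrow> (\<forall>p\<in>A. c \<le> u p + (pt p - z) \<bullet> w)"
      by (simp add: trop_term_eq inner_diff_left algebra_simps)
    finally show ?thesis .
  qed
  \<comment> \<open>The superlevel set of the value at \<open>0\<close> is nonempty and compact, so
    \<open>g\<close> attains its maximum over the whole plane there.\<close>
  define X0 where "X0 = {w. g 0 \<le> g w}"
  have "compact X0"
    unfolding X0_def g_ge by (rule compact_superlevel[OF assms])
  have "continuous_on X0 g"
  proof -
    have "continuous_on X0 (\<lambda>w. Min ((\<lambda>p. trop_term u p w) ` A))"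
      using assms(1) \<open>A \<noteq> {}\<close>
    proof (induction A rule: finite_ne_induct)
      case (insert p A)
      then show ?case
        by (simp, intro continuous_intros) (simp_all add: trop_term_eq continuous_intros)
    qed (simp add: trop_term_eq continuous_intros)
    then show ?thesis
      unfolding g_def trop_fun_def by (intro continuous_intros)
  qed
  moreover have "0 \<in> X0"
    by (simp add: X0_def)
  ultimately obtain wm where "wm \<in> X0" and max0: "\<forall>w\<in>X0. g w \<le> g wm"
    using continuous_attains_sup[OF \<open>compact X0\<close>, of g] by blast
  have max: "g w \<le> g wm" for w
    using max0 \<open>wm \<in> X0\<close> unfolding X0_def by (metis linear mem_Collect_eq order_trans)
  define X where "X = {w. g wm \<le> g w}"
  have "compact X"
    unfolding X_def g_ge by (rule compact_superlevel[OF assms])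
  moreover have "X = (\<Inter>p\<in>A. {w. (pt p - z) \<bullet> w \<ge> g wm - u p})"
    unfolding X_def g_ge by (auto simp: algebra_simps)
  then have "convex X"
    by (simp add: convex_INT convex_halfspace_ge)
  moreover have "wm \<in> X"
    by (simp add: X_def)
  ultimately obtain w where w: "w extreme_point_of X"
    using extreme_point_exists_convex[of X] by blast
  then have "w \<in> X"
    by (simp add: extreme_point_of_def)
  let ?M = "minimizers A u w"
  \<comment> \<open>Terms that do not attain the minimum at \<open>w\<close> stay above for small
    steps, so only the minimizers matter.\<close>
  have line: "\<forall>\<^sub>F t in at_right 0. \<forall>p\<in>A - ?M. 0 < (trop_term u p w - trop_fun A u w) + t * (pt p \<bullet> d - s)"
    for d s
  proof (rule eventually_positive)
    show "0 < trop_term u p w - trop_fun A u w \<or>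
       trop_term u p w - trop_fun A u w = 0 \<and> 0 < pt p \<bullet> d - s" if "p \<in> A - ?M" for p
      using that trop_fun_le[OF assms(1), of p u w] trop_fun_eq_iff[OF assms(1), of p u w] by force
  qed (use assms(1) in simp)
  have up: "trop_fun A u w + t * s \<le> trop_fun A u (w + t *\<^sub>R d)"
    if "0 < t" "\<forall>p\<in>A - ?M. 0 < (trop_term u p w - trop_fun A u w) + t * (pt p \<bullet> d - s)"
      "\<And>p. p \<in> ?M \<Longrightarrow> s \<le> pt p \<bullet> d" for t d s
    unfolding trop_fun_def[of A u "w + t *\<^sub>R d"]
  proof (subst Min_ge_iff)
    show "\<forall>a\<in>(\<lambda>p. trop_term u p (w + t *\<^sub>R d)) ` A. trop_fun A u w + t * s \<le> a"
    proof safe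
      fix p assume p: "p \<in> A"
      show "trop_fun A u w + t * s \<le> trop_term u p (w + t *\<^sub>R d)"
      proof (cases "p \<in> ?M")
        case True
        then show ?thesis
          using that(1) that(3)[of p] trop_fun_minimizer[OF assms(1) True]
          by (simp add: trop_term_line mult_left_mono)
      next
        case False
        then show ?thesis
          using that(2) p by (force simp: trop_term_line algebra_simps)
      qed
    qed
  qed (use assms(1) \<open>A \<noteq> {}\<close> in auto)
  show thesis
  proof
    show "z \<in> convex hull (pt ` ?M)"
    proof (rule ccontr)
      assume "z \<notin> convex hull (pt ` ?M)"
      moreover have "closed (convex hull (pt ` ?M))"
        using assms(1) by (intro compact_imp_closed finite_imp_compact_convex_hull) (simp add: minimizers_def)
      \<comment> \<open>A step in a direction that separates the cell from \<open>z\<close> would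
        increase \<open>g\<close> beyond its maximum.\<close>
      ultimately obtain d b where d: "d \<bullet> z < b" "\<And>x. x \<in> convex hull (pt ` ?M) \<Longrightarrow> b < d \<bullet> x"
        using separating_hyperplane_closed_point[of "convex hull (pt ` ?M)" z] by (auto simp: convex_convex_hull)
      obtain t where t: "0 < t" "\<forall>p\<in>A - ?M. 0 < (trop_term u p w - trop_fun A u w) + t * (pt p \<bullet> d - b)"
        using at_right_obtain[OF line] by blast
      have "b \<le> pt p \<bullet> d" if "p \<in> ?M" for p
        using d(2)[of "pt p"] that by (simp add: hull_inc inner_commute)
      from up[OF t this] have "g w + t * (b - d \<bullet> z) \<le> g (w + t *\<^sub>R d)"
        by (simp add: g_def algebra_simps inner_add_right inner_commute)
      moreover have "0 < t * (b - d \<bullet> z)"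
        using t d by simp
      ultimately show False
        using max[of "w + t *\<^sub>R d"] \<open>w \<in> X\<close> by (simp add: X_def)
    qed
    then have z: "z \<in> convex hull (pt ` ?M)" .
    show "interior (convex hull (pt ` ?M)) \<noteq> {}"
    proof
      assume "interior (convex hull (pt ` ?M)) = {}"
      \<comment> \<open>If the minimizers lay on a line with normal \<open>d\<close>, their terms
        would all change alike along \<open>d\<close>, and \<open>X\<close> would contain a segment
        around \<open>w\<close>.\<close>
      then obtain d b where d: "d \<noteq> 0" "convex hull (pt ` ?M) \<subseteq> {x. d \<bullet> x = b}"
        using empty_interior_subset_hyperplane[OF convex_convex_hull] by metis
      have bz: "b = d \<bullet> z"
        using d(2) z by blast
      have bp: "pt p \<bullet> d = b" if "p \<in> ?M" for p
        using d(2) hull_inc[of "pt p" "pt ` ?M" convex] that by (auto simp: inner_commute[of _ d])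
      note b = bz bp
      have "\<forall>\<^sub>F t in at_right 0. (\<forall>p\<in>A - ?M. 0 < (trop_term u p w - trop_fun A u w) + t * (pt p \<bullet> d - b))
        \<and> (\<forall>p\<in>A - ?M. 0 < (trop_term u p w - trop_fun A u w) + t * (pt p \<bullet> (- d) - (- b)))"
        by (intro eventually_conj line)
      then obtain t where t: "0 < t" "\<forall>p\<in>A - ?M. 0 < (trop_term u p w - trop_fun A u w) + t * (pt p \<bullet> d - b)"
        "\<forall>p\<in>A - ?M. 0 < (trop_term u p w - trop_fun A u w) + t * (pt p \<bullet> (- d) - (- b))"
        using at_right_obtain by (metis (no_types, lifting))
      have "w + t *\<^sub>R d \<in> X" "w + t *\<^sub>R (- d) \<in> X"
        using up[OF t(1,2)] up[OF t(1,3)] b \<open>w \<in> X\<close>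
        by (auto simp: X_def g_def inner_add_right inner_diff_right inner_commute algebra_simps)
      moreover have "w \<in> open_segment (w + t *\<^sub>R (- d)) (w + t *\<^sub>R d)"
        using midpoint_in_open_segment[of "w + t *\<^sub>R (- d)" "w + t *\<^sub>R d"] t(1) d(1)
        by (simp add: midpoint_def algebra_simps scaleR_2[symmetric])
      ultimately show False
        using w by (auto simp: extreme_point_of_def)
    qed
  qed
qed

text \<open>In a cell that contains it, \<open>\<omega>\<close> is a vertex and can be separated
  from the other marked points of the cell. A small step from the dual vertex in the separating
  direction makes the term of \<open>\<omega>\<close> the only minimum.\<close>

lemma strict_minimizer_if_cycle:
  assumes "finite A" and \<omega>: "pt \<omega> \<in> interior (convex hull (pt ` A))" and "determines_cycle A u \<omega>"
  shows "\<omega> \<in> A" "\<exists>w. \<forall>p\<in>A - {\<omega>}. trop_term u \<omega> w < trop_term u p w"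
proof -
  obtain w where w: "pt \<omega> \<in> convex hull (pt ` minimizers A u w)"
    "interior (convex hull (pt ` minimizers A u w)) \<noteq> {}"
    using cell_containing[OF assms(1) \<omega>] .
  let ?M = "minimizers A u w"
  have "(convex hull (pt ` ?M), ?M) \<in> marked_subdivision A u"
    unfolding marked_subdivision_eq[OF assms(1)] using w(2) by blast
  with assms(3) w(1) have ext: "pt \<omega> extreme_point_of (convex hull (pt ` ?M))"
    unfolding determines_cycle_def by blast
  then have "pt \<omega> \<in> pt ` ?M"
    by (rule extreme_point_of_convex_hull)
  then have M: "\<omega> \<in> ?M"
    by auto
  then show "\<omega> \<in> A"
    by (simp add: minimizers_def)
  let ?N = "convex hull (pt ` (?M - {\<omega>}))"
  have "?N \<subseteq> convex hull (pt ` ?M) - {pt \<omega>}"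
  proof (rule hull_minimal)
    show "convex (convex hull (pt ` ?M) - {pt \<omega>})"
      using extreme_point_of_stillconvex[OF convex_convex_hull] ext by blast
  qed (auto simp: hull_inc)
  then have "pt \<omega> \<notin> ?N"
    by blast
  moreover have "closed ?N"
    using assms(1) by (intro compact_imp_closed finite_imp_compact_convex_hull) (simp add: minimizers_def)
  ultimately obtain d b where d: "d \<bullet> pt \<omega> < b" "\<And>x. x \<in> ?N \<Longrightarrow> b < d \<bullet> x"
    using separating_hyperplane_closed_point[of ?N "pt \<omega>"] by (auto simp: convex_convex_hull)
  have "\<forall>\<^sub>F t in at_right 0. \<forall>p\<in>A - {\<omega>}.
      0 < (trop_term u p w - trop_term u \<omega> w) + t * (pt p \<bullet> d - pt \<omega> \<bullet> d)"
  proof (rule eventually_positive)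
    show "0 < trop_term u p w - trop_term u \<omega> w \<or>
         trop_term u p w - trop_term u \<omega> w = 0 \<and> 0 < pt p \<bullet> d - pt \<omega> \<bullet> d" if p: "p \<in> A - {\<omega>}" for p
    proof (cases "p \<in> ?M")
      case True
      then have "pt p \<in> ?N"
        using p by (simp add: hull_inc)
      moreover have "trop_term u p w = trop_term u \<omega> w"
        using trop_fun_minimizer[OF assms(1) True] trop_fun_minimizer[OF assms(1) M] by simp
      ultimately show ?thesis
        using d(1) d(2)[of "pt p"] by (simp add: inner_commute)
    next
      case False
      then show ?thesis
        using p trop_fun_le[OF assms(1), of p u w] trop_fun_eq_iff[OF assms(1), of p u w]
          trop_fun_minimizer[OF assms(1) M] by force
    qed
  qed (use assms(1) in simp)
  then obtain t where "\<forall>p\<in>A - {\<omega>}. 0 < (trop_term u p w - trop_term u \<omega> w) + t * (pt p \<bullet> d - pt \<omega> \<bullet> d)"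
    using at_right_obtain by (metis (no_types, lifting))
  then have "\<forall>p\<in>A - {\<omega>}. trop_term u \<omega> (w + t *\<^sub>R d) < trop_term u p (w + t *\<^sub>R d)"
    by (auto simp: trop_term_line algebra_simps)
  then show "\<exists>w. \<forall>p\<in>A - {\<omega>}. trop_term u \<omega> w < trop_term u p w"
    by blast
qed

text \<open>Comparing the terms at \<open>w\<close> with those at \<open>w0\<close> shows that the
  functional \<open>w0 - w\<close> attains its minimum on the cell of \<open>w\<close> only at
  \<open>\<omega>\<close>, which is thus a vertex of every cell that contains it.\<close>

lemma cycle_if_strict_minimizer:
  assumes "finite A" and \<omega>: "\<omega> \<in> A" "pt \<omega> \<in> interior (convex hull (pt ` A))"
    and w0: "\<And>p. p \<in> A - {\<omega>} \<Longrightarrow> trop_term u \<omega> w0 < trop_term u p w0"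
  shows "determines_cycle A u \<omega>"
proof -
  have "pt \<omega> extreme_point_of (convex hull (pt ` minimizers A u w))"
    if hull: "pt \<omega> \<in> convex hull (pt ` minimizers A u w)" for w
  proof -
    let ?M = "minimizers A u w"
    define l where "l = trop_fun A u w"
    have M: "finite ?M" "?M \<subseteq> A"
      using assms(1) by (auto simp: minimizers_def)
    have l: "trop_term u p w = l" if "p \<in> ?M" for p
      using trop_fun_minimizer[OF assms(1) that] by (simp add: l_def)
    have le: "l - trop_term u \<omega> w0 \<le> (w - w0) \<bullet> pt \<omega>"
    proof -
      have "l \<le> trop_term u \<omega> w"
        unfolding l_def by (rule trop_fun_le[OF assms(1) \<omega>(1)])
      then show ?thesis
        by (simp add: trop_term_eq inner_diff_left inner_diff_right inner_commute)
    qed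
    have lt: "(w - w0) \<bullet> pt p < l - trop_term u \<omega> w0" if "p \<in> ?M - {\<omega>}" for p
      using w0[of p] l[of p] that M(2) by (auto simp: trop_term_eq inner_diff_left inner_diff_right inner_commute)
    have M\<omega>: "\<omega> \<in> ?M"
    proof (rule ccontr)
      assume "\<omega> \<notin> ?M"
      then have "convex hull (pt ` ?M) \<subseteq> {x. (w - w0) \<bullet> x < l - trop_term u \<omega> w0}"
        using lt by (intro hull_minimal convex_halfspace_lt) auto
      with hull le show False
        by force
    qed
    have ge: "(w0 - w) \<bullet> pt \<omega> \<le> (w0 - w) \<bullet> x" if "x \<in> convex hull (pt ` ?M)" for x
    proof -
      have "convex hull (pt ` ?M) \<subseteq> {x. (w0 - w) \<bullet> x \<ge> (w0 - w) \<bullet> pt \<omega>}"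
        using lt le by (intro hull_minimal convex_halfspace_ge) (force simp: inner_diff_left)
      with that show ?thesis
        by blast
    qed
    have "(convex hull (pt ` ?M) \<inter> {x. (w0 - w) \<bullet> x = (w0 - w) \<bullet> pt \<omega>}) face_of convex hull (pt ` ?M)"
      using ge by (intro face_of_Int_supporting_hyperplane_ge convex_convex_hull)
    also have "convex hull (pt ` ?M) \<inter> {x. (w0 - w) \<bullet> x = (w0 - w) \<bullet> pt \<omega>}
        = {z \<in> convex hull (pt ` ?M). \<forall>z'\<in>convex hull (pt ` ?M). (w0 - w) \<bullet> z \<le> (w0 - w) \<bullet> z'}"
      using ge hull by (auto intro: antisym)
    also have "\<dots> = convex hull {x \<in> pt ` ?M. \<forall>y\<in>pt ` ?M. (w0 - w) \<bullet> x \<le> (w0 - w) \<bullet> y}"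
      by (rule convex_hull_minimizers) (use M in simp)
    also have "{x \<in> pt ` ?M. \<forall>y\<in>pt ` ?M. (w0 - w) \<bullet> x \<le> (w0 - w) \<bullet> y} = {pt \<omega>}"
    proof -
      have "\<not> (w0 - w) \<bullet> pt p \<le> (w0 - w) \<bullet> pt \<omega>" if "p \<in> ?M - {\<omega>}" for p
        using lt[OF that] le by (simp add: inner_diff_left)
      then have "x = pt \<omega>" if "x \<in> pt ` ?M" "\<forall>y\<in>pt ` ?M. (w0 - w) \<bullet> x \<le> (w0 - w) \<bullet> y" for x
        using that M\<omega> by blast
      moreover have "(w0 - w) \<bullet> pt \<omega> \<le> (w0 - w) \<bullet> y" if "y \<in> pt ` ?M" for y
        using ge hull_inc[OF that] by blast
      ultimately show ?thesis
        using M\<omega> by blast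
    qed
    finally show ?thesis
      by (simp add: face_of_singleton)
  qed
  then show ?thesis
    unfolding determines_cycle_def interior_lattice_points_def newton_polygon_def
      marked_subdivision_eq[OF assms(1)] using \<omega>(2) by auto
qed

section \<open>Edges of the subdivision at the interior lattice point\<close>

lemma orthogonal_parallel:
  fixes a d v :: "real \<times> real"
  assumes "v \<noteq> 0" "a \<noteq> 0" "a \<bullet> v = 0" "d \<bullet> v = 0"
  obtains s where "d = s *\<^sub>R a"
proof -
  obtain v1 v2 a1 a2 d1 d2 where [simp]: "v = (v1, v2)" "a = (a1, a2)" "d = (d1, d2)"
    by (metis surj_pair)
  have eq: "a1 * v1 + a2 * v2 = 0" "d1 * v1 + d2 * v2 = 0"
    using assms by simp_all
  have "(d1 * a2 - d2 * a1) * v1 = (d1 * v1 + d2 * v2) * a2 - d2 * (a1 * v1 + a2 * v2)"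
    "(d1 * a2 - d2 * a1) * v2 = d1 * (a1 * v1 + a2 * v2) - a1 * (d1 * v1 + d2 * v2)"
    by (simp_all add: algebra_simps)
  with eq have 0: "d1 * a2 = d2 * a1"
    using assms(1) by (auto simp: zero_prod_def)
  show thesis
  proof (cases "a1 = 0")
    case True
    with assms(2) 0 show thesis
      by (intro that[of "d2 / a2"]) (auto simp: zero_prod_def)
  next
    case False
    with 0 show thesis
      by (intro that[of "d1 / a1"]) (auto simp: field_simps)
  qed
qed

text \<open>Of two points on one ray the nearer would lie strictly between \<open>\<omega>\<close>
  and a point of the polygon, and be a second interior lattice point.\<close>

lemma lattice_point_on_ray:
  assumes "finite A" and int: "interior_lattice_points (convex hull (pt ` A)) = {\<omega>}"
    and pq: "p \<in> A - {\<omega>}" "q \<in> A - {\<omega>}" and s: "pt p - pt \<omega> = s *\<^sub>R (pt q - pt \<omega>)" "0 < s"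
  shows "p = q"
proof -
  let ?Q = "convex hull (pt ` A)"
  have \<omega>: "pt \<omega> \<in> interior ?Q"
    using int by (auto simp: interior_lattice_points_def)
  have no: False if "p \<in> A - {\<omega>}" "q \<in> A" "pt p - pt \<omega> = s *\<^sub>R (pt q - pt \<omega>)" "0 < s" "s < 1" for p q s
  proof -
    have "pt p = (1 - s) *\<^sub>R pt \<omega> + s *\<^sub>R pt q"
      using that(3) by (simp add: algebra_simps)
    then have "pt p \<in> open_segment (pt \<omega>) (pt q)"
      using that by (auto simp: in_segment)
    moreover have "open_segment (pt \<omega>) (pt q) \<subseteq> interior ?Q"
      using \<omega> that(2) closure_subset[of ?Q] hull_inc[of "pt q" "pt ` A" convex]
      by (intro in_interior_closure_convex_segment convex_convex_hull) auto
    ultimately have "p \<in> interior_lattice_points ?Q"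
      by (auto simp: interior_lattice_points_def)
    with int that(1) show False
      by simp
  qed
  consider "s < 1" | "s = 1" | "1 < s"
    by linarith
  then show "p = q"
  proof cases
    case 1
    with no[of p q s] pq s show ?thesis
      by blast
  next
    case 2
    with s show ?thesis
      by simp
  next
    case 3
    with s(1) have "pt q - pt \<omega> = (1 / s) *\<^sub>R (pt p - pt \<omega>)"
      by simp
    with no[of q p "1 / s"] pq 3 show ?thesis
      by simp
  qed
qed

text \<open>At an end \<open>w1\<close> of the dual edge a further term joins the minimum, so the
  cell of \<open>w1\<close> is two-dimensional. The direction of the dual edge is a supporting
  functional of this cell, and the face that it cuts out is the segment from \<open>\<omega>\<close>
  to \<open>q\<close>.\<close>

lemma edge_end_if_nondegenerate:
  assumes "finite A" and int: "interior_lattice_points (convex hull (pt ` A)) = {\<omega>}"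
    and cyc: "determines_cycle A u \<omega>" and q: "q \<in> A - {\<omega>}"
    and w: "wa \<in> dual_edge A u \<omega> q" "wb \<in> dual_edge A u \<omega> q" "wa \<noteq> wb"
  shows "q \<in> edge_ends A u \<omega>"
proof -
  have \<omega>: "pt \<omega> \<in> interior (convex hull (pt ` A))"
    using int by (auto simp: interior_lattice_points_def)
  have "\<omega> \<in> A"
    using strict_minimizer_if_cycle(1)[OF assms(1) \<omega> cyc] .
  obtain w0 where w0: "\<And>p. p \<in> A - {\<omega>} \<Longrightarrow> trop_term u \<omega> w0 < trop_term u p w0"
    using strict_minimizer_if_cycle(2)[OF assms(1) \<omega> cyc] by blast
  let ?E = "dual_edge A u \<omega> q" and ?x = "\<lambda>p. pt p - pt \<omega>"
  have E: "w \<in> ?E \<longleftrightarrow> u q + ?x q \<bullet> w = u \<omega> \<and> (\<forall>p\<in>A. u \<omega> \<le> u p + ?x p \<bullet> w)" for w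
    unfolding dual_edge_eq[OF assms(1) \<open>\<omega> \<in> A\<close> DiffD1[OF q]] using q \<open>\<omega> \<in> A\<close>
    by (auto simp: minimizers_def trop_term_eq inner_diff_left algebra_simps dest: bspec)
      (metis add.commute add_le_cancel_left order_antisym)+
  have "?E = {w. \<forall>p\<in>A. u \<omega> \<le> u p + ?x p \<bullet> w} \<inter> {w. ?x q \<bullet> w = u \<omega> - u q}"
    by (auto simp: E)
  moreover have "convex {w. \<forall>p\<in>A. u \<omega> \<le> u p + ?x p \<bullet> w}"
  proof -
    have "{w. \<forall>p\<in>A. u \<omega> \<le> u p + ?x p \<bullet> w} = (\<Inter>p\<in>A. {w. ?x p \<bullet> w \<ge> u \<omega> - u p})"
      by (auto simp: algebra_simps)
    then show ?thesis
      by (simp add: convex_INT convex_halfspace_ge)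
  qed
  ultimately have "compact ?E" "convex ?E"
    using compact_superlevel[OF assms(1) \<omega>]
    by (auto intro!: compact_Int_closed closed_hyperplane convex_Int convex_hyperplane)
  then obtain w1 where w1: "w1 extreme_point_of ?E"
    using extreme_point_exists_convex[of ?E] w by blast
  then have "w1 \<in> ?E"
    by (simp add: extreme_point_of_def)
  obtain w2 where w2: "w2 \<in> ?E" "w2 \<noteq> w1"
    using w by metis
  define d where "d = w2 - w1"
  let ?M = "minimizers A u w1"
  have M: "p \<in> ?M \<longleftrightarrow> p \<in> A \<and> u p + ?x p \<bullet> w1 = u \<omega>" for p
    using \<open>w1 \<in> ?E\<close> \<open>\<omega> \<in> A\<close> unfolding E
    by (force simp: minimizers_def trop_term_eq inner_diff_left)
  have "\<omega> \<in> ?M" "q \<in> ?M"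
    using \<open>w1 \<in> ?E\<close> \<open>\<omega> \<in> A\<close> q by (auto simp: M E)
  have xd: "0 \<le> ?x p \<bullet> d" if "p \<in> ?M" for p
    using w2(1) that by (auto simp: M E d_def inner_diff_right)
  have qd: "?x q \<bullet> d = 0"
    using w2(1) \<open>w1 \<in> ?E\<close> by (auto simp: E d_def inner_diff_right)
  \<comment> \<open>If all minimizers at \<open>w1\<close> were orthogonal to \<open>d\<close>, the
    dual edge would continue beyond its end.\<close>
  obtain p where p: "p \<in> ?M" "?x p \<bullet> d \<noteq> 0"
  proof (rule ccontr)
    assume "\<not> thesis"
    with that have 0: "?x p \<bullet> d = 0" if "p \<in> ?M" for p
      using that by blast
    have "\<forall>\<^sub>F t in at_right 0. \<forall>p\<in>A. 0 \<le> (u p + ?x p \<bullet> w1 - u \<omega>) + t * (?x p \<bullet> (- d))"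
      using \<open>w1 \<in> ?E\<close> 0 by (intro eventually_nonnegative assms(1)) (auto simp: E M order_le_less)
    then obtain t where t: "0 < t" "\<forall>p\<in>A. 0 \<le> (u p + ?x p \<bullet> w1 - u \<omega>) + t * (?x p \<bullet> (- d))"
      using at_right_obtain by (metis (no_types, lifting))
    have "w1 - t *\<^sub>R d \<in> ?E"
      using t \<open>w1 \<in> ?E\<close> qd by (auto simp: E inner_diff_right)
    moreover have "w1 \<in> open_segment (w1 - t *\<^sub>R d) w2"
    proof -
      \<comment> \<open>The point \<open>w1\<close> divides the segment from \<open>w1 - t d\<close>
        to \<open>w1 + d\<close> in the ratio \<open>t : 1\<close>, whence the parameter
        \<open>t / (1 + t)\<close>.\<close>
      have "(1 - s) *\<^sub>R (w1 - t *\<^sub>R d) + s *\<^sub>R w2 = w1 + (s - (1 - s) * t) *\<^sub>R d" for s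
        by (simp add: d_def algebra_simps)
      moreover have "t / (1 + t) - (1 - t / (1 + t)) * t = 0"
        using t(1) by (simp add: field_simps)
      ultimately have "w1 = (1 - t / (1 + t)) *\<^sub>R (w1 - t *\<^sub>R d) + (t / (1 + t)) *\<^sub>R w2"
        by simp
      moreover have "w1 - t *\<^sub>R d \<noteq> w2"
      proof
        assume "w1 - t *\<^sub>R d = w2"
        then have "(1 + t) *\<^sub>R d = 0"
          by (simp add: d_def algebra_simps)
        with t(1) w2(2) show False
          by (simp add: d_def)
      qed
      ultimately show ?thesis
        using t(1) by (auto simp: in_segment intro!: exI[of _ "t / (1 + t)"])
    qed
    ultimately show False
      using w1 w2(1) by (auto simp: extreme_point_of_def)
  qed
  let ?R = "convex hull (pt ` ?M)"
  have "interior ?R \<noteq> {}"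
  proof
    assume "interior ?R = {}"
    then obtain a b where a: "a \<noteq> 0" "?R \<subseteq> {x. a \<bullet> x = b}"
      using empty_interior_subset_hyperplane[OF convex_convex_hull] by metis
    have b: "a \<bullet> pt r = b" if "r \<in> ?M" for r
      using a(2) hull_inc[of "pt r" "pt ` ?M" convex] that by auto
    have "?x q \<noteq> 0" "a \<bullet> ?x q = 0" "d \<bullet> ?x q = 0"
      using q qd b[OF \<open>\<omega> \<in> ?M\<close>] b[OF \<open>q \<in> ?M\<close>] by (auto simp: inner_diff_right inner_commute)
    then obtain s where "d = s *\<^sub>R a"
      using orthogonal_parallel[of "?x q" a d] a(1) by blast
    then have "?x p \<bullet> d = s * (a \<bullet> pt p - a \<bullet> pt \<omega>)"
      by (simp add: inner_commute[of _ a] inner_diff_right)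
    with p b[OF \<open>\<omega> \<in> ?M\<close>] b[OF p(1)] show False
      by simp
  qed
  then have cell: "(?R, ?M) \<in> marked_subdivision A u"
    unfolding marked_subdivision_eq[OF assms(1)] by blast
  have ge: "d \<bullet> pt \<omega> \<le> d \<bullet> x" if "x \<in> ?R" for x
  proof -
    have "d \<bullet> pt \<omega> \<le> d \<bullet> pt r" if "r \<in> ?M" for r
      using xd[OF that] by (simp add: inner_commute[of _ d] inner_diff_right)
    then have "?R \<subseteq> {x. d \<bullet> x \<ge> d \<bullet> pt \<omega>}"
      by (intro hull_minimal convex_halfspace_ge) blast
    with that show ?thesis
      by blast
  qed
  have "(?R \<inter> {x. d \<bullet> x = d \<bullet> pt \<omega>}) face_of ?R"
    using ge by (intro face_of_Int_supporting_hyperplane_ge convex_convex_hull)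
  also have "?R \<inter> {x. d \<bullet> x = d \<bullet> pt \<omega>} = {z \<in> ?R. \<forall>z'\<in>?R. d \<bullet> z \<le> d \<bullet> z'}"
    using ge hull_inc[of "pt \<omega>" "pt ` ?M" convex] \<open>\<omega> \<in> ?M\<close> by (auto intro: antisym)
  also have "\<dots> = convex hull {x \<in> pt ` ?M. \<forall>y\<in>pt ` ?M. d \<bullet> x \<le> d \<bullet> y}"
    by (rule convex_hull_minimizers) (use assms(1) in \<open>simp add: minimizers_def\<close>)
  also have "{x \<in> pt ` ?M. \<forall>y\<in>pt ` ?M. d \<bullet> x \<le> d \<bullet> y} = {pt \<omega>, pt q}"
  proof -
    have "r = q" if r: "r \<in> ?M - {\<omega>}" "?x r \<bullet> d = 0" for r
    proof -
      have "?x q \<noteq> 0" "d \<bullet> ?x q = 0" "d \<bullet> ?x r = 0" "d \<noteq> 0"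
        using q qd r w2 by (auto simp: inner_commute d_def)
      then obtain s where s: "?x r = s *\<^sub>R ?x q"
        using orthogonal_parallel[of d "?x q" "?x r"] by (metis inner_commute)
      \<comment> \<open>Strict minimality at \<open>w0\<close> puts all other minimizers on the
        positive side of \<open>w0 - w1\<close>, so \<open>r\<close> lies on the ray of
        \<open>q\<close> and not on the opposite one.\<close>
      have pos: "0 < ?x p \<bullet> (w0 - w1)" if "p \<in> ?M - {\<omega>}" for p
        using w0[of p] that by (auto simp: M trop_term_eq inner_diff_left inner_diff_right)
      have "0 < s * (?x q \<bullet> (w0 - w1))" "0 < ?x q \<bullet> (w0 - w1)"
        using pos[OF r(1)] pos[of q] s q \<open>q \<in> ?M\<close> by simp_all
      then have "0 < s"
        by (simp add: zero_less_mult_iff)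
      then show "r = q"
        using lattice_point_on_ray[OF assms(1) int _ q s] r by (auto simp: M)
    qed
    moreover have iff: "d \<bullet> pt r = d \<bullet> pt \<omega> \<longleftrightarrow> ?x r \<bullet> d = 0" for r
      by (simp add: inner_commute[of _ d] inner_diff_right)
    moreover have ge': "d \<bullet> pt \<omega> \<le> d \<bullet> pt r" if "r \<in> ?M" for r
      using ge[of "pt r"] that by (simp add: hull_inc)
    ultimately have "r = \<omega> \<or> r = q" if "r \<in> ?M" "d \<bullet> pt r \<le> d \<bullet> pt \<omega>" for r
      using that by (metis DiffI antisym singletonD)
    then have "{x \<in> pt ` ?M. \<forall>y\<in>pt ` ?M. d \<bullet> x \<le> d \<bullet> y} \<subseteq> {pt \<omega>, pt q}"
      using \<open>\<omega> \<in> ?M\<close> by blast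
    moreover have "d \<bullet> pt q = d \<bullet> pt \<omega>"
      using iff qd by blast
    then have "{pt \<omega>, pt q} \<subseteq> {x \<in> pt ` ?M. \<forall>y\<in>pt ` ?M. d \<bullet> x \<le> d \<bullet> y}"
      using \<open>\<omega> \<in> ?M\<close> \<open>q \<in> ?M\<close> ge' by simp
    ultimately show ?thesis
      by (rule equalityI)
  qed
  also have "convex hull {pt \<omega>, pt q} = closed_segment (pt \<omega>) (pt q)"
    by (simp add: segment_convex_hull)
  finally have "closed_segment (pt \<omega>) (pt q) edge_of ?R"
    using q by (auto simp: edge_of_def segment_convex_hull aff_dim_convex_hull aff_dim_2)
  with cell q show ?thesis
    unfolding edge_ends_def by blast
qed

text \<open>A dual edge that does not belong to an edge of the subdivision is empty or a point and
  has diameter \<open>0\<close>. So the sum may run over all marked points, and the geometry of the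
  cells is no longer needed.\<close>

lemma j_trop_eq_sum:
  assumes "finite A" and int: "interior_lattice_points (convex hull (pt ` A)) = {\<omega>}"
    and cyc: "determines_cycle A u \<omega>"
  shows "j_trop A u = (\<Sum>q\<in>A - {\<omega>}. lattice_length A u \<omega> q)"
proof -
  have "determines_cycle A u = (\<lambda>\<omega>'. \<omega>' = \<omega>)"
    using int cyc by (auto simp: determines_cycle_def newton_polygon_def)
  then have "j_trop A u = (\<Sum>q\<in>edge_ends A u \<omega>. lattice_length A u \<omega> q)"
    by (simp add: j_trop_def has_cycle_def cycle_length_def)
  also have "\<dots> = (\<Sum>q\<in>A - {\<omega>}. lattice_length A u \<omega> q)"
  proof (rule sum.mono_neutral_left)
    show "edge_ends A u \<omega> \<subseteq> A - {\<omega>}"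
      by (auto simp: edge_ends_def edge_of_def)
    show "\<forall>q\<in>A - {\<omega>} - edge_ends A u \<omega>. lattice_length A u \<omega> q = 0"
    proof
      fix q assume q: "q \<in> A - {\<omega>} - edge_ends A u \<omega>"
      then have "\<And>wa wb. wa \<in> dual_edge A u \<omega> q \<Longrightarrow> wb \<in> dual_edge A u \<omega> q \<Longrightarrow> wa = wb"
        using edge_end_if_nondegenerate[OF assms(1) int cyc] by blast
      then have "dual_edge A u \<omega> q = {} \<or> (\<exists>w. dual_edge A u \<omega> q = {w})"
        by blast
      then show "lattice_length A u \<omega> q = 0"
        by (auto simp: lattice_length_def)
    qed
  qed (use assms(1) in simp)
  finally show ?thesis .
qed

section \<open>The perimeter of the dual polygon\<close>

lemma pairing_linear: "linear (pairing q)"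
  by (intro linearI) (simp_all add: pairing_def algebra_simps)

lemma pairing_add: "pairing q (w + w') = pairing q w + pairing q w'"
  and pairing_diff: "pairing q (w - w') = pairing q w - pairing q w'"
  and pairing_scaleR: "pairing q (t *\<^sub>R w) = t * pairing q w"
  by (simp_all add: pairing_def algebra_simps)

lemma continuous_on_pairing [continuous_intros]: "continuous_on S (pairing q)"
  unfolding pairing_def by (intro continuous_intros)

lemma pairing_decompose:
  assumes "det2 v d = 1"
  shows "pairing q w = of_int (det2 q d) * pairing v w + of_int (det2 v q) * pairing d w"
proof -
  have 1: "real_of_int (det2 v d) = 1"
    using assms by simp
  have "of_int (det2 q d) * pairing v w + of_int (det2 v q) * pairing d w
      = of_int (det2 v d) * pairing q w"
    by (simp add: det2_def pairing_def algebra_simps)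
  then show ?thesis
    by (simp only: 1)
qed

text \<open>
  Breaking ties by the direction of the next side makes the minimizer a vertex and lets the sum
  over the sides telescope.
\<close>

definition lexmin :: "(real \<times> real) set \<Rightarrow> lpt \<Rightarrow> lpt \<Rightarrow> real \<times> real \<Rightarrow> bool" where
  "lexmin P v d w \<longleftrightarrow> w \<in> P \<and>
     (\<forall>w'\<in>P. pairing v w \<le> pairing v w' \<and> (pairing v w' = pairing v w \<longrightarrow> pairing d w' \<le> pairing d w))"

lemma lexmin_exists:
  assumes "compact P" "P \<noteq> {}"
  obtains w where "lexmin P v d w"
proof -
  obtain w1 where w1: "w1 \<in> P" "\<forall>w'\<in>P. pairing v w1 \<le> pairing v w'"
    using continuous_attains_inf[OF assms, of "pairing v"] continuous_on_pairing by blast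
  let ?F = "P \<inter> {w. pairing v w = pairing v w1}"
  have "closed {w. pairing v w = pairing v w1}"
    by (intro closed_Collect_eq continuous_on_pairing continuous_on_const)
  then have "compact ?F"
    by (intro compact_Int_closed assms)
  moreover have "?F \<noteq> {}"
    using w1 by blast
  ultimately obtain w where w: "w \<in> ?F" "\<forall>w'\<in>?F. pairing d w' \<le> pairing d w"
    using continuous_attains_sup[of ?F "pairing d"] continuous_on_pairing by blast
  then have "lexmin P v d w"
    using w1 by (auto simp: lexmin_def)
  with that show thesis
    by blast
qed

definition feasible :: "lpt set \<Rightarrow> (lpt \<Rightarrow> real) \<Rightarrow> (real \<times> real) set" where
  "feasible X h = {w. \<forall>q\<in>X. 0 \<le> h q + pairing q w}"

definition tight :: "lpt set \<Rightarrow> (lpt \<Rightarrow> real) \<Rightarrow> lpt \<Rightarrow> (real \<times> real) set" where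
  "tight X h q = {w \<in> feasible X h. h q + pairing q w = 0}"

lemma convex_feasible: "convex (feasible X h)"
proof (rule convexI)
  fix w w' s t assume w: "w \<in> feasible X h" "w' \<in> feasible X h" and st: "0 \<le> s" "0 \<le> t" "s + t = (1::real)"
  have "0 \<le> h q + pairing q (s *\<^sub>R w + t *\<^sub>R w')" if "q \<in> X" for q
  proof -
    have "0 \<le> s * (h q + pairing q w) + t * (h q + pairing q w')"
      using w st that by (simp add: feasible_def)
    also have "\<dots> = (s + t) * h q + pairing q (s *\<^sub>R w + t *\<^sub>R w')"
      by (simp add: pairing_add pairing_scaleR algebra_simps)
    finally show ?thesis
      using st by simp
  qed
  then show "s *\<^sub>R w + t *\<^sub>R w' \<in> feasible X h"
    by (simp add: feasible_def)
qed

lemma tight_eq: "tight X h q = feasible X h \<inter> {w. pairing q w = - h q}"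
  by (auto simp: tight_def)

lemma compact_tight: "compact (feasible X h) \<Longrightarrow> compact (tight X h q)"
  unfolding tight_eq
  by (intro compact_Int_closed closed_Collect_eq continuous_on_pairing continuous_on_const)

lemma convex_tight: "convex (tight X h q)"
proof -
  have "{w. pairing q w = - h q} = pairing q -` {- h q}"
    by auto
  then have "convex {w. pairing q w = - h q}"
    using convex_linear_vimage[OF pairing_linear] by simp
  then show ?thesis
    unfolding tight_eq by (intro convex_Int convex_feasible)
qed

lemma eventually_feasible_direction:
  assumes "finite X" "w \<in> feasible X h"
    and "\<And>q. q \<in> X \<Longrightarrow> w \<in> tight X h q \<Longrightarrow> 0 \<le> pairing q \<eta>"
  obtains t where "0 < t" "w + t *\<^sub>R \<eta> \<in> feasible X h"
proof -
  have "\<forall>\<^sub>F t in at_right 0. \<forall>q\<in>X. 0 \<le> (h q + pairing q w) + t * pairing q \<eta>"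
    using assms by (intro eventually_nonnegative) (auto simp: feasible_def tight_def order_le_less)
  then obtain t where "0 < t" "\<forall>q\<in>X. 0 \<le> (h q + pairing q w) + t * pairing q \<eta>"
    using at_right_obtain by (metis (no_types, lifting))
  with that[of t] show thesis
    by (simp add: feasible_def pairing_add pairing_scaleR add.assoc)
qed

text \<open>First-order conditions: a direction along which no tight constraint decreases can be
  followed for a short time.\<close>

lemma lexmin_direction:
  assumes "finite X" "lexmin (feasible X h) v d w"
    and "\<And>q. q \<in> X \<Longrightarrow> w \<in> tight X h q \<Longrightarrow> 0 \<le> pairing q \<eta>"
  shows "0 \<le> pairing v \<eta>" "pairing v \<eta> = 0 \<Longrightarrow> pairing d \<eta> \<le> 0"
proof -
  have "w \<in> feasible X h"
    using assms(2) by (simp add: lexmin_def)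
  then obtain t where t: "0 < t" "w + t *\<^sub>R \<eta> \<in> feasible X h"
    using eventually_feasible_direction[OF assms(1) _ assms(3)] by blast
  then have "pairing v w \<le> pairing v (w + t *\<^sub>R \<eta>)"
    "pairing v (w + t *\<^sub>R \<eta>) = pairing v w \<longrightarrow> pairing d (w + t *\<^sub>R \<eta>) \<le> pairing d w"
    using assms(2) by (auto simp: lexmin_def)
  with t(1) show "0 \<le> pairing v \<eta>" "pairing v \<eta> = 0 \<Longrightarrow> pairing d \<eta> \<le> 0"
    by (auto simp: pairing_add pairing_scaleR zero_le_mult_iff mult_le_0_iff)
qed

text \<open>
  In the coordinates \<open>x = pairing d\<close> and \<open>y = - pairing v\<close> the points \<open>v + j d\<close> of a side bound \<open>y\<close>
  from above by \<open>h (v + j d) + j x\<close>, all other points do not bound \<open>y\<close> from above. So the edges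
  of the feasible polygon that belong to the side form the graph of a concave function of \<open>x\<close>.
\<close>

lemma side_length:
  assumes "finite X" "compact (feasible X h)" and vd: "det2 v d = 1"
    and side: "\<And>q. q \<in> X \<Longrightarrow> det2 q d \<le> 1" "\<And>q. q \<in> X \<Longrightarrow> det2 q d = 1 \<Longrightarrow> 0 \<le> det2 v q \<and> det2 v q \<le> n"
    and w: "lexmin (feasible X h) v d w"
    and v': "fst v' = fst v + n * fst d" "snd v' = snd v + n * snd d" "0 \<le> n"
    and d': "fst d' = fst d - l * fst v'" "snd d' = snd d - l * snd v'"
    and w': "lexmin (feasible X h) v' d' w'"
  shows "(\<Sum>q | q \<in> X \<and> det2 q d = 1 \<and> det2 v q < n. measure lebesgue (pairing d ` tight X h q))
    = pairing d w - pairing d w'"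
proof -
  define y where "y w = - pairing v w" for w
  let ?x = "pairing d" and ?P = "feasible X h"
  define J where "J = {q \<in> X. det2 q d = 1}"
  define J' where "J' = {q. q \<in> X \<and> det2 q d = 1 \<and> det2 v q < n}"
  let ?j = "\<lambda>q. real_of_int (det2 v q)"
  have J: "pairing q w = - y w + ?j q * ?x w" if "q \<in> J" for q w
    using pairing_decompose[OF vd, of q w] that by (simp add: J_def y_def)
  have le: "y w \<le> h q + ?j q * ?x w" if "w \<in> ?P" "q \<in> J" for w q
    using that J[OF that(2), of w] by (auto simp: feasible_def J_def)
  have tight: "w \<in> tight X h q \<longleftrightarrow> w \<in> ?P \<and> y w = h q + ?j q * ?x w" if "q \<in> J" for w q
    using J[OF that, of w] by (auto simp: tight_def)
  have v'w: "pairing v' w = - y w + n * ?x w" for w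
    by (simp add: v' y_def pairing_def algebra_simps)
  \<comment> \<open>Since \<open>d'\<close> differs from \<open>d\<close> by a multiple of
    \<open>v'\<close>, the two break ties among the minimizers of \<open>v'\<close> in the same
    way.\<close>
  have d'w: "pairing d' w = ?x w - l * pairing v' w" for w
    by (simp add: d' pairing_def algebra_simps)
  have "w \<in> ?P" "w' \<in> ?P"
    using w w' by (simp_all add: lexmin_def)
  have ymax: "y z \<le> y w" "y z = y w \<Longrightarrow> ?x z \<le> ?x w" if "z \<in> ?P" for z
    using w that by (auto simp: lexmin_def y_def)
  have zmax: "y z - n * ?x z \<le> y w' - n * ?x w'"
      "y z - n * ?x z = y w' - n * ?x w' \<Longrightarrow> ?x z \<le> ?x w'" if "z \<in> ?P" for z
  proof -
    show "y z - n * ?x z \<le> y w' - n * ?x w'"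
      using w' that by (auto simp: lexmin_def v'w)
    assume "y z - n * ?x z = y w' - n * ?x w'"
    then have "pairing v' z = pairing v' w'"
      by (simp add: v'w)
    moreover from this have "pairing d' z \<le> pairing d' w'"
      using w' that by (auto simp: lexmin_def)
    ultimately show "?x z \<le> ?x w'"
      by (simp add: d'w)
  qed
  have xle: "?x w' \<le> ?x w"
  proof (rule ccontr)
    assume less: "\<not> ?x w' \<le> ?x w"
    then have "y w' < y w"
      using ymax[OF \<open>w' \<in> ?P\<close>] by fastforce
    moreover have "n * ?x w \<le> n * ?x w'"
      using less v'(3) by (simp add: mult_left_mono)
    ultimately show False
      using zmax(1)[OF \<open>w \<in> ?P\<close>] by simp
  qed
  have upper: "?x z \<in> {?x w'..?x w}" if "q \<in> J'" "z \<in> tight X h q" for q z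
  proof -
    have q: "q \<in> J" "0 \<le> ?j q" "?j q < n"
      using that(1) side(2)[of q] by (auto simp: J_def J'_def)
    have z: "z \<in> ?P" "y z = h q + ?j q * ?x z"
      using tight[OF q(1)] that(2) by auto
    have "?x z \<le> ?x w"
    proof (rule ccontr)
      assume less: "\<not> ?x z \<le> ?x w"
      then have "y z < y w"
        using ymax[OF z(1)] by fastforce
      moreover have "?j q * ?x w \<le> ?j q * ?x z"
        using less q(2) by (simp add: mult_left_mono)
      ultimately show False
        using le[OF \<open>w \<in> ?P\<close> q(1)] z(2) by simp
    qed
    moreover have "?x w' \<le> ?x z"
    proof (rule ccontr)
      assume less: "\<not> ?x w' \<le> ?x z"
      then have "(n - ?j q) * ?x z < (n - ?j q) * ?x w'"
        using q(3) by simp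
      then show False
        using le[OF \<open>w' \<in> ?P\<close> q(1)] z(2) zmax(1)[OF z(1)] by (simp add: algebra_simps)
    qed
    ultimately show ?thesis
      by simp
  qed
  \<comment> \<open>Over each \<open>x\<close> of the open interval the highest point of the polygon
    lies on an edge that belongs to the side.\<close>
  have lower: "\<exists>q\<in>J'. x \<in> ?x ` tight X h q" if x: "?x w' < x" "x < ?x w" for x
  proof -
    define s where "s = (x - ?x w') / (?x w - ?x w')"
    have s: "0 \<le> s" "s \<le> 1" "s * (?x w - ?x w') = x - ?x w'"
      using x by (auto simp: s_def)
    have "(1 - s) *\<^sub>R w' + s *\<^sub>R w \<in> ?P"
      using convex_feasible[of X h] \<open>w \<in> ?P\<close> \<open>w' \<in> ?P\<close> s by (simp add: convex_alt)
    moreover have "?x ((1 - s) *\<^sub>R w' + s *\<^sub>R w) = x"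
      using s(3) by (simp add: pairing_add pairing_diff pairing_scaleR algebra_simps)
    ultimately have "?P \<inter> {z. ?x z = x} \<noteq> {}"
      by blast
    moreover have "closed {z. ?x z = x}"
      by (intro closed_Collect_eq continuous_on_pairing continuous_on_const)
    then have "compact (?P \<inter> {z. ?x z = x})"
      by (intro compact_Int_closed assms(2))
    ultimately obtain z where z: "z \<in> ?P" "?x z = x"
        and zm: "\<And>z'. z' \<in> ?P \<Longrightarrow> ?x z' = x \<Longrightarrow> y z' \<le> y z"
      using continuous_attains_inf[of "?P \<inter> {z. ?x z = x}" "pairing v"] continuous_on_pairing
      unfolding y_def by (metis (mono_tags, lifting) IntE IntI mem_Collect_eq neg_le_iff_le)
    obtain q where q: "q \<in> J" "z \<in> tight X h q"
    proof (rule ccontr)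
      note thesisI = that
      assume *: "\<not> thesis"
      \<comment> \<open>The direction that raises \<open>y\<close> at constant \<open>x\<close>.
        Only constraints with \<open>det2 q d = 1\<close> decrease along it.\<close>
      define \<eta> where "\<eta> = (- of_int (snd d) :: real, of_int (fst d) :: real)"
      have \<eta>: "pairing q \<eta> = - of_int (det2 q d)" for q
        by (simp add: \<eta>_def pairing_def det2_def)
      have "0 \<le> pairing q \<eta>" if q: "q \<in> X" "z \<in> tight X h q" for q
      proof -
        have "q \<notin> J"
          using * thesisI q(2) by blast
        then have "det2 q d \<noteq> 1"
          using q(1) by (simp add: J_def)
        with side(1)[OF q(1)] show ?thesis
          by (simp add: \<eta>)
      qed
      then obtain t where t: "0 < t" "z + t *\<^sub>R \<eta> \<in> ?P"
        using eventually_feasible_direction[OF assms(1) z(1)] by blast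
      have "?x (z + t *\<^sub>R \<eta>) = x" "y (z + t *\<^sub>R \<eta>) = y z + t"
        using vd z(2) by (simp_all add: pairing_add pairing_scaleR \<eta> y_def) (simp add: det2_def)
      with zm[OF t(2)] t(1) show False
        by simp
    qed
    \<comment> \<open>The end of the side is counted with the next side. If it were tight at
      \<open>z\<close>, then \<open>z\<close> would minimize \<open>v'\<close> with a larger
      \<open>x\<close> than the tie-break at \<open>w'\<close> permits.\<close>
    have "det2 v q < n"
    proof (rule ccontr)
      assume "\<not> det2 v q < n"
      then have "det2 v q = n"
        using side(2)[of q] q(1) by (simp add: J_def)
      then have "y z - n * ?x z = h q" "y w' - n * ?x w' \<le> h q"
        using tight[OF q(1)] q(2) le[OF \<open>w' \<in> ?P\<close> q(1)] by auto
      then show False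
        using zmax[OF z(1)] x(1) z(2) by simp
    qed
    then have "q \<in> J'"
      using q(1) by (simp add: J_def J'_def)
    with q(2) z(2) show ?thesis
      by blast
  qed
  have "finite J'"
    using assms(1) by (simp add: J'_def)
  have "(\<Sum>q\<in>J'. measure lebesgue (?x ` tight X h q)) = measure lebesgue (\<Union>q\<in>J'. ?x ` tight X h q)"
  proof (rule measure_negligible_finite_Union_image[symmetric])
    show "?x ` tight X h q \<in> lmeasurable" for q
      using compact_continuous_image[OF continuous_on_pairing compact_tight[OF assms(2)]]
      by (rule lmeasurable_compact)
    \<comment> \<open>Two lines of different slope share only one value of \<open>x\<close>, so the
      projected edges overlap in null sets.\<close>
    show "pairwise (\<lambda>q r. negligible (?x ` tight X h q \<inter> ?x ` tight X h r)) J'"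
    proof (rule pairwiseI)
      fix q r assume qr: "q \<in> J'" "r \<in> J'" "q \<noteq> r"
      then have qrJ: "q \<in> J" "r \<in> J"
        by (auto simp: J_def J'_def)
      have "?j q \<noteq> ?j r"
      proof
        assume "?j q = ?j r"
        then have "pairing q z = pairing r z" for z
          using J[OF qrJ(1), of z] J[OF qrJ(2), of z] by simp
        from this[of "(1,0)"] this[of "(0,1)"] qr(3) show False
          by (simp add: pairing_def prod_eq_iff)
      qed
      have "x = (h q - h r) / (?j r - ?j q)" if "x \<in> ?x ` tight X h q \<inter> ?x ` tight X h r" for x
      proof -
        obtain z z' where z: "z \<in> tight X h q" "x = ?x z" "z' \<in> tight X h r" "x = ?x z'"
          using \<open>x \<in> _\<close> by blast
        have "y z = y z'"
          using z le[of z r] le[of z' q] tight[OF qrJ(1)] tight[OF qrJ(2)] qrJ by fastforce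
        then have "h q + ?j q * x = h r + ?j r * x"
          using z tight[OF qrJ(1)] tight[OF qrJ(2)] by simp
        with \<open>?j q \<noteq> ?j r\<close> show ?thesis
          by (simp add: field_simps)
      qed
      then have "?x ` tight X h q \<inter> ?x ` tight X h r \<subseteq> {(h q - h r) / (?j r - ?j q)}"
        by blast
      then show "negligible (?x ` tight X h q \<inter> ?x ` tight X h r)"
        by (rule negligible_subset[rotated]) simp
    qed
  qed fact
  also have "\<dots> = ?x w - ?x w'"
  proof (rule antisym)
    have meas: "(\<Union>q\<in>J'. ?x ` tight X h q) \<in> lmeasurable"
      using compact_continuous_image[OF continuous_on_pairing compact_tight[OF assms(2)]]
      by (intro lmeasurable_compact compact_UN \<open>finite J'\<close>)
    have "measure lebesgue (\<Union>q\<in>J'. ?x ` tight X h q) \<le> measure lebesgue {?x w'..?x w}"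
      using upper meas by (intro measure_mono_fmeasurable) auto
    then show "measure lebesgue (\<Union>q\<in>J'. ?x ` tight X h q) \<le> ?x w - ?x w'"
      using xle by simp
    have "measure lebesgue {?x w'<..<?x w} \<le> measure lebesgue (\<Union>q\<in>J'. ?x ` tight X h q)"
      using lower meas by (intro measure_mono_fmeasurable) auto
    then show "?x w - ?x w' \<le> measure lebesgue (\<Union>q\<in>J'. ?x ` tight X h q)"
      using xle by simp
  qed
  finally show ?thesis
    by (simp add: J'_def)
qed

section \<open>Summation over the sides\<close>

definition on_side :: "lpt \<times> lpt \<times> int \<times> int \<Rightarrow> lpt \<Rightarrow> bool" where
  "on_side = (\<lambda>(v, d, n, l) q. det2 q d = 1 \<and> det2 v q < n)"

lemma frame_facts:
  "\<forall>s\<in>set (frame \<sigma>). case s of (v, d, n, l) \<Rightarrow> det2 v d = 1 \<and> 0 \<le> n \<and>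
     (\<forall>q\<in>set (boundary \<sigma>). det2 q d \<le> 1 \<and> (det2 q d = 1 \<longrightarrow> 0 \<le> det2 v q \<and> det2 v q \<le> n))"
  by (cases \<sigma>) (simp only:; code_simp)+

lemma boundary_partition:
  "\<forall>q\<in>set (boundary \<sigma>). (\<Sum>s\<leftarrow>frame \<sigma>. if on_side s q then 1 else 0) = (1::int)"
  by (cases \<sigma>) (simp only:; code_simp)+

lemma boundary_facts:
  "(0,0) \<notin> set (boundary \<sigma>)" "distinct (boundary \<sigma>)"
  "\<forall>v\<in>set (map fst (corner_mults \<sigma>)). \<forall>p\<in>set (cones_around \<sigma> v). det2 (fst p) (snd p) dvd 12"
  by (cases \<sigma>; simp only:; code_simp)+

lemma sum_over_sides:
  assumes "X \<subseteq> set (boundary \<sigma>)"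
  shows "(\<Sum>q\<in>X. g q) = (\<Sum>s\<leftarrow>frame \<sigma>. \<Sum>q | q \<in> X \<and> on_side s q. (g q :: real))"
proof -
  have fin: "finite X"
    using assms finite_subset by blast
  have one: "(\<Sum>s\<leftarrow>frame \<sigma>. if on_side s q then 1 else 0) = (1::real)" if "q \<in> X" for q
  proof -
    have "real_of_int (\<Sum>s\<leftarrow>xs. if on_side s q then 1 else 0) = (\<Sum>s\<leftarrow>xs. if on_side s q then 1 else 0)" for xs
      by (induction xs) auto
    note eq = this[of "frame \<sigma>", symmetric]
    have "q \<in> set (boundary \<sigma>)"
      using assms that by blast
    note bp = bspec[OF boundary_partition this]
    show ?thesis
      unfolding eq bp by simp
  qed
  have "(\<Sum>s\<leftarrow>xs. \<Sum>q | q \<in> X \<and> on_side s q. g q) = (\<Sum>q\<in>X. g q * (\<Sum>s\<leftarrow>xs. if on_side s q then 1 else 0))" for xs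
  proof (induction xs)
    case (Cons s xs)
    have "(\<Sum>q | q \<in> X \<and> on_side s q. g q) = (\<Sum>q\<in>X. if on_side s q then g q else 0)"
      using fin by (simp add: sum.If_cases Int_def)
    moreover have "(\<Sum>q\<in>X. g q * (\<Sum>t\<leftarrow>s # xs. if on_side t q then 1 else 0))
        = (\<Sum>q\<in>X. (if on_side s q then g q else 0) + g q * (\<Sum>t\<leftarrow>xs. if on_side t q then 1 else 0))"
      by (rule sum.cong) (simp_all add: distrib_left)
    ultimately show ?case
      using Cons by (simp only: sum.distrib list.map sum_list.Cons)
  qed simp
  from this[of "frame \<sigma>"] show ?thesis
    using one by simp
qed

text \<open>Summation by parts. The minimizer at a corner occurs in the contributions of the sides
  that start and end there, with total coefficient \<open>d - d' = - l v\<close>.\<close>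

theorem perimeter:
  assumes X: "X \<subseteq> set (boundary \<sigma>)" and comp: "compact (feasible X h)"
    and len_ws: "length ws = length (frame \<sigma>)"
    and lex: "\<And>i. i < length (frame \<sigma>) \<Longrightarrow>
       lexmin (feasible X h) (fst (frame \<sigma> ! i)) (fst (snd (frame \<sigma> ! i))) (ws ! i)"
    and len: "\<And>q s. q \<in> X \<Longrightarrow> s \<in> set (frame \<sigma>) \<Longrightarrow> on_side s q \<Longrightarrow>
       len q = measure lebesgue (pairing (fst (snd s)) ` tight X h q)"
  shows "(\<Sum>q\<in>X. len q) = excess \<sigma> ws"
proof -
  have fin: "finite X"
    using X finite_subset by blast
  have side: "(\<Sum>q | q \<in> X \<and> on_side s q. len q) = pairing d w - pairing d w'"
    if s: "s \<in> set (frame \<sigma>)" "s = (v, d, n, l)"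
      and w: "lexmin (feasible X h) v d w" "lexmin (feasible X h) v' d' w'"
      and v': "fst v' = fst v + n * fst d" "snd v' = snd v + n * snd d"
      and d': "fst d' = fst d - l' * fst v'" "snd d' = snd d - l' * snd v'"
    for s v d n l v' d' l' w w'
  proof -
    note f = bspec[OF frame_facts s(1), unfolded s(2) prod.case]
    have "(\<Sum>q | q \<in> X \<and> on_side s q. len q)
        = (\<Sum>q | q \<in> X \<and> det2 q d = 1 \<and> det2 v q < n. measure lebesgue (pairing d ` tight X h q))"
    proof (rule sum.cong)
      show "{q \<in> X. on_side s q} = {q \<in> X. det2 q d = 1 \<and> det2 v q < n}"
        by (simp add: s(2) on_side_def)
      show "len q = measure lebesgue (pairing d ` tight X h q)"
        if "q \<in> {q \<in> X. det2 q d = 1 \<and> det2 v q < n}" for q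
        using len[OF _ s(1), of q] that by (simp add: s(2) on_side_def)
    qed
    also have "\<dots> = pairing d w - pairing d w'"
      using f X by (intro side_length[OF fin comp _ _ _ w(1) v' _ d' w(2)]) auto
    finally show ?thesis .
  qed
  show ?thesis
  proof (cases \<sigma>)
    case Triangle_42
    then obtain a b c where ws: "ws = [a, b, c]"
      using len_ws by (auto simp: length_Suc_conv numeral_eq_Suc)
    have l: "lexmin (feasible X h) (-1,-1) (1,0) a" "lexmin (feasible X h) (3,-1) (-2,1) b"
        "lexmin (feasible X h) (-1,1) (0,-1) c"
      using lex[of 0] lex[of 1] lex[of 2] by (simp_all add: Triangle_42 ws numeral_eq_Suc)
    show ?thesis
      unfolding sum_over_sides[OF X]
      using side[of _ "(-1,-1)" "(1,0)" 4 1 a "(3,-1)" "(-2,1)" b 1, OF _ refl l(1) l(2)]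
        side[of _ "(3,-1)" "(-2,1)" 2 1 b "(-1,1)" "(0,-1)" c 2, OF _ refl l(2) l(3)]
        side[of _ "(-1,1)" "(0,-1)" 2 2 c "(-1,-1)" "(1,0)" a 1, OF _ refl l(3) l(1)]
      by (simp add: Triangle_42 ws excess_def corner_mults_def pairing_def)
  next
    case Triangle_33
    then obtain a b c where ws: "ws = [a, b, c]"
      using len_ws by (auto simp: length_Suc_conv numeral_eq_Suc)
    have l: "lexmin (feasible X h) (-1,-1) (1,0) a" "lexmin (feasible X h) (2,-1) (-1,1) b"
        "lexmin (feasible X h) (-1,2) (0,-1) c"
      using lex[of 0] lex[of 1] lex[of 2] by (simp_all add: Triangle_33 ws numeral_eq_Suc)
    show ?thesis
      unfolding sum_over_sides[OF X]
      using side[of _ "(-1,-1)" "(1,0)" 3 1 a "(2,-1)" "(-1,1)" b 1, OF _ refl l(1) l(2)]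
        side[of _ "(2,-1)" "(-1,1)" 3 1 b "(-1,2)" "(0,-1)" c 1, OF _ refl l(2) l(3)]
        side[of _ "(-1,2)" "(0,-1)" 3 1 c "(-1,-1)" "(1,0)" a 1, OF _ refl l(3) l(1)]
      by (simp add: Triangle_33 ws excess_def corner_mults_def pairing_def)
  next
    case Square
    then obtain a b c e where ws: "ws = [a, b, c, e]"
      using len_ws by (auto simp: length_Suc_conv numeral_eq_Suc)
    have l: "lexmin (feasible X h) (-1,-1) (1,0) a" "lexmin (feasible X h) (1,-1) (0,1) b"
        "lexmin (feasible X h) (1,1) (-1,0) c" "lexmin (feasible X h) (-1,1) (0,-1) e"
      using lex[of 0] lex[of 1] lex[of 2] lex[of 3] by (simp_all add: Square ws numeral_eq_Suc)
    show ?thesis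
      unfolding sum_over_sides[OF X]
      using side[of _ "(-1,-1)" "(1,0)" 2 1 a "(1,-1)" "(0,1)" b 1, OF _ refl l(1) l(2)]
        side[of _ "(1,-1)" "(0,1)" 2 1 b "(1,1)" "(-1,0)" c 1, OF _ refl l(2) l(3)]
        side[of _ "(1,1)" "(-1,0)" 2 1 c "(-1,1)" "(0,-1)" e 1, OF _ refl l(3) l(4)]
        side[of _ "(-1,1)" "(0,-1)" 2 1 e "(-1,-1)" "(1,0)" a 1, OF _ refl l(4) l(1)]
      by (simp add: Square ws excess_def corner_mults_def pairing_def)
  qed
qed

section \<open>The leading monomial\<close>

text \<open>The two rays that bound the normal cone of the polygon at its vertex \<open>w\<close>,
  in counterclockwise order.\<close>

definition extreme_pair :: "lpt set \<Rightarrow> (lpt \<Rightarrow> real) \<Rightarrow> real \<times> real \<Rightarrow> lpt \<times> lpt \<Rightarrow> bool" where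
  "extreme_pair X h w p \<longleftrightarrow> fst p \<in> X \<and> snd p \<in> X \<and> w \<in> tight X h (fst p) \<and> w \<in> tight X h (snd p) \<and>
     0 < det2 (fst p) (snd p) \<and>
     (\<forall>q\<in>X. w \<in> tight X h q \<longrightarrow> 0 \<le> det2 (fst p) q \<and> 0 \<le> det2 q (snd p))"

lemma det2_commute: "det2 q p = - det2 p q"
  by (simp add: det2_def)

text \<open>All tight normals at \<open>w\<close> pair positively with \<open>w0 - w\<close>. They
  lie in an open half-plane and are ordered by their slope \<open>\<rho>\<close>, so a first and a
  last one exist; optimality of \<open>w\<close> places \<open>v\<close> between them.\<close>

lemma extreme_pair_exists:
  assumes "finite X" and w: "lexmin (feasible X h) v d w" and vd: "det2 v d = 1"
    and w0: "\<And>q. q \<in> X \<Longrightarrow> 0 < h q + pairing q w0"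
  obtains p where "extreme_pair X h w p" "0 \<le> det2 (fst p) v" "0 \<le> det2 v (snd p)"
proof -
  define T where "T = {q \<in> X. w \<in> tight X h q}"
  define \<delta> where "\<delta> = w0 - w"
  define \<delta>' where "\<delta>' = (- snd \<delta>, fst \<delta>)"
  define \<rho> where "\<rho> q = pairing q \<delta>' / pairing q \<delta>" for q
  note dir = lexmin_direction[OF assms(1) w]
  define perp where "perp q = (- of_int (snd q) :: real, of_int (fst q) :: real)" for q
  have perp: "pairing r (perp q) = of_int (det2 q r)" for q r
    by (simp add: perp_def pairing_def det2_def)
  have pos: "0 < pairing q \<delta>" if "q \<in> T" for q
    using w0[of q] that by (auto simp: T_def tight_def \<delta>_def pairing_diff)
  have det: "0 \<le> det2 q r" if "q \<in> T" "r \<in> T" "\<rho> q \<le> \<rho> r" for q r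
  proof -
    have "0 \<le> pairing q \<delta> * pairing r \<delta>' - pairing q \<delta>' * pairing r \<delta>"
      using that(3) pos[OF that(1)] pos[OF that(2)] by (simp add: \<rho>_def field_simps)
    also have "\<dots> = of_int (det2 q r) * (fst \<delta> ^ 2 + snd \<delta> ^ 2)"
      by (simp add: \<delta>'_def pairing_def det2_def power2_eq_square algebra_simps)
    finally show ?thesis
      using pos[OF that(1)] by (auto simp: zero_le_mult_iff pairing_def sum_power2_le_zero_iff)
  qed
  have "T \<noteq> {}"
  proof
    assume "T = {}"
    then have "0 \<le> pairing v (perp d)"
      by (intro dir(1)) (auto simp: T_def)
    with vd show False
      by (simp add: perp det2_commute[of v])
  qed
  moreover have "finite T"
    using assms(1) by (simp add: T_def)
  ultimately have "Min (\<rho> ` T) \<in> \<rho> ` T" "Max (\<rho> ` T) \<in> \<rho> ` T"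
    by (auto intro!: Min_in Max_in)
  then obtain p r where pr: "p \<in> T" "\<rho> p = Min (\<rho> ` T)" "r \<in> T" "\<rho> r = Max (\<rho> ` T)"
    by (metis imageE)
  have ext: "0 \<le> det2 p q" "0 \<le> det2 q r" if "q \<in> T" for q
    using that pr \<open>finite T\<close> by (auto intro!: det)
  have v: "0 \<le> det2 p v" "0 \<le> det2 v r"
  proof -
    show "0 \<le> det2 p v"
      using dir(1)[of "perp p"] ext(1) by (simp add: perp T_def)
    have "0 \<le> pairing v (- perp r)"
      using dir(1)[of "- perp r"] ext(2) pairing_scaleR[of _ "-1" "perp r"]
      by (simp add: perp T_def det2_commute[of r])
    then show "0 \<le> det2 v r"
      using pairing_scaleR[of v "-1" "perp r"] by (simp add: perp det2_commute[of r])
  qed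
  \<comment> \<open>Otherwise all tight normals are parallel and \<open>w\<close> can move both ways
    along an edge. Minimality together with the tie-break would make \<open>p\<close> parallel to
    both \<open>v\<close> and \<open>d\<close>.\<close>
  have "det2 p r \<noteq> 0"
  proof
    assume 0: "det2 p r = 0"
    have par: "det2 p q = 0" if "q \<in> T" for q
    proof -
      have "0 \<le> det2 p q" "0 \<le> det2 q r"
        using ext that by auto
      moreover have "of_int (det2 p q) * pairing r \<delta> + of_int (det2 q r) * pairing p \<delta> = of_int (det2 p r) * pairing q \<delta>"
        by (simp add: det2_def pairing_def algebra_simps)
      ultimately show ?thesis
        using 0 pos[OF pr(1)] pos[OF pr(3)] by (simp add: add_nonneg_eq_0_iff)
    qed
    have neg: "pairing q (- perp p) = - of_int (det2 p q)" for q
      using pairing_scaleR[of q "-1" "perp p"] by (simp add: perp)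
    have "0 \<le> pairing v (perp p)" "pairing v (perp p) = 0 \<Longrightarrow> pairing d (perp p) \<le> 0"
      using dir[of "perp p"] par by (auto simp: perp T_def)
    moreover have "0 \<le> pairing v (- perp p)" "pairing v (- perp p) = 0 \<Longrightarrow> pairing d (- perp p) \<le> 0"
      using dir[of "- perp p"] par by (auto simp: neg T_def)
    ultimately have "det2 p v = 0" "det2 p d = 0"
      by (auto simp: perp neg)
    then have "pairing p \<delta> = 0"
      using pairing_decompose[OF vd, of p \<delta>] det2_commute[of v p] by simp
    with pos[OF pr(1)] show False
      by simp
  qed
  with ext(1)[OF pr(3)] have "0 < det2 p r"
    by simp
  moreover have "\<forall>q\<in>X. w \<in> tight X h q \<longrightarrow> 0 \<le> det2 p q \<and> 0 \<le> det2 q r"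
    using ext by (simp add: T_def)
  ultimately have "extreme_pair X h w (p, r)"
    using pr by (simp add: extreme_pair_def T_def)
  with that v show thesis
    by auto
qed

text \<open>If a ray \<open>q\<close> tight at \<open>w'\<close> lies inside the cone of
  \<open>p\<close>, it is a positive combination of both rays of \<open>p\<close>. Moving from
  \<open>w\<close> to \<open>w'\<close> cannot lower the constraints of these rays nor raise that of
  \<open>q\<close>, so both rays are tight at \<open>w'\<close>. This contradicts that
  \<open>q\<close> bounds the normal cone there.\<close>

lemma extreme_pairs_compatible:
  assumes p: "extreme_pair X h w p" and p': "extreme_pair X h w' p'"
  shows "compatible p p'"
proof -
  have *: "\<not> inside_cone p q"
    if p: "extreme_pair X h w p" and p': "extreme_pair X h w' p'" and q: "q = fst p' \<or> q = snd p'" for p p' w w' q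
  proof
    assume ins: "inside_cone p q"
    have tq: "q \<in> X" "w' \<in> tight X h q"
      using p' q by (auto simp: extreme_pair_def)
    have pp: "fst p \<in> X" "snd p \<in> X" "w \<in> tight X h (fst p)" "w \<in> tight X h (snd p)" "0 < det2 (fst p) (snd p)"
      using p by (auto simp: extreme_pair_def)
    have comb: "of_int (det2 (fst p) (snd p)) * pairing q z = of_int (det2 q (snd p)) * pairing (fst p) z
        + of_int (det2 (fst p) q) * pairing (snd p) z" for z
      by (simp add: det2_def pairing_def algebra_simps)
    have a: "0 < det2 q (snd p)" "0 < det2 (fst p) q"
      using ins by (auto simp: inside_cone_def)
    define z where "z = w' - w"
    have z: "0 \<le> pairing (fst p) z" "0 \<le> pairing (snd p) z" "pairing q z \<le> 0"
      using pp tq by (auto simp: z_def pairing_diff tight_def feasible_def dest: bspec)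
    have "of_int (det2 q (snd p)) * pairing (fst p) z + of_int (det2 (fst p) q) * pairing (snd p) z \<le> 0"
      unfolding comb[symmetric] using z(3) pp(5) by (simp add: mult_nonneg_nonpos)
    moreover have "0 \<le> of_int (det2 q (snd p)) * pairing (fst p) z" "0 \<le> of_int (det2 (fst p) q) * pairing (snd p) z"
      using a z by simp_all
    ultimately have "of_int (det2 q (snd p)) * pairing (fst p) z = 0" "of_int (det2 (fst p) q) * pairing (snd p) z = 0"
      by linarith+
    then have "pairing (fst p) z = 0" "pairing (snd p) z = 0"
      using a by simp_all
    then have "w' \<in> tight X h (fst p)" "w' \<in> tight X h (snd p)"
      using pp tq(2) by (auto simp: z_def pairing_diff tight_def)
    then have "0 \<le> det2 (fst p') (fst p)" "0 \<le> det2 (snd p) (snd p')"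
      using p' pp by (auto simp: extreme_pair_def)
    then show False
      using q a det2_commute[of "fst p" "fst p'"] det2_commute[of "snd p'" "snd p"] by auto
  qed
  show ?thesis
    unfolding compatible_def using *[OF p p'] *[OF p' p] by blast
qed

section \<open>From configurations of cones to monomials\<close>

lemma configurations_mem:
  assumes "list_all2 (\<lambda>x ps. x \<in> set ps) xs pss"
    and "\<And>i j. i < j \<Longrightarrow> j < length xs \<Longrightarrow> compatible (fst (xs ! i)) (fst (xs ! j))"
  shows "(map fst xs, foldr (\<lambda>x e. map2 (+) (snd x) e) xs z) \<in> set (configurations z pss)"
  using assms
proof (induction xs pss rule: list_all2_induct)
  case (Cons x xs ps pss)
  have "compatible (fst (xs ! i)) (fst (xs ! j))" if "i < j" "j < length xs" for i j
    using Cons.prems[of "Suc i" "Suc j"] that by simp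
  then have IH: "(map fst xs, foldr (\<lambda>x e. map2 (+) (snd x) e) xs z) \<in> set (configurations z pss)"
    by (rule Cons.IH)
  have "compatible (fst x) (fst y)" if y: "y \<in> set xs" for y
  proof -
    obtain i where "i < length xs" "y = xs ! i"
      using y unfolding in_set_conv_nth by blast
    with Cons.prems[of 0 "Suc i"] show ?thesis
      by simp
  qed
  then have "list_all (compatible (fst x)) (map fst xs)"
    by (simp add: list_all_iff)
  then have "(fst x # map fst xs, map2 (+) (snd x) (foldr (\<lambda>x e. map2 (+) (snd x) e) xs z)) \<in>
      (\<lambda>p. (fst p # map fst xs, map2 (+) (snd p) (foldr (\<lambda>x e. map2 (+) (snd x) e) xs z))) `
        set (filter (\<lambda>p. list_all (compatible (fst p)) (map fst xs)) ps)"
    using Cons.hyps(1) by (intro imageI) simp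
  with IH show ?case
    by (simp, intro bexI[of _ "(map fst xs, foldr (\<lambda>x e. map2 (+) (snd x) e) xs z)"]) simp_all
qed simp

lemma all_distinct_all: "all_distinct P acc xs \<Longrightarrow> (\<And>x. x \<in> set acc \<Longrightarrow> P x) \<Longrightarrow> x \<in> set xs \<Longrightarrow> P x"
  by (induction P acc xs rule: all_distinct.induct) (auto split: if_splits)

text \<open>The finite verification that yields integral exponents and the unit coefficient.\<close>

lemma all_leads_ok:
  assumes "e \<in> set (map snd (all_configurations \<sigma>))"
  shows "lead_ok \<sigma> e"
proof (rule all_distinct_all[OF _ _ assms])
  show "all_distinct (lead_ok \<sigma>) [] (map snd (all_configurations \<sigma>))"
    by (cases \<sigma>) (simp only:; code_simp)+
qed simp

text \<open>Cramer's rule \<open>det2 p r * v = det2 v r * p + det2 p v * r\<close>, combined with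
  the tightness of \<open>p\<close> and \<open>r\<close> at \<open>w\<close>.\<close>

lemma weighted_vector:
  assumes p: "p \<in> set (boundary \<sigma>)" "r \<in> set (boundary \<sigma>)" "0 < det2 p r" "det2 p r dvd 12"
    and w: "h p + pairing p w = 0" "h r + pairing r w = 0"
  shows "(\<Sum>x\<leftarrow>zip (boundary \<sigma>) (cone_vector \<sigma> (v, l) (p, r)). of_int (snd x) * h (fst x))
     = - 12 * of_int l * pairing v w"
proof -
  define k where "k = 12 div det2 p r"
  define g where "g q = of_int l * real_of_int k * ((if q = p then of_int (det2 v r) else 0) + (if q = r then of_int (det2 p v) else 0)) * h q" for q
  have zip_map: "(\<Sum>x\<leftarrow>zip xs (map f xs). of_int (snd x) * h (fst x)) = (\<Sum>q\<leftarrow>xs. of_int (f q) * h q)" for f :: "lpt \<Rightarrow> int" and xs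
    by (induction xs) simp_all
  have "(\<Sum>x\<leftarrow>zip (boundary \<sigma>) (cone_vector \<sigma> (v, l) (p, r)). of_int (snd x) * h (fst x)) = (\<Sum>q\<leftarrow>boundary \<sigma>. g q)"
  proof -
    define f where "f q = l * (12 div det2 p r) * ((if q = p then det2 v r else 0) + (if q = r then det2 p v else 0))" for q
    have "of_int (f q) * h q = g q" for q
      by (cases "q = p"; cases "q = r") (simp_all add: f_def g_def k_def)
    moreover have "cone_vector \<sigma> (v, l) (p, r) = map f (boundary \<sigma>)"
      by (simp add: cone_vector_def f_def)
    ultimately show ?thesis
      by (simp add: zip_map)
  qed
  also have "\<dots> = (\<Sum>q\<in>set (boundary \<sigma>). g q)"
    using boundary_facts(2) by (rule sum_list_distinct_conv_sum_set)
  also have "\<dots> = (\<Sum>q\<in>set (boundary \<sigma>). (if q = p then of_int l * real_of_int k * of_int (det2 v r) * h p else 0)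
      + (if q = r then of_int l * real_of_int k * of_int (det2 p v) * h r else 0))"
    by (rule sum.cong) (simp_all add: g_def algebra_simps)
  also have "\<dots> = of_int l * real_of_int k * (of_int (det2 v r) * h p + of_int (det2 p v) * h r)"
    using p(1,2) by (simp add: sum.distrib algebra_simps)
  also have "of_int (det2 v r) * h p + of_int (det2 p v) * h r
      = - (of_int (det2 v r) * pairing p w + of_int (det2 p v) * pairing r w)"
    using w by (simp add: eq_neg_iff_add_eq_0[symmetric])
  also have "of_int (det2 v r) * pairing p w + of_int (det2 p v) * pairing r w = of_int (det2 p r) * pairing v w"
    by (simp add: det2_def pairing_def algebra_simps)
  also have "of_int l * real_of_int k * - (of_int (det2 p r) * pairing v w)
      = - of_int l * real_of_int (k * det2 p r) * pairing v w"
    by (simp add: algebra_simps)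
  also have "k * det2 p r = 12"
    using p(4) by (simp add: k_def)
  finally show ?thesis
    by simp
qed

lemma sum_map2_vector:
  assumes "length e = length xs" "length e' = length xs"
  shows "(\<Sum>x\<leftarrow>zip xs (map2 (+) e e'). real_of_int (snd x) * h (fst x))
     = (\<Sum>x\<leftarrow>zip xs e. of_int (snd x) * h (fst x)) + (\<Sum>x\<leftarrow>zip xs e'. of_int (snd x) * h (fst x))"
  using assms
proof (induction xs arbitrary: e e')
  case (Cons a xs)
  then obtain b f c g where "e = b # f" "e' = c # g"
    by (metis length_Suc_conv length_Cons)
  with Cons show ?case
    by (simp add: algebra_simps)
qed simp

lemma sum_lead_monomial:
  fixes xs :: "lpt list"
  assumes "list_all (\<lambda>k. 0 \<le> k \<and> 12 dvd k) e"
  shows "12 * (\<Sum>q\<leftarrow>concat (map (\<lambda>x. replicate (nat (snd x div 12)) (fst (fst x) + 1, snd (fst x) + 1)) (zip xs e)).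
      h (fst q - 1, snd q - 1)) = (\<Sum>x\<leftarrow>zip xs e. real_of_int (snd x) * h (fst x))"
  using assms
proof (induction xs arbitrary: e)
  case (Cons a xs)
  show ?case
  proof (cases e)
    case (Cons b f)
    have "0 \<le> b" "12 dvd b" "list_all (\<lambda>k. 0 \<le> k \<and> 12 dvd k) f"
      using Cons.prems by (simp_all add: Cons)
    then have b: "12 * real (nat (b div 12)) = of_int b"
      by (auto elim!: dvdE)
    have "12 * (real (nat (b div 12)) * h a) = of_int b * h a"
      unfolding b[symmetric] by simp
    moreover have "h (fst a + 1 - 1, snd a + 1 - 1) = h a"
      by simp
    ultimately show ?thesis
      using Cons.IH[OF \<open>list_all _ f\<close>]
      by (simp only: Cons zip_Cons_Cons list.map concat.simps map_append sum_list_append map_replicate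
          sum_list_replicate distrib_left fst_conv snd_conv sum_list.Cons)
  qed simp
qed simp

lemma length_corner_mults [simp]: "length (corner_mults \<sigma>) = length (frame \<sigma>)"
  by (simp add: corner_mults_def)

lemma sum_foldr_vectors:
  assumes "\<And>x. x \<in> set xs \<Longrightarrow> length (snd x) = length bs"
  shows "(\<Sum>x\<leftarrow>zip bs (foldr (\<lambda>x e. map2 (+) (snd x) e) xs (map (\<lambda>q. 0) bs)). real_of_int (snd x) * h (fst x))
      = (\<Sum>y\<leftarrow>xs. \<Sum>x\<leftarrow>zip bs (snd y). of_int (snd x) * h (fst x))" (is ?A)
    and "length (foldr (\<lambda>x e. map2 (+) (snd x) e) xs (map (\<lambda>q. 0) bs)) = length bs" (is ?B)
proof -
  have "?A \<and> ?B"
    using assms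
  proof (induction xs)
    case Nil
    have "(\<Sum>x\<leftarrow>zip bs (map (\<lambda>q. 0) bs). real_of_int (snd x) * h (fst x)) = 0"
      by (induction bs) simp_all
    then show ?case
      by simp
  next
    case (Cons x xs)
    then show ?case
      by (simp add: sum_map2_vector)
  qed
  then show ?A ?B
    by blast+
qed

lemma positive_entry:
  assumes "q \<in> set (concat (map (\<lambda>x. replicate (nat (snd x div 12)) (fst (fst x) + 1, snd (fst x) + 1)) (zip xs e)))"
    "length e = length xs"
  obtains i where "i < length xs" "q = (fst (xs ! i) + 1, snd (xs ! i) + 1)" "0 < e ! i"
proof -
  from assms(1) obtain x where x: "x \<in> set (zip xs e)" "nat (snd x div 12) \<noteq> 0"
      "q = (fst (fst x) + 1, snd (fst x) + 1)"
    by (auto split: if_splits)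
  then obtain i where "i < length xs" "x = (xs ! i, e ! i)"
    using assms(2) by (auto simp: set_zip)
  moreover have "0 < k" if "nat (k div 12) \<noteq> 0" for k :: int
    using that div_nonpos_pos_le0[of k 12] by (cases "k \<le> 0") auto
  ultimately show thesis
    using x that[of i] by simp
qed

text \<open>
  At each corner the minimizer lies on two edges whose normals span a cone around the corner.
  Together these cones determine the leading monomial of the discriminant.
\<close>

theorem leading_monomial_exists:
  assumes X: "X \<subseteq> set (boundary \<sigma>)" and len_ws: "length ws = length (frame \<sigma>)"
    and lex: "\<And>i. i < length (frame \<sigma>) \<Longrightarrow>
       lexmin (feasible X h) (fst (frame \<sigma> ! i)) (fst (snd (frame \<sigma> ! i))) (ws ! i)"
    and w0: "\<And>q. q \<in> X \<Longrightarrow> 0 < h q + pairing q w0"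
  obtains n ps where "(\<lambda>q. (fst q - 1, snd q - 1)) ` set n \<subseteq> X" "length n \<le> 12" "\<bar>disc_coeff \<sigma> n\<bar> = 1"
    "length ps = length (frame \<sigma>)"
    "\<And>i. i < length (frame \<sigma>) \<Longrightarrow> extreme_pair X h (ws ! i) (ps ! i)"
    "\<And>h' ws'. length ws' = length (frame \<sigma>) \<Longrightarrow>
      (\<And>i q. i < length (frame \<sigma>) \<Longrightarrow> q = fst (ps ! i) \<or> q = snd (ps ! i) \<Longrightarrow> h' q + pairing q (ws' ! i) = 0) \<Longrightarrow>
      (\<Sum>q\<leftarrow>n. h' (fst q - 1, snd q - 1)) = excess \<sigma> ws'"
proof -
  let ?K = "length (frame \<sigma>)" and ?bs = "boundary \<sigma>"
  have fin: "finite X"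
    using X finite_subset by blast
  have "\<exists>p. extreme_pair X h (ws ! i) p \<and> 0 \<le> det2 (fst p) (fst (frame \<sigma> ! i)) \<and> 0 \<le> det2 (fst (frame \<sigma> ! i)) (snd p)"
    if "i < ?K" for i
  proof -
    have "det2 (fst (frame \<sigma> ! i)) (fst (snd (frame \<sigma> ! i))) = 1"
      using bspec[OF frame_facts nth_mem[OF that]] by (simp add: case_prod_beta)
    from extreme_pair_exists[OF fin lex[OF that] this w0] show ?thesis
      by blast
  qed
  then obtain P where P: "\<And>i. i < ?K \<Longrightarrow> extreme_pair X h (ws ! i) (P i)"
      "\<And>i. i < ?K \<Longrightarrow> 0 \<le> det2 (fst (P i)) (fst (frame \<sigma> ! i))"
      "\<And>i. i < ?K \<Longrightarrow> 0 \<le> det2 (fst (frame \<sigma> ! i)) (snd (P i))"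
    by metis
  define cm where "cm = corner_mults \<sigma>"
  have cm: "fst (cm ! i) = fst (frame \<sigma> ! i)" if "i < ?K" for i
    using that by (simp add: cm_def corner_mults_def case_prod_beta)
  define xs where "xs = map (\<lambda>i. (P i, cone_vector \<sigma> (cm ! i) (P i))) [0..<?K]"
  define e where "e = foldr (\<lambda>x e. map2 (+) (snd x) e) xs (map (\<lambda>q. 0) ?bs)"
  have PX: "fst (P i) \<in> X" "snd (P i) \<in> X" "0 < det2 (fst (P i)) (snd (P i))" if "i < ?K" for i
    using P(1)[OF that] by (auto simp: extreme_pair_def)
  have cone: "P i \<in> set (cones_around \<sigma> (fst (cm ! i)))" if "i < ?K" for i
    using PX[OF that] P(2,3)[OF that] X cm[OF that] by (auto simp: cones_around_def case_prod_beta mem_Times_iff)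
  have "(map fst xs, e) \<in> set (all_configurations \<sigma>)"
    unfolding all_configurations_def e_def
  proof (rule configurations_mem)
    show "list_all2 (\<lambda>x ps. x \<in> set ps) xs
      (map (\<lambda>x. map (\<lambda>p. (p, cone_vector \<sigma> x p)) (cones_around \<sigma> (fst x))) (corner_mults \<sigma>))"
      using cone by (auto simp: list_all2_conv_all_nth xs_def cm_def)
    show "compatible (fst (xs ! i)) (fst (xs ! j))" if "i < j" "j < length xs" for i j
      using that extreme_pairs_compatible[OF P(1) P(1), of i j] by (simp add: xs_def)
  qed
  then have ok: "lead_ok \<sigma> e"
    using all_leads_ok[of e \<sigma>] by force
  define n where "n = lead_monomial \<sigma> e"
  have len_vec: "length (cone_vector \<sigma> x p) = length ?bs" for x p
    by (simp add: cone_vector_def case_prod_beta)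
  then have len_xs: "length (snd x) = length ?bs" if "x \<in> set xs" for x
    using that unfolding xs_def set_map by (elim imageE) (simp only: snd_conv len_vec)
  show thesis
  proof
    show "length n \<le> 12" "\<bar>disc_coeff \<sigma> n\<bar> = 1"
      using ok by (auto simp: lead_ok_def n_def)
    show "length (map P [0..<?K]) = ?K"
      by simp
    show "extreme_pair X h (ws ! i) (map P [0..<?K] ! i)" if "i < ?K" for i
      using P(1)[OF that] that by simp
    \<comment> \<open>The monomial depends only on the cones, so its weight is known for all heights
      and points for which the same constraints are tight.\<close>
    show "(\<Sum>q\<leftarrow>n. h' (fst q - 1, snd q - 1)) = excess \<sigma> ws'"
      if len: "length ws' = ?K"
        and t: "\<And>i q. i < ?K \<Longrightarrow> q = fst (map P [0..<?K] ! i) \<or> q = snd (map P [0..<?K] ! i) \<Longrightarrow> h' q + pairing q (ws' ! i) = 0"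
      for h' ws'
    proof -
      have "12 * (\<Sum>q\<leftarrow>n. h' (fst q - 1, snd q - 1)) = (\<Sum>x\<leftarrow>zip ?bs e. real_of_int (snd x) * h' (fst x))"
        unfolding n_def lead_monomial_def using ok by (intro sum_lead_monomial) (simp add: lead_ok_def)
      also have "\<dots> = (\<Sum>y\<leftarrow>xs. \<Sum>x\<leftarrow>zip ?bs (snd y). of_int (snd x) * h' (fst x))"
        unfolding e_def by (rule sum_foldr_vectors(1)) (rule len_xs)
      also have "\<dots> = (\<Sum>i\<leftarrow>[0..<?K]. \<Sum>x\<leftarrow>zip ?bs (cone_vector \<sigma> (cm ! i) (P i)). of_int (snd x) * h' (fst x))"
        by (simp add: xs_def comp_def)
      also have "\<dots> = (\<Sum>i\<leftarrow>[0..<?K]. - 12 * of_int (snd (cm ! i)) * pairing (fst (cm ! i)) (ws' ! i))"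
      proof (intro arg_cong[of _ _ sum_list] map_cong refl)
        fix i assume "i \<in> set [0..<?K]"
        then have i: "i < ?K"
          by simp
        have "det2 (fst (P i)) (snd (P i)) dvd 12"
          using boundary_facts(3)[of \<sigma>] cone[OF i] i by (fastforce simp: cm_def)
        then show "(\<Sum>x\<leftarrow>zip ?bs (cone_vector \<sigma> (cm ! i) (P i)). of_int (snd x) * h' (fst x))
            = - 12 * of_int (snd (cm ! i)) * pairing (fst (cm ! i)) (ws' ! i)"
          using weighted_vector[of "fst (P i)" \<sigma> "snd (P i)" h' "ws' ! i" "fst (cm ! i)" "snd (cm ! i)"]
            PX[OF i] X t[OF i] i by auto
      qed
      also have "\<dots> = 12 * excess \<sigma> ws'"
      proof -
        have "(\<Sum>x\<leftarrow>zip cm ws'. g (fst x) (snd x)) = (\<Sum>i\<leftarrow>[0..<?K]. g (cm ! i) (ws' ! i))" for g :: "lpt \<times> int \<Rightarrow> real \<times> real \<Rightarrow> real"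
        proof -
          have "map (\<lambda>x. g (fst x) (snd x)) (zip cm ws') = map (\<lambda>i. g (cm ! i) (ws' ! i)) [0..<?K]"
            using len by (intro nth_equalityI) (simp_all add: cm_def)
          then show ?thesis
            by simp
        qed
        from this[of "\<lambda>x w. of_int (snd x) * pairing (fst x) w"] show ?thesis
          by (simp add: excess_def cm_def[symmetric] sum_list_const_mult[symmetric] uminus_sum_list_map comp_def mult.assoc)
      qed
      finally show ?thesis
        by simp
    qed
    show "(\<lambda>q. (fst q - 1, snd q - 1)) ` set n \<subseteq> X"
    proof
      fix q' assume "q' \<in> (\<lambda>q. (fst q - 1, snd q - 1)) ` set n"
      then obtain q where q: "q \<in> set n" "q' = (fst q - 1, snd q - 1)"
        by blast
      have len_e: "length e = length ?bs"
        unfolding e_def by (rule sum_foldr_vectors(2)) (rule len_xs)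
      obtain i where i: "i < length ?bs" "q = (fst (?bs ! i) + 1, snd (?bs ! i) + 1)" "0 < e ! i"
        using positive_entry[OF q(1)[unfolded n_def lead_monomial_def] len_e] by blast
      then have q': "q' = ?bs ! i"
        using q(2) by simp
      \<comment> \<open>Each cone vector is supported on the two rays of its cone, and these belong
        to \<open>X\<close>.\<close>
      have "e ! i = 0" if "?bs ! i \<notin> X"
      proof -
        have zero: "x ! i = 0" if "x \<in> snd ` set xs" for x
        proof -
          obtain k where k: "k < ?K" "x = cone_vector \<sigma> (cm ! k) (P k)"
            using \<open>x \<in> _\<close> by (auto simp: xs_def)
          then show ?thesis
            using PX[OF k(1)] \<open>?bs ! i \<notin> X\<close> i(1) by (auto simp: cone_vector_def case_prod_beta)
        qed
        have "foldr (\<lambda>x e. map2 (+) (snd x) e) ys (map (\<lambda>q. 0) ?bs) ! i = 0" if "set ys \<subseteq> set xs" for ys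
          using that
        proof (induction ys)
          case (Cons y ys)
          have "length (foldr (\<lambda>x e. map2 (+) (snd x) e) ys (map (\<lambda>q. 0) ?bs)) = length ?bs"
            using Cons.prems len_xs by (intro sum_foldr_vectors(2)) auto
          with Cons zero[of "snd y"] len_xs[of y] i(1) show ?case
            by simp
        qed (use i(1) in simp)
        then show ?thesis
          unfolding e_def by blast
      qed
      with i(3) q' show "q' \<in> X"
        by fastforce
    qed
  qed
qed

section \<open>Existence of a normal form\<close>

lemma shape_points_iff:
  "(i, j) \<in> shape_points Triangle_42 \<longleftrightarrow> 0 \<le> i \<and> 0 \<le> j \<and> i + 2 * j \<le> 4"
  "(i, j) \<in> shape_points Square \<longleftrightarrow> 0 \<le> i \<and> i \<le> 2 \<and> 0 \<le> j \<and> j \<le> 2"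
  "(i, j) \<in> shape_points Triangle_33 \<longleftrightarrow> 0 \<le> i \<and> 0 \<le> j \<and> i + j \<le> 3"
proof -
  have half: "a * real_of_int i + b * real_of_int j \<le> c"
    if "pt (i, j) \<in> convex hull (pt ` V)" "\<forall>v\<in>V. a * of_int (fst v) + b * of_int (snd v) \<le> c" for V a b c
  proof -
    have "convex hull (pt ` V) \<subseteq> {z. (a, b) \<bullet> z \<le> c}"
      using that(2) by (intro hull_minimal convex_halfspace_le) (auto simp: pt_def)
    with that(1) show ?thesis
      by (auto simp: pt_def)
  qed
  show "(i, j) \<in> shape_points Triangle_42 \<longleftrightarrow> 0 \<le> i \<and> 0 \<le> j \<and> i + 2 * j \<le> 4"
  proof
    assume "(i, j) \<in> shape_points Triangle_42"
    then have "pt (i, j) \<in> convex hull (pt ` {(0,0), (4,0), (0,2)})"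
      by simp
    from half[OF this, of "-1" 0 0] half[OF this, of 0 "-1" 0] half[OF this, of 1 2 4]
    have "0 \<le> i" "0 \<le> j" "real_of_int i + 2 * of_int j \<le> 4"
      by simp_all
    moreover from this(3) have "i + 2 * j \<le> 4"
      by linarith
    ultimately show "0 \<le> i \<and> 0 \<le> j \<and> i + 2 * j \<le> 4"
      by simp
  next
    assume ij: "0 \<le> i \<and> 0 \<le> j \<and> i + 2 * j \<le> 4"
    then have "0 \<le> 1 - of_int i / 4 - real_of_int j / 2"
      by linarith
    moreover have "pt (i, j) = (1 - of_int i / 4 - of_int j / 2) *\<^sub>R pt (0,0) + (of_int i / 4) *\<^sub>R pt (4,0) + (of_int j / 2) *\<^sub>R pt (0,2)"
      by (simp add: pt_def)
    ultimately have "pt (i, j) \<in> convex hull {pt (0,0), pt (4,0), pt (0,2)}"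
      unfolding convex_hull_3 mem_Collect_eq using ij
      by (intro exI[of _ "1 - of_int i / 4 - of_int j / 2"] exI[of _ "of_int i / 4"] exI[of _ "of_int j / 2"] conjI)
        simp_all
    then show "(i, j) \<in> shape_points Triangle_42"
      by simp
  qed
  show "(i, j) \<in> shape_points Triangle_33 \<longleftrightarrow> 0 \<le> i \<and> 0 \<le> j \<and> i + j \<le> 3"
  proof
    assume "(i, j) \<in> shape_points Triangle_33"
    then have "pt (i, j) \<in> convex hull (pt ` {(0,0), (3,0), (0,3)})"
      by simp
    from half[OF this, of "-1" 0 0] half[OF this, of 0 "-1" 0] half[OF this, of 1 1 3]
    have "0 \<le> i" "0 \<le> j" "real_of_int i + of_int j \<le> 3"
      by simp_all
    moreover from this(3) have "i + j \<le> 3"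
      by linarith
    ultimately show "0 \<le> i \<and> 0 \<le> j \<and> i + j \<le> 3"
      by simp
  next
    assume ij: "0 \<le> i \<and> 0 \<le> j \<and> i + j \<le> 3"
    then have "0 \<le> 1 - of_int i / 3 - real_of_int j / 3"
      by linarith
    moreover have "pt (i, j) = (1 - of_int i / 3 - of_int j / 3) *\<^sub>R pt (0,0) + (of_int i / 3) *\<^sub>R pt (3,0) + (of_int j / 3) *\<^sub>R pt (0,3)"
      by (simp add: pt_def)
    ultimately have "pt (i, j) \<in> convex hull {pt (0,0), pt (3,0), pt (0,3)}"
      unfolding convex_hull_3 mem_Collect_eq using ij
      by (intro exI[of _ "1 - of_int i / 3 - of_int j / 3"] exI[of _ "of_int i / 3"] exI[of _ "of_int j / 3"] conjI)
        simp_all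
    then show "(i, j) \<in> shape_points Triangle_33"
      by simp
  qed
  show "(i, j) \<in> shape_points Square \<longleftrightarrow> 0 \<le> i \<and> i \<le> 2 \<and> 0 \<le> j \<and> j \<le> 2"
  proof
    assume "(i, j) \<in> shape_points Square"
    then have "pt (i, j) \<in> convex hull (pt ` {(0,0), (2,0), (2,2), (0,2)})"
      by simp
    from half[OF this, of "-1" 0 0] half[OF this, of 0 "-1" 0] half[OF this, of 1 0 2] half[OF this, of 0 1 2]
    show "0 \<le> i \<and> i \<le> 2 \<and> 0 \<le> j \<and> j \<le> 2"
      by simp
  next
    let ?H = "convex hull (pt ` {(0,0), (2,0), (2,2), (0,2)})"
    assume ij: "0 \<le> i \<and> i \<le> 2 \<and> 0 \<le> j \<and> j \<le> 2"
    have comb: "(1 - t) *\<^sub>R x + t *\<^sub>R y \<in> ?H" if "x \<in> ?H" "y \<in> ?H" "0 \<le> t" "t \<le> 1" for x y t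
      using that convex_convex_hull[of "pt ` {(0,0), (2,0), (2,2), (0,2)}"] by (auto simp: convex_alt)
    have V: "pt (0,0) \<in> ?H" "pt (2,0) \<in> ?H" "pt (2,2) \<in> ?H" "pt (0,2) \<in> ?H"
      by (auto intro: hull_inc)
    \<comment> \<open>Bilinear interpolation between the four corners.\<close>
    have "(1 - of_int j / 2) *\<^sub>R ((1 - of_int i / 2) *\<^sub>R pt (0,0) + (of_int i / 2) *\<^sub>R pt (2,0))
        + (of_int j / 2) *\<^sub>R ((1 - of_int i / 2) *\<^sub>R pt (0,2) + (of_int i / 2) *\<^sub>R pt (2,2)) \<in> ?H"
      using ij by (intro comb V) auto
    moreover have "(1 - of_int j / 2) *\<^sub>R ((1 - of_int i / 2) *\<^sub>R pt (0,0) + (of_int i / 2) *\<^sub>R pt (2,0))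
        + (of_int j / 2) *\<^sub>R ((1 - of_int i / 2) *\<^sub>R pt (0,2) + (of_int i / 2) *\<^sub>R pt (2,2)) = pt (i, j)"
      by (simp add: pt_def algebra_simps)
    ultimately show "(i, j) \<in> shape_points Square"
      by simp
  qed
qed

section \<open>Unimodular maps and the axioms for sets of lattice points\<close>

definition lin :: "int \<times> int \<times> int \<times> int \<Rightarrow> lpt \<Rightarrow> lpt" where
  "lin = (\<lambda>(a, b, c, d) p. (a * fst p + b * snd p, c * fst p + d * snd p))"

definition unimod :: "int \<times> int \<times> int \<times> int \<Rightarrow> bool" where
  "unimod = (\<lambda>(a, b, c, d). \<bar>a * d - b * c\<bar> = 1)"

text \<open>The shift by one takes the origin to \<open>(1,1)\<close>, the interior lattice point of
  each shape.\<close>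

definition fits :: "lpt set \<Rightarrow> bool" where
  "fits B \<longleftrightarrow> (\<exists>M \<sigma>. unimod M \<and> (\<forall>p\<in>B. (fst (lin M p) + 1, snd (lin M p) + 1) \<in> shape_points \<sigma>))"

text \<open>
  The discrete properties of the set of lattice points of a lattice polygon whose only interior
  lattice point is the origin. The last one says that a lattice point that is the midpoint of two
  others supports the line through them.
\<close>

locale reflexive_points =
  fixes B :: "lpt set"
  assumes interior: "p \<in> B \<Longrightarrow> q \<in> B \<Longrightarrow> 0 \<le> a \<Longrightarrow> 0 \<le> b \<Longrightarrow> a + b < m \<Longrightarrow>
      m * fst z = a * fst p + b * fst q \<Longrightarrow> m * snd z = a * snd p + b * snd q \<Longrightarrow> z = (0,0)"
    and convex: "p \<in> B \<Longrightarrow> q \<in> B \<Longrightarrow> 0 \<le> a \<Longrightarrow> 0 \<le> b \<Longrightarrow> a + b \<le> m \<Longrightarrow> 0 < m \<Longrightarrow>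
      m * fst z = a * fst p + b * fst q \<Longrightarrow> m * snd z = a * snd p + b * snd q \<Longrightarrow> z \<in> B"
    and support: "p \<in> B \<Longrightarrow> q \<in> B \<Longrightarrow> t \<in> B \<Longrightarrow> 2 * fst z = fst p + fst q \<Longrightarrow> 2 * snd z = snd p + snd q \<Longrightarrow>
      det2 p q \<noteq> 0 \<Longrightarrow> 0 \<le> det2 p q * det2 (fst q - fst p, snd q - snd p) (fst t - fst p, snd t - snd p)"
    and spanning: "\<exists>A0\<subseteq>B. finite A0 \<and> (\<forall>p. p \<noteq> (0,0) \<longrightarrow> (\<exists>t\<in>A0. 0 < det2 p t))"

lemma det2_lin: "det2 (lin (a, b, c, d) p) (lin (a, b, c, d) q) = (a * d - b * c) * det2 p q"
  by (simp add: lin_def det2_def algebra_simps)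

lemma lin_inverse:
  assumes "unimod (a, b, c, d)" and "D = a * d - b * c"
  shows "lin (a, b, c, d) (lin (D * d, - D * b, - D * c, D * a) p) = p"
    and "lin (D * d, - D * b, - D * c, D * a) (lin (a, b, c, d) p) = p"
    and "unimod (D * d, - D * b, - D * c, D * a)"
proof -
  have "\<bar>D\<bar> = 1"
    using assms by (simp add: unimod_def)
  then have D: "D * D = 1"
    by (metis abs_mult_self_eq mult_1)
  have *: "a * (D * d * x - D * b * y) + b * (D * a * y - D * c * x) = D * D * x"
    "c * (D * d * x - D * b * y) + d * (D * a * y - D * c * x) = D * D * y"
    "D * d * (a * x + b * y) - D * b * (c * x + d * y) = D * D * x"
    "D * a * (c * x + d * y) - D * c * (a * x + b * y) = D * D * y" for x y
    by (simp_all add: assms(2) algebra_simps)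
  show "lin (a, b, c, d) (lin (D * d, - D * b, - D * c, D * a) p) = p"
    "lin (D * d, - D * b, - D * c, D * a) (lin (a, b, c, d) p) = p"
    using *[of "fst p" "snd p"] D by (simp_all add: lin_def prod_eq_iff)
  have "(D * d) * (D * a) - (- D * b) * (- D * c) = D * D * D"
    by (simp add: assms(2) algebra_simps)
  with D assms show "unimod (D * d, - D * b, - D * c, D * a)"
    by (simp add: unimod_def)
qed

text \<open>Allows free changes of basis. Determinants change by the sign \<open>D\<close>, which
  enters the support condition twice.\<close>

lemma reflexive_points_lin:
  assumes "reflexive_points B" "unimod M"
  shows "reflexive_points (lin M ` B)"
proof -
  interpret reflexive_points B
    by fact
  obtain a b c d where M: "M = (a, b, c, d)"
    by (metis prod_cases4)
  define D where "D = a * d - b * c"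
  define N where "N = (D * d, - D * b, - D * c, D * a)"
  note inv = lin_inverse[OF assms(2)[unfolded M] D_def, folded N_def M]
  have "\<bar>D\<bar> = 1"
    using assms by (simp add: M D_def unimod_def)
  then have D: "D * D = 1"
    by (metis abs_mult_self_eq mult_1)
  have det: "det2 (lin M p) (lin M q) = D * det2 p q" for p q
    unfolding M D_def by (rule det2_lin)
  have comb: "m * fst (lin N z) = x * fst p + y * fst q \<and> m * snd (lin N z) = x * snd p + y * snd q"
    if "m * fst z = x * fst (lin M p) + y * fst (lin M q)" "m * snd z = x * snd (lin M p) + y * snd (lin M q)"
    for m x y p q z
  proof -
    have "m * fst (lin N z) = D * d * (m * fst z) - D * b * (m * snd z)"
      "m * snd (lin N z) = D * a * (m * snd z) - D * c * (m * fst z)"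
      by (simp_all add: N_def lin_def algebra_simps)
    then have "m * fst (lin N z) = x * fst (lin N (lin M p)) + y * fst (lin N (lin M q))"
      "m * snd (lin N z) = x * snd (lin N (lin M p)) + y * snd (lin N (lin M q))"
      unfolding that by (simp_all add: N_def lin_def algebra_simps)
    then show ?thesis
      by (simp add: inv)
  qed
  show ?thesis
  proof
    fix p q z and x y m :: int
    assume "p \<in> lin M ` B" "q \<in> lin M ` B"
    then obtain p' q' where pq: "p = lin M p'" "q = lin M q'" "p' \<in> B" "q' \<in> B"
      by blast
    assume xy: "0 \<le> x" "0 \<le> y" and eq: "m * fst z = x * fst p + y * fst q" "m * snd z = x * snd p + y * snd q"
    note c = comb[OF eq[unfolded pq]]
    have z: "lin M (lin N z) = z"
      by (rule inv)
    show "z = (0,0)" if "x + y < m"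
    proof -
      have "lin N z = (0,0)"
        using interior[OF pq(3,4) xy that] c by blast
      then have "z = lin M (0,0)"
        using z by simp
      then show ?thesis
        by (simp add: lin_def M)
    qed
    show "z \<in> lin M ` B" if "x + y \<le> m" "0 < m"
    proof -
      have "lin N z \<in> B"
        using convex[OF pq(3,4) xy that] c by blast
      then show ?thesis
        using z by (metis imageI)
    qed
  next
    fix p q t z
    assume "p \<in> lin M ` B" "q \<in> lin M ` B" "t \<in> lin M ` B"
    then obtain p' q' t' where pq: "p = lin M p'" "q = lin M q'" "t = lin M t'" "p' \<in> B" "q' \<in> B" "t' \<in> B"
      by blast
    assume eq: "2 * fst z = fst p + fst q" "2 * snd z = snd p + snd q" and "det2 p q \<noteq> 0"
    then have ne: "det2 p' q' \<noteq> 0"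
      by (auto simp: pq det)
    have diff: "(fst (lin M x) - fst (lin M y), snd (lin M x) - snd (lin M y)) = lin M (fst x - fst y, snd x - snd y)" for x y
      by (simp add: lin_def M algebra_simps)
    have "0 \<le> det2 p' q' * det2 (fst q' - fst p', snd q' - snd p') (fst t' - fst p', snd t' - snd p')"
      using support[OF pq(4-6) _ _ ne, of "lin N z"] comb[of 2 z 1 p' 1 q'] eq by (simp add: pq)
    also have "\<dots> = (D * D) * (det2 p' q' * det2 (fst q' - fst p', snd q' - snd p') (fst t' - fst p', snd t' - snd p'))"
      by (simp add: D)
    also have "\<dots> = det2 p q * det2 (fst q - fst p, snd q - snd p) (fst t - fst p, snd t - snd p)"
      unfolding pq diff det by (simp add: algebra_simps)
    finally show "0 \<le> det2 p q * det2 (fst q - fst p, snd q - snd p) (fst t - fst p, snd t - snd p)" .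
  next
    obtain A0 where A0: "A0 \<subseteq> B" "finite A0" "\<And>p. p \<noteq> (0,0) \<Longrightarrow> \<exists>t\<in>A0. 0 < det2 p t"
      using spanning by blast
    have "\<exists>t\<in>lin M ` A0. 0 < det2 p t" if "p \<noteq> (0,0)" for p
    proof -
      define p' where "p' = lin N (D * fst p, D * snd p)"
      have Mp': "lin M p' = (D * fst p, D * snd p)"
        unfolding p'_def by (rule inv)
      have "p' \<noteq> (0,0)"
      proof
        assume "p' = (0,0)"
        then have "lin M p' = (0,0)"
          by (simp add: lin_def M)
        with Mp' that D show False
          by (auto simp: prod_eq_iff)
      qed
      then obtain t where t: "t \<in> A0" "0 < det2 p' t"
        using A0(3) by blast
      moreover have "det2 (D * fst p, D * snd p) (lin M t) = D * det2 p (lin M t)"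
        by (simp add: det2_def algebra_simps)
      ultimately have "D * det2 p (lin M t) = D * det2 p' t"
        using det[of p' t] Mp' by simp
      then have "det2 p (lin M t) = det2 p' t"
        using D by auto
      then show ?thesis
        using t by (intro bexI[of _ "lin M t"]) auto
    qed
    with A0(1,2) show "\<exists>A0\<subseteq>lin M ` B. finite A0 \<and> (\<forall>p. p \<noteq> (0,0) \<longrightarrow> (\<exists>t\<in>A0. 0 < det2 p t))"
      by (intro exI[of _ "lin M ` A0"]) auto
  qed
qed

lemma lin_comp: "lin (a, b, c, d) (lin (a', b', c', d') p)
    = lin (a * a' + b * c', a * b' + b * d', c * a' + d * c', c * b' + d * d') p"
  by (simp add: lin_def algebra_simps)

lemma fits_lin:
  assumes "fits (lin M ` B)" "unimod M"
  shows "fits B"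
proof -
  obtain N \<sigma> where N: "unimod N" "\<And>p. p \<in> B \<Longrightarrow> (fst (lin N (lin M p)) + 1, snd (lin N (lin M p)) + 1) \<in> shape_points \<sigma>"
    using assms(1) unfolding fits_def by fast
  obtain a b c d a' b' c' d' where M: "N = (a, b, c, d)" "M = (a', b', c', d')"
    by (metis prod_cases4)
  let ?K = "(a * a' + b * c', a * b' + b * d', c * a' + d * c', c * b' + d * d')"
  have "(a * a' + b * c') * (c * b' + d * d') - (a * b' + b * d') * (c * a' + d * c')
      = (a * d - b * c) * (a' * d' - b' * c')"
    by (simp add: algebra_simps)
  then have "unimod ?K"
    using N(1) assms(2) by (simp add: unimod_def M abs_mult)
  with N(2) show ?thesis
    unfolding fits_def M lin_comp by blast
qed

section \<open>Sets with few rows and sets with an antipodal pair\<close>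

context reflexive_points
begin

text \<open>A proper divisor \<open>z\<close> of \<open>p\<close>, up to sign, lies strictly between
  the origin and \<open>p\<close> and would be interior.\<close>

lemma primitive:
  assumes "p \<in> B" "m * fst z = fst p" "m * snd z = snd p" "1 < \<bar>m\<bar>"
  shows "p = (0,0)"
proof (cases "0 < m")
  case True
  then have "z = (0,0)"
    using interior[of p p 1 0 m z] assms by simp
  with assms show ?thesis
    by (simp add: prod_eq_iff)
next
  case False
  then have "(- fst z, - snd z) = (0,0)"
    using interior[of p p 1 0 "- m" "(- fst z, - snd z)"] assms by simp
  with assms show ?thesis
    by (simp add: prod_eq_iff)
qed

lemma bezout:
  assumes "p \<in> B" "p \<noteq> (0,0)"
  obtains s where "det2 p s = 1"
proof -
  define g where "g = gcd (fst p) (snd p)"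
  obtain x y where xy: "fst p = g * x" "snd p = g * y"
    unfolding g_def by (meson dvd_def gcd_dvd1 gcd_dvd2)
  have "g = 1"
  proof (rule ccontr)
    assume "g \<noteq> 1"
    moreover have "g \<noteq> 0"
      using assms(2) by (auto simp: g_def prod_eq_iff)
    moreover have "0 \<le> g"
      by (simp add: g_def)
    ultimately have "1 < \<bar>g\<bar>"
      by simp
    with primitive[OF assms(1), of g "(x, y)"] xy assms(2) show False
      by simp
  qed
  moreover obtain a b where "a * fst p + b * snd p = g"
    using bezout_int[of "fst p" "snd p"] by (auto simp: g_def)
  ultimately show thesis
    by (intro that[of "(- b, a)"]) (simp add: det2_def algebra_simps)
qed

text \<open>Rows \<open>-1, 0, 1\<close>: after a shear the bottom row starts at \<open>-1\<close>.\<close>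

lemma fits_width_2:
  assumes rows: "\<And>p. p \<in> B \<Longrightarrow> \<bar>snd p\<bar> \<le> 1"
  shows "fits B"
proof -
  have row0: "\<bar>x\<bar> \<le> 1" if "(x, 0) \<in> B" for x
  proof (rule ccontr)
    assume "\<not> \<bar>x\<bar> \<le> 1"
    with primitive[OF that, of x "(1, 0)"] show False
      by simp
  qed
  \<comment> \<open>Otherwise \<open>(1,0)\<close> or \<open>(-1,0)\<close> is a combination of the
    two points with both coefficients equal to \<open>1 / \<bar>x + y\<bar>\<close>, whose sum is
    less than 1.\<close>
  have sum: "\<bar>x + y\<bar> \<le> 2" if "(x, 1) \<in> B" "(y, -1) \<in> B" for x y
    using interior[OF that, of 1 1 "x + y" "(1, 0)"] interior[OF that, of 1 1 "- (x + y)" "(-1, 0)"]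
    by (fastforce simp: abs_le_iff not_less)
  obtain A0 where "A0 \<subseteq> B" "\<And>p. p \<noteq> (0,0) \<Longrightarrow> \<exists>t\<in>A0. 0 < det2 p t"
    using spanning by blast
  then have ex: "\<exists>t\<in>B. 0 < det2 p t" if "p \<noteq> (0,0)" for p
    using that by blast
  obtain t where "t \<in> B" "0 < snd t"
    using ex[of "(1,0)"] by (auto simp: det2_def)
  with rows[of t] have "snd t = 1"
    by linarith
  with \<open>t \<in> B\<close> obtain x1 where x1: "(x1, 1) \<in> B"
    by (metis prod.collapse)
  obtain t' where "t' \<in> B" "snd t' < 0"
    using ex[of "(-1,0)"] by (auto simp: det2_def)
  with rows[of t'] have "snd t' = -1"
    by linarith
  with \<open>t' \<in> B\<close> obtain y1 where y1: "(y1, -1) \<in> B"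
    by (metis prod.collapse)
  define X where "X = {x. (x, 1) \<in> B}"
  define Y where "Y = {y. (y, -1) \<in> B}"
  have "X \<subseteq> {- 2 - y1..2 - y1}" "Y \<subseteq> {- 2 - x1..2 - x1}"
    using sum x1 y1 by (auto simp: X_def Y_def abs_le_iff) (smt (verit))+
  then have fin: "finite X" "finite Y" and ne: "X \<noteq> {}" "Y \<noteq> {}"
    using x1 y1 by (auto intro: finite_subset simp: X_def Y_def)
  \<comment> \<open>The shear by \<open>k\<close> takes the left end of the bottom row to
    \<open>-1\<close>; then \<open>r\<close> and \<open>r'\<close> are the right ends of the bottom
    and the top row.\<close>
  define k where "k = - 1 - Min Y"
  define r where "r = Max Y + k"
  define r' where "r' = Max X - k"
  have Mx: "Min Y \<in> Y" "Max Y \<in> Y" "Max X \<in> X" "Min X \<in> X"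
    using fin ne by simp_all
  have le: "r + r' \<le> 2" "- 1 \<le> r" "- 1 \<le> r'"
    using sum[of "Max X" "Max Y"] sum[of "Max X" "Min Y"] Mx Min_le[OF fin(2) Mx(2)]
    by (auto simp: r_def r'_def k_def X_def Y_def)
  have bd: "- 1 \<le> y + k \<and> y + k \<le> r" if "(y, -1) \<in> B" for y
    using that fin(2) by (auto simp: k_def r_def Y_def)
  have bd': "- 1 \<le> x - k \<and> x - k \<le> r'" if "(x, 1) \<in> B" for x
    using that fin(1) sum[OF that, of "Min Y"] Mx by (auto simp: k_def r'_def X_def Y_def)
  have cases: "p = (fst p, 0) \<and> \<bar>fst p\<bar> \<le> 1 \<or> p = (fst p, 1) \<and> - 1 \<le> fst p - k \<and> fst p - k \<le> r'
      \<or> p = (fst p, -1) \<and> - 1 \<le> fst p + k \<and> fst p + k \<le> r" if "p \<in> B" for p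
    using rows[OF that] row0[of "fst p"] bd[of "fst p"] bd'[of "fst p"] that
    by (cases p) (auto simp: abs_le_iff, (smt (verit))+)
  have fitsI: "fits B" if "unimod M" "\<And>p. p \<in> B \<Longrightarrow> (fst (lin M p) + 1, snd (lin M p) + 1) \<in> shape_points \<sigma>" for M \<sigma>
    using that unfolding fits_def by blast
  note iff = shape_points_iff
  \<comment> \<open>Short rows fit into the square. A long bottom row fits into one of the
    triangles, and so does a long top row after a reflection.\<close>
  consider "r \<le> 1" "r' \<le> 1" | "r = 3" "r' \<le> -1" | "r = 2" "r' \<le> 0" | "r' = 3" "r \<le> -1" | "r' = 2" "r \<le> 0"
    using le by linarith
  then show ?thesis
  proof cases
    case 1
    show ?thesis
    proof (rule fitsI[of "(1, - k, 0, 1)" Square])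
      show "(fst (lin (1, - k, 0, 1) p) + 1, snd (lin (1, - k, 0, 1) p) + 1) \<in> shape_points Square" if "p \<in> B" for p
        using cases[OF that] 1 unfolding iff by (cases p) (auto simp: lin_def)
    qed (simp add: unimod_def)
  next
    case 2
    show ?thesis
    proof (rule fitsI[of "(1, - k, 0, 1)" Triangle_42])
      show "(fst (lin (1, - k, 0, 1) p) + 1, snd (lin (1, - k, 0, 1) p) + 1) \<in> shape_points Triangle_42" if "p \<in> B" for p
        using cases[OF that] 2 unfolding iff by (cases p) (auto simp: lin_def)
    qed (simp add: unimod_def)
  next
    case 3
    show ?thesis
    proof (rule fitsI[of "(1, - k, 0, 1)" Triangle_33])
      show "(fst (lin (1, - k, 0, 1) p) + 1, snd (lin (1, - k, 0, 1) p) + 1) \<in> shape_points Triangle_33" if "p \<in> B" for p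
        using cases[OF that] 3 unfolding iff by (cases p) (auto simp: lin_def)
    qed (simp add: unimod_def)
  next
    case 4
    show ?thesis
    proof (rule fitsI[of "(1, - k, 0, -1)" Triangle_42])
      show "(fst (lin (1, - k, 0, -1) p) + 1, snd (lin (1, - k, 0, -1) p) + 1) \<in> shape_points Triangle_42" if "p \<in> B" for p
        using cases[OF that] 4 unfolding iff by (cases p) (auto simp: lin_def)
    qed (simp add: unimod_def)
  next
    case 5
    show ?thesis
    proof (rule fitsI[of "(1, - k, 0, -1)" Triangle_33])
      show "(fst (lin (1, - k, 0, -1) p) + 1, snd (lin (1, - k, 0, -1) p) + 1) \<in> shape_points Triangle_33" if "p \<in> B" for p
        using cases[OF that] 5 unfolding iff by (cases p) (auto simp: lin_def)
    qed (simp add: unimod_def)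
  qed
qed

text \<open>A point at height 3 or more spans with \<open>(-1,0)\<close> and \<open>(1,0)\<close> a
  triangle whose section at height 1 is longer than 1. This section would contain a further interior
  lattice point.\<close>

lemma height_le_2:
  assumes "(1,0) \<in> B" "(-1,0) \<in> B" "(x, y) \<in> B"
  shows "y \<le> 2"
proof (rule ccontr)
  assume y: "\<not> y \<le> 2"
  \<comment> \<open>The quotient \<open>x / y\<close> rounded to a nearest integer, so
    \<open>(k,1)\<close> is within one half of the segment from the origin to
    \<open>(x,y)\<close>.\<close>
  define k where "k = (2 * x + y) div (2 * y)"
  define \<mu> where "\<mu> = (2 * x + y) mod (2 * y)"
  have "2 * x + y = 2 * (y * k) + \<mu>"
    unfolding k_def \<mu>_def using mult_div_mod_eq[of "2 * y" "2 * x + y"] by (simp only: mult.assoc)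
  moreover have "0 \<le> \<mu>" "\<mu> < 2 * y"
    using y by (simp_all add: \<mu>_def)
  moreover have "2 * w - 2 * x \<le> y \<and> - y \<le> 2 * w - 2 * x" if "2 * x + y = 2 * w + \<mu>" "0 \<le> \<mu>" "\<mu> < 2 * y" for w
    using that by linarith
  ultimately have "2 * (y * k) - 2 * x \<le> y" "- y \<le> 2 * (y * k) - 2 * x"
    by blast+
  then have k: "2 * \<bar>y * k - x\<bar> \<le> y"
    by (simp add: abs_if)
  show False
  proof (cases "0 \<le> y * k - x")
    case True
    with interior[OF assms(3,1), of 1 "y * k - x" y "(k, 1)"] k y show False
      by simp
  next
    case False
    with interior[OF assms(3,2), of 1 "x - y * k" y "(k, 1)"] k y show False
      by simp
  qed
qed

text \<open>The points \<open>(1,1)\<close> and \<open>(0,1)\<close> are midpoints of points of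
  \<open>B\<close>, so two lines through \<open>(1,2)\<close> support \<open>B\<close>. A point at
  height \<open>-2\<close> gives a third such line, and in each case \<open>B\<close> has only three
  rows in another direction.\<close>

lemma fits_if_apex:
  assumes B: "(1,0) \<in> B" "(-1,0) \<in> B" "(1,2) \<in> B" and bot: "\<And>x y. (x, y) \<in> B \<Longrightarrow> - 2 \<le> y"
  shows "fits B"
proof -
  have 1: "x \<le> 1" "y \<le> x + 1" if "(x, y) \<in> B" for x y
    using support[OF B(1,3) that, of "(1,1)"] support[OF B(3,2) that, of "(0,1)"]
    by (simp_all add: det2_def)
  have swap: "fits B" if M: "unimod M" "\<And>p. p \<in> B \<Longrightarrow> \<bar>snd (lin M p)\<bar> \<le> 1" for M
  proof -
    interpret L: reflexive_points "lin M ` B"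
      by (rule reflexive_points_lin[OF reflexive_points_axioms M(1)])
    have "fits (lin M ` B)"
      using M(2) by (intro L.fits_width_2) auto
    then show ?thesis
      using M(1) by (rule fits_lin)
  qed
  show ?thesis
  proof (cases "\<exists>x. (x, -2) \<in> B")
    case True
    then obtain x where x: "(x, -2) \<in> B"
      by blast
    have "odd x"
    proof
      assume "even x"
      then obtain z where "x = 2 * z"
        by blast
      with primitive[OF x, of 2 "(z, -1)"] show False
        by simp
    qed
    moreover have "- 3 \<le> x" "x \<le> 1"
      using 1[OF x] by auto
    ultimately consider "x = 1" | "x = -1" | "x = -3"
      by (cases "x = -2 \<or> x = 0") (auto, smt (verit))
    then show ?thesis
    proof cases
      case 1
      have "- 1 \<le> a + b" if "(a, b) \<in> B" for a b
        using support[OF B(2) x that, of "(0,-1)"] 1 by (simp add: det2_def)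
      with \<open>\<And>y x. (x, y) \<in> B \<Longrightarrow> x \<le> 1\<close> \<open>\<And>y x. (x, y) \<in> B \<Longrightarrow> y \<le> x + 1\<close>
      have "\<bar>a\<bar> \<le> 1" if "(a, b) \<in> B" for a b
        using that by (smt (verit))
      then show ?thesis
        by (intro swap[of "(0, 1, 1, 0)"]) (auto simp: unimod_def lin_def)
    next
      case 2
      have "- 1 \<le> a" if "(a, b) \<in> B" for a b
        using support[OF B(2) x that, of "(-1,-1)"] 2 by (simp add: det2_def)
      with \<open>\<And>y x. (x, y) \<in> B \<Longrightarrow> x \<le> 1\<close> have "\<bar>a\<bar> \<le> 1" if "(a, b) \<in> B" for a b
        using that by (smt (verit))
      then show ?thesis
        by (intro swap[of "(0, 1, 1, 0)"]) (auto simp: unimod_def lin_def)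
    next
      case 3
      have "a - 1 \<le> 2 * b" if "(a, b) \<in> B" for a b
        using support[OF B(1) x that, of "(-1,-1)"] 3 by (simp add: det2_def)
      with \<open>\<And>y x. (x, y) \<in> B \<Longrightarrow> x \<le> 1\<close> \<open>\<And>y x. (x, y) \<in> B \<Longrightarrow> y \<le> x + 1\<close>
      have "\<bar>b - a\<bar> \<le> 1" if "(a, b) \<in> B" for a b
        using that by (smt (verit))
      then show ?thesis
        by (intro swap[of "(1, 0, -1, 1)"]) (auto simp: unimod_def lin_def)
    qed
  next
    case False
    have "(- a + 1, b + 1) \<in> shape_points Triangle_33" if "(a, b) \<in> B" for a b
    proof -
      have "b \<noteq> -2"
        using False that by blast
      with 1[OF that] bot[OF that] show ?thesis
        unfolding shape_points_iff by simp
    qed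
    then show ?thesis
      unfolding fits_def by (intro exI[of _ "(-1, 0, 0, 1)"] exI[of _ Triangle_33]) (auto simp: unimod_def lin_def)
  qed
qed

end

text \<open>In a basis that begins with \<open>p\<close> the pair becomes
  \<open>(1,0), (-1,0)\<close>, and all heights are between \<open>-2\<close> and \<open>2\<close>.
  A point at height \<open>2\<close> or \<open>-2\<close> has odd first coordinate by primitivity
  and is brought to \<open>(1,2)\<close> by a reflection and a shear.\<close>

lemma fits_antipodal:
  assumes "reflexive_points B" and p: "p \<in> B" "(- fst p, - snd p) \<in> B" "p \<noteq> (0,0)"
  shows "fits B"
proof -
  have std: "fits B" if "reflexive_points B" and B: "(1,0) \<in> B" "(-1,0) \<in> B" for B
  proof -
    interpret reflexive_points B
      by fact
    have apex: "fits B'" if r: "reflexive_points B'" and B': "(1,0) \<in> B'" "(-1,0) \<in> B'" "(x, 2) \<in> B'" for B' x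
    proof -
      interpret B': reflexive_points B'
        by fact
      have "odd x"
      proof
        assume "even x"
        then obtain z where "x = 2 * z"
          by blast
        with B'.primitive[OF B'(3), of 2 "(z, 1)"] show False
          by simp
      qed
      then obtain k where k: "x = 2 * k + 1"
        by (elim oddE)
      let ?M = "(1, - k, 0, 1)" and ?N = "(1, 0, 0, -1)"
      have M: "unimod ?M" "unimod ?N"
        by (simp_all add: unimod_def)
      interpret R: reflexive_points "lin ?N ` B'"
        by (rule reflexive_points_lin[OF r M(2)])
      interpret S: reflexive_points "lin ?M ` B'"
        by (rule reflexive_points_lin[OF r M(1)])
      have bot: "- 2 \<le> b" if "(a, b) \<in> B'" for a b
        using R.height_le_2[of a "- b"] imageI[OF B'(1), of "lin ?N"] imageI[OF B'(2), of "lin ?N"]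
          imageI[OF that, of "lin ?N"] by (simp add: lin_def)
      have "fits (lin ?M ` B')"
      proof (rule S.fits_if_apex)
        show "(1,0) \<in> lin ?M ` B'" "(-1,0) \<in> lin ?M ` B'" "(1,2) \<in> lin ?M ` B'"
          using imageI[OF B'(1), of "lin ?M"] imageI[OF B'(2), of "lin ?M"] imageI[OF B'(3), of "lin ?M"]
          by (simp_all add: lin_def k)
        show "- 2 \<le> b" if "(a, b) \<in> lin ?M ` B'" for a b
          using that bot by (auto simp: lin_def)
      qed
      then show ?thesis
        using M(1) by (rule fits_lin)
    qed
    let ?N = "(1, 0, 0, -1)"
    have N: "unimod ?N"
      by (simp add: unimod_def)
    have rN: "reflexive_points (lin ?N ` B)"
      by (rule reflexive_points_lin[OF that(1) N])
    interpret R: reflexive_points "lin ?N ` B"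
      by (rule rN)
    have BN: "(1,0) \<in> lin ?N ` B" "(-1,0) \<in> lin ?N ` B"
      using imageI[OF B(1), of "lin ?N"] imageI[OF B(2), of "lin ?N"] by (simp_all add: lin_def)
    consider x where "(x, 2) \<in> B" | x where "(x, -2) \<in> B" | "\<And>x y. (x, y) \<in> B \<Longrightarrow> y \<noteq> 2 \<and> y \<noteq> -2"
      by blast
    then show ?thesis
    proof cases
      case 1
      with apex[OF that(1) B] show ?thesis .
    next
      case (2 x)
      from imageI[OF 2, of "lin ?N"] have "(x, 2) \<in> lin ?N ` B"
        by (simp add: lin_def)
      from fits_lin[OF apex[OF rN BN this] N] show ?thesis .
    next
      case 3
      show ?thesis
      proof (rule fits_width_2)
        fix t assume t: "t \<in> B"
        obtain a b where ab: "t = (a, b)"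
          by (cases t)
        have "b \<le> 2" "- b \<le> 2"
          using height_le_2[OF B, of a b] R.height_le_2[OF BN, of a "- b"] imageI[OF t, of "lin ?N"] t
          by (simp_all add: ab lin_def)
        moreover have "b \<noteq> 2 \<and> b \<noteq> -2"
          using 3[of a b] t by (simp add: ab)
        ultimately have "\<bar>b\<bar> \<le> 1"
          by arith
        then show "\<bar>snd t\<bar> \<le> 1"
          by (simp add: ab)
      qed
    qed
  qed
  interpret reflexive_points B
    by fact
  obtain s where s: "det2 p s = 1"
    using bezout[OF p(1,3)] .
  let ?M = "(snd s, - fst s, - snd p, fst p)"
  have M: "unimod ?M"
    using s by (simp add: unimod_def det2_def algebra_simps)
  have "(1,0) \<in> lin ?M ` B" "(-1,0) \<in> lin ?M ` B"
    using imageI[OF p(1), of "lin ?M"] imageI[OF p(2), of "lin ?M"] s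
    by (simp_all add: lin_def det2_def algebra_simps)
  from fits_lin[OF std[OF reflexive_points_lin[OF assms(1) M] this] M] show ?thesis .
qed

section \<open>Sets without antipodal pairs\<close>

context reflexive_points
begin

text \<open>If \<open>b \<le> a\<close>, then \<open>a (p + q) = t + (a - b) q\<close>, so
  \<open>p + q\<close> lies in the triangle of the origin, \<open>t\<close> and \<open>q\<close>;
  the other case is symmetric.\<close>

lemma add_in_B:
  assumes "p \<in> B" "q \<in> B" "1 \<le> a" "1 \<le> b" and t: "t \<in> B" "fst t = a * fst p + b * fst q" "snd t = a * snd p + b * snd q"
  shows "(fst p + fst q, snd p + snd q) \<in> B"
proof (cases "b \<le> a")
  case True
  show ?thesis
    by (rule convex[OF t(1) assms(2), of 1 "a - b" a]) (use assms True in \<open>simp_all add: algebra_simps\<close>)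
next
  case False
  show ?thesis
    by (rule convex[OF t(1) assms(1), of 1 "b - a" b]) (use assms False in \<open>simp_all add: algebra_simps\<close>)
qed

text \<open>
  Without antipodal points, a triangle around the origin of minimal size has no further lattice
  points, so its vertices are \<open>p\<close>, \<open>q\<close> and \<open>- p - q\<close> for a lattice basis \<open>p, q\<close>.
\<close>

definition triangle :: "lpt \<Rightarrow> lpt \<Rightarrow> lpt \<Rightarrow> bool" where
  "triangle p q r \<longleftrightarrow> p \<in> B \<and> q \<in> B \<and> r \<in> B \<and> 0 < det2 p q \<and> 0 < det2 q r \<and> 0 < det2 r p"

lemma parallel:
  assumes "p \<in> B" "q \<in> B" "p \<noteq> (0,0)" "q \<noteq> (0,0)" "det2 p q = 0"
  shows "q = p \<or> q = (- fst p, - snd p)"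
proof -
  obtain s where s: "det2 p s = 1"
    using bezout[OF assms(1,3)] .
  have q: "fst q = det2 q s * fst p" "snd q = det2 q s * snd p"
  proof -
    have "fst q * det2 p s = det2 q s * fst p + det2 p q * fst s" "snd q * det2 p s = det2 q s * snd p + det2 p q * snd s"
      by (simp_all add: det2_def algebra_simps)
    with s assms(5) show "fst q = det2 q s * fst p" "snd q = det2 q s * snd p"
      by simp_all
  qed
  have "\<not> 1 < \<bar>det2 q s\<bar>"
    using primitive[OF assms(2), of "det2 q s" p] q assms(4) by auto
  then consider "det2 q s = 0" | "det2 q s = 1" | "det2 q s = -1"
    by linarith
  then show ?thesis
    using q assms(4) by cases (auto simp: prod_eq_iff)
qed

lemma triangle_exists:
  assumes anti: "\<And>p. p \<in> B \<Longrightarrow> (- fst p, - snd p) \<in> B \<Longrightarrow> p = (0,0)"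
  obtains p q r where "triangle p q r"
proof -
  obtain A0 where A0: "A0 \<subseteq> B" "finite A0" "\<And>p. p \<noteq> (0,0) \<Longrightarrow> \<exists>t\<in>A0. 0 < det2 p t"
    using spanning by blast
  obtain p where p: "p \<in> A0" "p \<noteq> (0,0)"
    using A0(3)[of "(1,0)"] by (auto simp: det2_def)
  define T where "T = {t \<in> A0. 0 < det2 p t}"
  \<comment> \<open>The cotangent of the angle from \<open>p\<close> to \<open>t\<close>, so its
    minimum marks the largest angle.\<close>
  define \<rho> where "\<rho> t = of_int (fst p * fst t + snd p * snd t) / real_of_int (det2 p t)" for t
  have "finite T" "T \<noteq> {}"
    using A0(2) A0(3)[OF p(2)] unfolding T_def by (simp, blast)
  then have "Min (\<rho> ` T) \<in> \<rho> ` T"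
    by simp
  then obtain q where q: "q \<in> T" "\<rho> q = Min (\<rho> ` T)"
    by (metis imageE)
  have qmin: "0 \<le> det2 t q" if "t \<in> T" for t
  proof -
    have "\<rho> q \<le> \<rho> t"
      using that \<open>finite T\<close> q(2) by simp
    then have "real_of_int ((fst p * fst q + snd p * snd q) * det2 p t) \<le> of_int ((fst p * fst t + snd p * snd t) * det2 p q)"
      using that q(1) by (simp add: \<rho>_def T_def field_simps)
    then have "(fst p * fst q + snd p * snd q) * det2 p t \<le> (fst p * fst t + snd p * snd t) * det2 p q"
      unfolding of_int_le_iff .
    moreover have "det2 t q * (fst p ^ 2 + snd p ^ 2)
        = (fst p * fst t + snd p * snd t) * det2 p q - (fst p * fst q + snd p * snd q) * det2 p t"
      by (simp add: det2_def power2_eq_square algebra_simps)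
    ultimately have "0 \<le> det2 t q * (fst p ^ 2 + snd p ^ 2)"
      by simp
    moreover have "0 < fst p ^ 2 + snd p ^ 2"
      using p(2) by (auto simp: prod_eq_iff sum_power2_gt_zero_iff)
    ultimately show ?thesis
      by (simp add: zero_le_mult_iff)
  qed
  have "q \<noteq> (0,0)"
    using q(1) by (auto simp: T_def det2_def)
  then obtain r where r: "r \<in> A0" "0 < det2 q r"
    using A0(3) by blast
  have "r \<notin> T"
    using qmin[of r] r(2) det2_commute[of q r] by auto
  moreover have "det2 p r \<noteq> 0"
  proof
    assume 0: "det2 p r = 0"
    have "r \<noteq> (0,0)"
      using r(2) by (auto simp: det2_def)
    with parallel[of p r] 0 p r A0(1) consider "r = p" | "r = (- fst p, - snd p)"
      by blast
    then show False
    proof cases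
      case 1
      with r(2) q(1) show False
        by (simp add: T_def det2_commute[of q p])
    next
      case 2
      with anti[of p] p r A0(1) show False
        by auto
    qed
  qed
  ultimately have "0 < det2 r p"
    using r(1) by (auto simp: T_def det2_commute[of r p])
  with that[of p q r] p q r A0(1) show thesis
    by (auto simp: triangle_def T_def)
qed

text \<open>If \<open>p, q\<close> is not a basis, the triangle of the origin, \<open>p\<close> and
  \<open>q\<close> contains another lattice point \<open>s\<close> with \<open>det2 p s = 1\<close>.
  Depending on the side of \<open>s\<close> on which \<open>r\<close> lies, \<open>s\<close>
  replaces \<open>q\<close> or \<open>p\<close>.\<close>

lemma smaller_triangle:
  assumes anti: "\<And>p. p \<in> B \<Longrightarrow> (- fst p, - snd p) \<in> B \<Longrightarrow> p = (0,0)"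
    and tri: "triangle p q r" and "1 < det2 p q"
  obtains p' q' r' where "triangle p' q' r'"
    "det2 p' q' + det2 q' r' + det2 r' p' < det2 p q + det2 q r + det2 r p"
proof -
  define m where "m = det2 p q"
  have pqr: "p \<in> B" "q \<in> B" "r \<in> B" "0 < det2 q r" "0 < det2 r p" "1 < m"
    using tri assms(3) by (auto simp: triangle_def m_def)
  have "p \<noteq> (0,0)"
    using assms(3) by (auto simp: det2_def)
  then obtain s0 where s0: "det2 p s0 = 1"
    using bezout[OF pqr(1)] by blast
  \<comment> \<open>Subtracting multiples of \<open>p\<close> keeps \<open>det2 p s = 1\<close> and
    reduces \<open>det2 s q\<close> modulo \<open>m\<close>, which puts \<open>s\<close> into the
    triangle.\<close>
  define k where "k = det2 s0 q div m"
  define s where "s = (fst s0 - k * fst p, snd s0 - k * snd p)"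
  define \<alpha> where "\<alpha> = det2 s0 q mod m"
  have ps: "det2 p s = 1"
    using s0 by (simp add: s_def det2_def algebra_simps)
  have sq: "det2 s q = \<alpha>"
  proof -
    have "det2 s q = det2 s0 q - m * k"
      by (simp add: s_def det2_def m_def algebra_simps)
    then show ?thesis
      by (simp add: \<alpha>_def k_def minus_mult_div_eq_mod)
  qed
  have "0 \<le> \<alpha>" "\<alpha> < m"
    using pqr(6) by (simp_all add: \<alpha>_def)
  then have \<alpha>: "0 \<le> \<alpha>" "\<alpha> + 1 \<le> m"
    by simp_all
  have ms: "m * fst s = \<alpha> * fst p + 1 * fst q" "m * snd s = \<alpha> * snd p + 1 * snd q"
  proof -
    have "det2 p q * fst s = det2 s q * fst p + det2 p s * fst q" "det2 p q * snd s = det2 s q * snd p + det2 p s * snd q"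
      by (simp_all add: det2_def algebra_simps)
    then show "m * fst s = \<alpha> * fst p + 1 * fst q" "m * snd s = \<alpha> * snd p + 1 * snd q"
      by (simp_all add: sq ps m_def)
  qed
  have "s \<in> B"
    by (rule convex[OF pqr(1,2) \<alpha>(1) _ \<alpha>(2) _ ms]) (use pqr(6) in simp_all)
  have msr: "m * det2 s r = det2 q r - \<alpha> * det2 r p"
  proof -
    have "m * det2 s r = (m * fst s) * snd r - (m * snd s) * fst r"
      by (simp add: det2_def algebra_simps)
    then show ?thesis
      unfolding ms by (simp add: det2_def algebra_simps)
  qed
  have "det2 s r \<noteq> 0"
  proof
    assume 0: "det2 s r = 0"
    have "s \<noteq> (0,0)" "r \<noteq> (0,0)"
      using ps pqr(4) by (auto simp: det2_def)
    with parallel[OF \<open>s \<in> B\<close> pqr(3)] 0 consider "r = s" | "r = (- fst s, - snd s)"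
      by blast
    then show False
    proof cases
      case 1
      then show False
        using ps pqr(5) by (simp add: det2_commute[of s p])
    next
      case 2
      with anti[OF \<open>s \<in> B\<close>] pqr(3) \<open>s \<noteq> (0,0)\<close> show False
        by simp
    qed
  qed
  then consider "0 < det2 s r" | "det2 s r < 0"
    by linarith
  then show thesis
  proof cases
    case 1
    have "m * det2 s r \<le> det2 q r"
      using msr \<alpha>(1) pqr(5) by simp
    moreover have "1 * det2 s r \<le> m * det2 s r"
      using 1 pqr(6) by (intro mult_right_mono) auto
    ultimately have "det2 s r \<le> det2 q r"
      by simp
    then show thesis
      using that[of p s r] pqr \<open>s \<in> B\<close> 1 ps by (simp add: triangle_def m_def)
  next
    case 2
    have pos: "0 < \<alpha>"
    proof (rule ccontr)
      assume "\<not> 0 < \<alpha>"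
      then have "\<alpha> = 0"
        using \<alpha>(1) by simp
      then have "0 < m * det2 s r"
        using msr pqr(4) by simp
      with 2 pqr(6) show False
        by (simp add: zero_less_mult_iff)
    qed
    have "m * det2 r s \<le> \<alpha> * det2 r p"
      using msr pqr(4) by (simp add: det2_commute[of r s])
    also have "\<dots> \<le> m * det2 r p"
      using \<alpha>(2) pqr(5) by (intro mult_right_mono) auto
    finally have "det2 r s \<le> det2 r p"
      using pqr(6) by simp
    then show thesis
      using that[of s q r] pqr \<open>s \<in> B\<close> 2 pos sq \<alpha> by (simp add: triangle_def m_def det2_commute[of r s])
  qed
qed

lemma unimodular_triangle_exists:
  assumes anti: "\<And>p. p \<in> B \<Longrightarrow> (- fst p, - snd p) \<in> B \<Longrightarrow> p = (0,0)"
  obtains p q r where "triangle p q r" "det2 p q = 1" "det2 q r = 1" "det2 r p = 1"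
proof -
  define size where "size = (\<lambda>(p, q, r). nat (det2 p q + det2 q r + det2 r p))"
  obtain p q r where tri: "triangle p q r"
    using triangle_exists[OF anti] by blast
  obtain t where t: "(case t of (p, q, r) \<Rightarrow> triangle p q r)"
      "\<And>t'. (case t' of (p, q, r) \<Rightarrow> triangle p q r) \<Longrightarrow> size t \<le> size t'"
    using exists_least_iff[of "\<lambda>n. \<exists>t. (case t of (p, q, r) \<Rightarrow> triangle p q r) \<and> size t = n"] tri
    by (metis (mono_tags, lifting) case_prod_conv not_le)
  obtain p q r where pqr: "t = (p, q, r)"
    by (metis prod_cases3)
  have tri: "triangle p q r"
    using t(1) by (simp add: pqr)
  have min: "det2 p q + det2 q r + det2 r p \<le> det2 p' q' + det2 q' r' + det2 r' p'" if "triangle p' q' r'" for p' q' r'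
    using t(2)[of "(p', q', r')"] that tri by (auto simp: size_def pqr triangle_def)
  have rot: "triangle q r p" "triangle r p q"
    using tri by (auto simp: triangle_def)
  have "\<not> 1 < det2 p q" "\<not> 1 < det2 q r" "\<not> 1 < det2 r p"
    using smaller_triangle[OF anti tri] smaller_triangle[OF anti rot(1)] smaller_triangle[OF anti rot(2)] min
    by (smt (verit))+
  with tri that[of p q r] show thesis
    by (auto simp: triangle_def)
qed

text \<open>Unimodularity gives \<open>r = - p - q\<close>. The sum of two vertices is the antipode
  of the third, hence not in \<open>B\<close>, so no point of \<open>B\<close> lies in the interior
  of one of the three cones. By primitivity only the origin and the vertices remain.\<close>

lemma fits_not_antipodal:
  assumes anti: "\<And>p. p \<in> B \<Longrightarrow> (- fst p, - snd p) \<in> B \<Longrightarrow> p = (0,0)"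
  shows "fits B"
proof -
  obtain p q r where tri: "triangle p q r" and det: "det2 p q = 1" "det2 q r = 1" "det2 r p = 1"
    using unimodular_triangle_exists[OF anti] by blast
  have in_B: "p \<in> B" "q \<in> B" "r \<in> B"
    using tri by (auto simp: triangle_def)
  have r: "fst r = - fst p - fst q" "snd r = - snd p - snd q"
  proof -
    have "det2 p q * fst r = - det2 q r * fst p - det2 r p * fst q" "det2 p q * snd r = - det2 q r * snd p - det2 r p * snd q"
      by (simp_all add: det2_def algebra_simps)
    with det show "fst r = - fst p - fst q" "snd r = - snd p - snd q"
      by simp_all
  qed
  have nonzero: "p \<noteq> (0,0)" "q \<noteq> (0,0)" "r \<noteq> (0,0)"
    using det by (auto simp: det2_def)
  have not_in: "(fst p + fst q, snd p + snd q) \<notin> B" "(fst q + fst r, snd q + snd r) \<notin> B" "(fst r + fst p, snd r + snd p) \<notin> B"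
  proof -
    have "(fst p + fst q, snd p + snd q) = (- fst r, - snd r)" "(fst q + fst r, snd q + snd r) = (- fst p, - snd p)"
      "(fst r + fst p, snd r + snd p) = (- fst q, - snd q)"
      by (simp_all add: r)
    then show "(fst p + fst q, snd p + snd q) \<notin> B" "(fst q + fst r, snd q + snd r) \<notin> B" "(fst r + fst p, snd r + snd p) \<notin> B"
      using anti[OF in_B(3)] anti[OF in_B(1)] anti[OF in_B(2)] nonzero by metis+
  qed
  let ?x = "\<lambda>t. det2 t q" and ?y = "\<lambda>t. det2 p t"
  have coord: "fst t = ?x t * fst p + ?y t * fst q" "snd t = ?x t * snd p + ?y t * snd q" for t
  proof -
    have "det2 p q * fst t = ?x t * fst p + ?y t * fst q" "det2 p q * snd t = ?x t * snd p + ?y t * snd q"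
      by (simp_all add: det2_def algebra_simps)
    with det(1) show "fst t = ?x t * fst p + ?y t * fst q" "snd t = ?x t * snd p + ?y t * snd q"
      by simp_all
  qed
  have "(?x t + 1, ?y t + 1) \<in> shape_points Triangle_33" if t: "t \<in> B" for t
  proof -
    define x where "x = ?x t"
    define y where "y = ?y t"
    note c = coord[of t, folded x_def y_def]
    have "\<not> (1 \<le> x \<and> 1 \<le> y)"
      using add_in_B[OF in_B(1,2), of x y t] t c not_in(1) by auto
    \<comment> \<open>The coordinates of \<open>t\<close> in the basis \<open>q, r\<close> are
      \<open>y - x\<close> and \<open>- x\<close>; in the basis \<open>r, p\<close> they are
      \<open>- y\<close> and \<open>x - y\<close>.\<close>
    moreover have "\<not> (1 \<le> y - x \<and> 1 \<le> - x)"
      using add_in_B[OF in_B(2,3), of "y - x" "- x" t] t c not_in(2) by (auto simp: r algebra_simps)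
    moreover have "\<not> (1 \<le> - y \<and> 1 \<le> x - y)"
      using add_in_B[OF in_B(3,1), of "- y" "x - y" t] t c not_in(3) by (auto simp: r algebra_simps)
    moreover have t0: "x = 0 \<and> y = 0" if "t = (0,0)"
      using that by (simp add: x_def y_def det2_def)
    moreover have "\<bar>x\<bar> \<le> 1" if "y = 0"
      using primitive[OF t, of x p] c that t0 by fastforce
    moreover have "\<bar>y\<bar> \<le> 1" if "x = 0"
      using primitive[OF t, of y q] c that t0 by fastforce
    moreover have "\<bar>x\<bar> \<le> 1" if "y = x"
      using primitive[OF t, of x "(fst p + fst q, snd p + snd q)"] c that t0
      by (fastforce simp: algebra_simps)
    ultimately show ?thesis
      unfolding shape_points_iff x_def[symmetric] y_def[symmetric] by (smt (verit))
  qed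
  moreover have "unimod (snd q, - fst q, - snd p, fst p)"
    using det(1) by (simp add: unimod_def det2_def algebra_simps)
  moreover have "lin (snd q, - fst q, - snd p, fst p) t = (?x t, ?y t)" for t
    by (simp add: lin_def det2_def algebra_simps)
  ultimately show ?thesis
    unfolding fits_def by (intro exI[of _ "(snd q, - fst q, - snd p, fst p)"] exI[of _ Triangle_33]) simp
qed

theorem fits: "fits B"
  using fits_not_antipodal fits_antipodal[OF reflexive_points_axioms] by blast

end

text \<open>The first two axioms hold because shrinking towards the interior point \<open>0\<close>
  leads into the interior. For the third, the midpoint is a nonzero lattice point, hence not
  interior, and a supporting line at it must contain both end points.\<close>

lemma reflexive_points_polygon:
  fixes A :: "lpt set"
  assumes "finite A" and "interior_lattice_points (convex hull (pt ` A)) = {(0,0)}"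
  shows "reflexive_points {p. pt p \<in> convex hull (pt ` A)}"
proof
  let ?C = "convex hull (pt ` A)"
  have int_iff: "pt p \<in> interior ?C \<longleftrightarrow> p = (0,0)" for p
    using assms(2) unfolding interior_lattice_points_def by blast
  then have int: "\<And>p. pt p \<in> interior ?C \<Longrightarrow> p = (0,0)"
    by blast
  have "pt (0,0) = (0,0)"
    by (simp add: pt_def)
  with int_iff[of "(0,0)"] have int0: "(0,0) \<in> interior ?C"
    by simp
  have C: "convex ?C"
    by (rule convex_convex_hull)
  have int_scale: "s *\<^sub>R y \<in> interior ?C" if "y \<in> ?C" "0 \<le> s" "s < 1" for s y
  proof (cases "s = 0 \<or> y = 0")
    case True
    with int0 show ?thesis
      by (auto simp: zero_prod_def)
  next
    case False
    then have "s *\<^sub>R y \<in> open_segment (0,0) y"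
      using that by (auto simp: in_segment zero_prod_def[symmetric] intro!: exI[of _ s])
    moreover have "open_segment (0,0) y \<subseteq> interior ?C"
      using int0 that(1) closure_subset[of ?C] by (intro in_interior_closure_convex_segment C) auto
    ultimately show ?thesis
      by blast
  qed
  have scale: "s *\<^sub>R y \<in> ?C" if "y \<in> ?C" "0 \<le> s" "s \<le> 1" for s y
    using int_scale[OF that(1,2)] that interior_subset[of ?C] by (cases "s = 1") auto
  have comb: "pt z = (of_int (a + b) / of_int m) *\<^sub>R y \<and> y \<in> ?C"
    if "pt p \<in> ?C" "pt q \<in> ?C" "0 \<le> a" "0 \<le> b" "0 < a + b" "0 < m"
      "m * fst z = a * fst p + b * fst q" "m * snd z = a * snd p + b * snd q"
      "y = (of_int a / of_int (a + b)) *\<^sub>R pt p + (of_int b / of_int (a + b)) *\<^sub>R pt q"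
    for p q z y and a b m :: int
  proof
    have "real_of_int m * fst (pt z) = a * fst (pt p) + b * fst (pt q)"
      "real_of_int m * snd (pt z) = a * snd (pt p) + b * snd (pt q)"
      using arg_cong[OF that(7), of real_of_int] arg_cong[OF that(8), of real_of_int] by (simp_all add: pt_def)
    moreover have "real_of_int (a + b) * (real_of_int a / of_int (a + b)) = a"
      "real_of_int (a + b) * (real_of_int b / of_int (a + b)) = b"
      using that(5) by simp_all
    then have "of_int (a + b) *\<^sub>R y = of_int a *\<^sub>R pt p + of_int b *\<^sub>R pt q"
      unfolding that(9) by (simp only: scaleR_right_distrib scaleR_scaleR)
    ultimately have "of_int m *\<^sub>R pt z = of_int (a + b) *\<^sub>R y"
      by (simp add: prod_eq_iff)
    then have "(1 / of_int m) *\<^sub>R (of_int m *\<^sub>R pt z) = (1 / of_int m) *\<^sub>R (of_int (a + b) *\<^sub>R y)"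
      by simp
    then show "pt z = (of_int (a + b) / of_int m) *\<^sub>R y"
      using that(6) by (simp del: of_int_add)
    have "real_of_int a / of_int (a + b) + of_int b / of_int (a + b) = 1"
      using that(5) by (simp add: add_divide_distrib[symmetric])
    then show "y \<in> ?C"
      unfolding that(9) using that by (intro convexD[OF C]) simp_all
  qed
  show "z = (0,0)"
    if pq: "p \<in> {p. pt p \<in> ?C}" "q \<in> {p. pt p \<in> ?C}" "0 \<le> a" "0 \<le> b" "a + b < m"
      "m * fst z = a * fst p + b * fst q" "m * snd z = a * snd p + b * snd q" for p q a b m z
  proof (cases "a + b = 0")
    case True
    with pq show ?thesis
      by (auto simp: prod_eq_iff add_nonneg_eq_0_iff)
  next
    case False
    then have pos: "0 < a + b" "0 < m"
      using pq by linarith+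
    note c = comb[of p q a b m z, OF _ _ pq(3,4) pos pq(6,7) refl]
    have "pt z \<in> interior ?C"
      using c pq(1,2,3,4,5) pos by (auto intro!: int_scale)
    then show ?thesis
      by (rule int)
  qed
  show "z \<in> {p. pt p \<in> ?C}"
    if pq: "p \<in> {p. pt p \<in> ?C}" "q \<in> {p. pt p \<in> ?C}" "0 \<le> a" "0 \<le> b" "a + b \<le> m" "0 < m"
      "m * fst z = a * fst p + b * fst q" "m * snd z = a * snd p + b * snd q" for p q a b m z
  proof (cases "a + b = 0")
    case True
    with pq have "z = (0,0)"
      by (auto simp: prod_eq_iff add_nonneg_eq_0_iff)
    then show ?thesis
      using int0 interior_subset[of ?C] by (auto simp: pt_def)
  next
    case False
    then have pos: "0 < a + b"
      using pq by linarith
    note c = comb[of p q a b m z, OF _ _ pq(3,4) pos pq(6,7,8) refl]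
    show ?thesis
      using c pq pos by (auto intro!: scale)
  qed
  show "0 \<le> det2 p q * det2 (fst q - fst p, snd q - snd p) (fst t - fst p, snd t - snd p)"
    if pqt: "p \<in> {p. pt p \<in> ?C}" "q \<in> {p. pt p \<in> ?C}" "t \<in> {p. pt p \<in> ?C}"
      "2 * fst z = fst p + fst q" "2 * snd z = snd p + snd q" "det2 p q \<noteq> 0" for p q t z
  proof -
    have "z \<noteq> (0,0)"
    proof
      assume "z = (0,0)"
      with pqt have "fst q = - fst p" "snd q = - snd p"
        by simp_all
      with pqt(6) show False
        by (simp add: det2_def)
    qed
    with int have "pt z \<notin> interior ?C"
      by blast
    then have "interior ?C \<inter> {pt z} = {}"
      by blast
    moreover have "convex (interior ?C)" "interior ?C \<noteq> {}"
      using C int0 by (auto intro: convex_interior)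
    ultimately obtain \<eta> b where \<eta>: "\<eta> \<noteq> 0" "\<And>x. x \<in> interior ?C \<Longrightarrow> \<eta> \<bullet> x \<le> b" "b \<le> \<eta> \<bullet> pt z"
      using separating_hyperplane_sets[of "interior ?C" "{pt z}"] by auto
    have le: "\<eta> \<bullet> x \<le> \<eta> \<bullet> pt z" if "x \<in> ?C" for x
    proof -
      have "closure (interior ?C) \<subseteq> {x. \<eta> \<bullet> x \<le> b}"
        using \<eta>(2) by (intro closure_minimal closed_halfspace_le) auto
      then have "?C \<subseteq> {x. \<eta> \<bullet> x \<le> b}"
        using convex_closure_interior[OF C \<open>interior ?C \<noteq> {}\<close>] closure_subset[of ?C] by blast
      with that \<eta>(3) show ?thesis
        by force
    qed
    define d where "d = (fst q - fst p, snd q - snd p)"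
    have z2: "2 * (\<eta> \<bullet> pt z) = \<eta> \<bullet> pt p + \<eta> \<bullet> pt q"
      using arg_cong[OF pqt(4), of real_of_int] arg_cong[OF pqt(5), of real_of_int]
      by (simp add: pt_def inner_prod_def algebra_simps)
    with le[of "pt p"] le[of "pt q"] pqt(1,2) have eq: "\<eta> \<bullet> pt p = \<eta> \<bullet> pt z" "\<eta> \<bullet> pt q = \<eta> \<bullet> pt z"
      by auto
    define e where "e = (- real_of_int (snd d), real_of_int (fst d))"
    have e: "e \<bullet> pt x = of_int (det2 d x)" for x
      by (simp add: e_def pt_def inner_prod_def det2_def)
    have "d \<noteq> (0,0)"
      using pqt(6) by (auto simp: d_def det2_def)
    have "\<eta> \<bullet> pt d = 0"
      using eq by (simp add: d_def pt_def inner_prod_def algebra_simps)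
    moreover have "e \<bullet> pt d = 0"
      by (simp add: e det2_def)
    moreover have "pt d \<noteq> 0" "e \<noteq> 0"
      using \<open>d \<noteq> (0,0)\<close> by (auto simp: pt_def e_def zero_prod_def prod_eq_iff)
    ultimately obtain s where s: "\<eta> = s *\<^sub>R e"
      using orthogonal_parallel by metis
    have det_t: "det2 d (fst t - fst p, snd t - snd p) = det2 d t - det2 d p"
      by (simp add: det2_def algebra_simps)
    have "s * of_int (det2 d (fst t - fst p, snd t - snd p)) = \<eta> \<bullet> pt t - \<eta> \<bullet> pt p"
      unfolding det_t by (simp add: s e right_diff_distrib)
    also have "\<dots> \<le> 0"
      using le[of "pt t"] pqt(3) eq by simp
    finally have t: "s * of_int (det2 d (fst t - fst p, snd t - snd p)) \<le> 0" .
    have "s * of_int (det2 p q) = - (\<eta> \<bullet> pt p)"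
      by (simp add: s e) (simp add: d_def det2_def algebra_simps)
    also have "\<dots> \<le> 0"
      using le[of "(0,0)"] int0 interior_subset[of ?C] eq by (auto simp: zero_prod_def[symmetric])
    finally have o: "s * of_int (det2 p q) \<le> 0" .
    \<comment> \<open>The origin and \<open>t\<close> lie on the same side of the supporting line;
      \<open>det2 p q\<close> measures the position of the origin.\<close>
    have "0 \<le> (s * of_int (det2 p q)) * (s * of_int (det2 d (fst t - fst p, snd t - snd p)))"
      using o t by (rule mult_nonpos_nonpos)
    also have "\<dots> = (s * s) * of_int (det2 p q * det2 d (fst t - fst p, snd t - snd p))"
      by simp
    finally have "0 \<le> (s * s) * real_of_int (det2 p q * det2 d (fst t - fst p, snd t - snd p))" .
    moreover have "0 < s * s"
      using \<eta>(1) s by (auto simp: zero_less_mult_iff)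
    ultimately show ?thesis
      unfolding d_def[symmetric] by (simp only: zero_le_mult_iff of_int_0_le_iff, linarith)
  qed
  show "\<exists>A0\<subseteq>{p. pt p \<in> ?C}. finite A0 \<and> (\<forall>p. p \<noteq> (0,0) \<longrightarrow> (\<exists>t\<in>A0. 0 < det2 p t))"
  proof (intro exI[of _ A] conjI allI impI)
    show "A \<subseteq> {p. pt p \<in> ?C}"
      by (auto intro: hull_inc)
    show "finite A"
      by fact
    fix p :: lpt assume p: "p \<noteq> (0,0)"
    define e where "e = (- real_of_int (snd p), real_of_int (fst p))"
    have e: "e \<bullet> pt t = of_int (det2 p t)" for t
      by (simp add: e_def pt_def inner_prod_def det2_def)
    show "\<exists>t\<in>A. 0 < det2 p t"
    proof (rule ccontr)
      assume "\<not> ?thesis"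
      then have "?C \<subseteq> {x. e \<bullet> x \<le> 0}"
        by (intro hull_minimal convex_halfspace_le) (force simp: e)
      moreover obtain r where r: "0 < r" "ball (0,0) r \<subseteq> ?C"
        using int0 mem_interior by blast
      have "e \<noteq> 0"
        using p by (auto simp: e_def zero_prod_def prod_eq_iff)
      then have "(r / 2 / norm e) *\<^sub>R e \<in> ball (0,0) r"
        using r(1) by (simp add: dist_norm zero_prod_def[symmetric])
      with r(2) have "(r / 2 / norm e) *\<^sub>R e \<in> ?C"
        by blast
      ultimately have "e \<bullet> ((r / 2 / norm e) *\<^sub>R e) \<le> 0"
        by blast
      then have "r / 2 / norm e * (e \<bullet> e) \<le> 0"
        by (simp only: inner_scaleR_right)
      moreover have "0 < r / 2 / norm e * (e \<bullet> e)"
        using r(1) \<open>e \<noteq> 0\<close> by (intro mult_pos_pos divide_pos_pos) simp_all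
      ultimately show False
        by linarith
    qed
  qed
qed

theorem normal_form_exists:
  assumes "finite A" and int: "interior_lattice_points (convex hull (pt ` A)) = {\<omega>}"
  obtains N where "normal_form A N"
proof -
  define T where "T p = (fst p - fst \<omega>, snd p - snd \<omega>)" for p
  have pt_T: "pt (T p) = - pt \<omega> + pt p" for p
    by (simp add: T_def pt_def)
  have hull: "convex hull (pt ` T ` A) = (+) (- pt \<omega>) ` (convex hull (pt ` A))"
    unfolding convex_hull_translation[symmetric] image_image by (simp add: pt_T)
  have "pt p \<in> interior (convex hull (pt ` T ` A)) \<longleftrightarrow> pt (fst p + fst \<omega>, snd p + snd \<omega>) \<in> interior (convex hull (pt ` A))" for p
  proof -
    have "pt (fst p + fst \<omega>, snd p + snd \<omega>) = pt p + pt \<omega>"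
      by (simp add: pt_def)
    then show ?thesis
      unfolding hull interior_translation by (auto simp: image_iff algebra_simps)
  qed
  then have "interior_lattice_points (convex hull (pt ` T ` A)) = {(0,0)}"
    using int by (auto simp: interior_lattice_points_def prod_eq_iff set_eq_iff)
  then interpret reflexive_points "{p. pt p \<in> convex hull (pt ` T ` A)}"
    using assms(1) by (intro reflexive_points_polygon) auto
  obtain M \<sigma> where M: "unimod M" "\<And>p. pt p \<in> convex hull (pt ` T ` A) \<Longrightarrow>
      (fst (lin M p) + 1, snd (lin M p) + 1) \<in> shape_points \<sigma>"
    using fits unfolding fits_def by blast
  obtain a b c d where abcd: "M = (a, b, c, d)"
    by (metis prod_cases4)
  define \<phi> where "\<phi> = (\<lambda>p. (fst (lin M (T p)) + 1, snd (lin M (T p)) + 1))"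
  have "\<phi> (i, j) = (a * i + b * j + (1 - a * fst \<omega> - b * snd \<omega>), c * i + d * j + (1 - c * fst \<omega> - d * snd \<omega>))" for i j
    by (simp add: \<phi>_def abcd lin_def T_def algebra_simps)
  moreover have "\<bar>a * d - b * c\<bar> = 1"
    using M(1) by (simp add: abcd unimod_def)
  ultimately have "unimodular_affine \<phi>"
    unfolding unimodular_affine_def by blast
  moreover have "\<phi> ` A \<subseteq> shape_points \<sigma>"
  proof
    fix x assume "x \<in> \<phi> ` A"
    then obtain p where p: "p \<in> A" "x = \<phi> p"
      by blast
    then have "pt (T p) \<in> convex hull (pt ` T ` A)"
      by (intro hull_inc) blast
    from M(2)[OF this] show "x \<in> shape_points \<sigma>"
      by (simp add: p \<phi>_def)
  qed
  ultimately have "normal_form A (\<sigma>, \<phi>)"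
    by (simp add: normal_form_def)
  with that show thesis .
qed

section \<open>Passing to the normal form\<close>

text \<open>\<open>E\<close> is a segment in direction \<open>r\<close>, and a functional with
  values \<open>1\<close> or \<open>-1\<close> on \<open>r\<close> measures it in units of
  \<open>norm r\<close>. This turns lattice lengths into lengths of projections.\<close>

lemma segment_length:
  fixes E :: "(real \<times> real) set" and \<xi> :: "real \<times> real \<Rightarrow> real"
  assumes E: "compact E" "convex E" and r: "r \<noteq> 0" "\<And>w w'. w \<in> E \<Longrightarrow> w' \<in> E \<Longrightarrow> \<exists>t. w' - w = t *\<^sub>R r"
    and \<xi>: "linear \<xi>" "\<bar>\<xi> r\<bar> = 1"
  shows "diameter E / norm r = measure lebesgue (\<xi> ` E)"
proof (cases "E = {}")
  case False
  have dist: "dist w w' = norm r * \<bar>\<xi> w - \<xi> w'\<bar>" if ww': "w \<in> E" "w' \<in> E" for w w'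
  proof -
    obtain t where t: "w - w' = t *\<^sub>R r"
      using r(2)[OF ww'(2,1)] by blast
    then have "\<xi> w - \<xi> w' = t * \<xi> r"
      using \<xi>(1) by (simp add: linear_diff[symmetric] linear_scale)
    then show ?thesis
      using \<xi>(2) t by (simp add: dist_norm abs_mult)
  qed
  have "continuous_on E \<xi>"
    using \<xi>(1) by (simp add: linear_continuous_on linear_linear)
  obtain w1 where w1: "w1 \<in> E" "\<forall>w\<in>E. \<xi> w1 \<le> \<xi> w"
    using continuous_attains_inf[OF E(1) False \<open>continuous_on E \<xi>\<close>] by blast
  obtain w2 where w2: "w2 \<in> E" "\<forall>w\<in>E. \<xi> w \<le> \<xi> w2"
    using continuous_attains_sup[OF E(1) False \<open>continuous_on E \<xi>\<close>] by blast
  have "\<xi> ` E = {\<xi> w1..\<xi> w2}"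
  proof
    have "convex (\<xi> ` E)"
      using \<xi>(1) E(2) by (rule convex_linear_image)
    then show "{\<xi> w1..\<xi> w2} \<subseteq> \<xi> ` E"
      using w1(1) w2(1) unfolding is_interval_convex_1[symmetric] by (auto intro: mem_is_interval_1_I)
  qed (use w1 w2 in auto)
  moreover have "\<xi> w1 \<le> \<xi> w2"
    using w1 w2 by blast
  moreover have "diameter E = norm r * (\<xi> w2 - \<xi> w1)"
  proof (rule antisym)
    show "diameter E \<le> norm r * (\<xi> w2 - \<xi> w1)"
    proof (rule diameter_le)
      show "E \<noteq> {} \<or> 0 \<le> norm r * (\<xi> w2 - \<xi> w1)"
        using False by simp
      fix x y assume xy: "x \<in> E" "y \<in> E"
      then have "\<bar>\<xi> x - \<xi> y\<bar> \<le> \<xi> w2 - \<xi> w1"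
        using w1(2) w2(2) by (auto simp: abs_le_iff) (smt (verit))+
      then show "norm (x - y) \<le> norm r * (\<xi> w2 - \<xi> w1)"
        using dist[OF xy] by (simp add: dist_norm mult_left_mono)
    qed
    have "norm r * (\<xi> w2 - \<xi> w1) = dist w2 w1"
      using dist[OF w2(1) w1(1)] \<open>\<xi> w1 \<le> \<xi> w2\<close> by simp
    also have "\<dots> \<le> diameter E"
      using E(1) w1(1) w2(1) by (intro diameter_bounded_bound compact_imp_bounded)
    finally show "norm r * (\<xi> w2 - \<xi> w1) \<le> diameter E" .
  qed
  ultimately show ?thesis
    using r(1) by simp
qed simp

lemma interior_strict:
  fixes z \<eta> :: "real \<times> real"
  assumes "z \<in> interior C" "\<eta> \<noteq> 0" "\<And>x. x \<in> C \<Longrightarrow> \<eta> \<bullet> x \<le> c"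
  shows "\<eta> \<bullet> z < c"
proof -
  obtain e where e: "0 < e" "ball z e \<subseteq> C"
    using assms(1) mem_interior by blast
  have "z + (e / 2 / norm \<eta>) *\<^sub>R \<eta> \<in> ball z e"
    using e(1) assms(2) by (simp add: dist_norm)
  then have "\<eta> \<bullet> (z + (e / 2 / norm \<eta>) *\<^sub>R \<eta>) \<le> c"
    using e(2) assms(3) by blast
  then have "\<eta> \<bullet> z + e / 2 / norm \<eta> * (\<eta> \<bullet> \<eta>) \<le> c"
    by (simp only: inner_add_right inner_scaleR_right)
  moreover have "0 < e / 2 / norm \<eta> * (\<eta> \<bullet> \<eta>)"
    using e(1) assms(2) by (intro mult_pos_pos divide_pos_pos) simp_all
  ultimately show ?thesis
    by linarith
qed

lemma mem_shape_points:
  "p \<in> shape_points Triangle_42 \<longleftrightarrow> 0 \<le> fst p \<and> 0 \<le> snd p \<and> fst p + 2 * snd p \<le> 4"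
  "p \<in> shape_points Square \<longleftrightarrow> 0 \<le> fst p \<and> fst p \<le> 2 \<and> 0 \<le> snd p \<and> snd p \<le> 2"
  "p \<in> shape_points Triangle_33 \<longleftrightarrow> 0 \<le> fst p \<and> 0 \<le> snd p \<and> fst p + snd p \<le> 3"
  by (cases p; simp only: shape_points_iff fst_conv snd_conv)+

lemma shape_points_boundary:
  assumes "p \<in> shape_points \<sigma>" "p \<noteq> (1,1)"
  shows "(fst p - 1, snd p - 1) \<in> set (boundary \<sigma>)"
proof -
  have *: "\<forall>i\<in>set [0..4]. \<forall>j\<in>set [0..3]. (i, j) \<noteq> (1,1) \<longrightarrow>
     ((i + 2 * j \<le> 4 \<longrightarrow> (i - 1, j - 1) \<in> set (boundary Triangle_42)) \<and>
      (i \<le> 2 \<and> j \<le> 2 \<longrightarrow> (i - 1, j - 1) \<in> set (boundary Square)) \<and>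
      (i + j \<le> 3 \<longrightarrow> (i - 1, j - 1) \<in> set (boundary Triangle_33)))"
    by code_simp
  obtain i j where p: "p = (i, j)"
    by (cases p)
  have "i \<in> set [0..4] \<and> j \<in> set [0..3]"
    using assms(1) unfolding p by (cases \<sigma>) (auto simp: shape_points_iff simp del: shape_points.simps)
  with * assms show ?thesis
    unfolding p by (cases \<sigma>) (auto simp: shape_points_iff simp del: shape_points.simps)
qed

locale marked_normal_form =
  fixes A :: "lpt set" and \<omega> :: lpt and \<sigma> :: shape and \<phi> :: "lpt \<Rightarrow> lpt" and a b c d r s :: int
  assumes fin: "finite A" and int: "interior_lattice_points (convex hull (pt ` A)) = {\<omega>}"
    and unim: "\<bar>a * d - b * c\<bar> = 1" and \<phi>: "\<And>i j. \<phi> (i, j) = (a * i + b * j + r, c * i + d * j + s)"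
    and shape: "\<phi> ` A \<subseteq> shape_points \<sigma>"
begin

lemma \<omega>_interior: "pt \<omega> \<in> interior (convex hull (pt ` A))"
  using int by (auto simp: interior_lattice_points_def)

lemma \<phi>_eq: "\<phi> p = (a * fst p + b * snd p + r, c * fst p + d * snd p + s)"
  by (cases p) (simp add: \<phi>)

lemma unim_cases: "a * d - b * c = 1 \<or> a * d - b * c = - 1"
  using unim by linarith

text \<open>An interior point satisfies the inequalities of the shape strictly, and
  \<open>(1,1)\<close> is the only lattice point that does.\<close>

lemma \<phi>_\<omega>: "\<phi> \<omega> = (1,1)"
proof -
  have strict: "\<alpha> * fst (\<phi> \<omega>) + \<beta> * snd (\<phi> \<omega>) < m"
    if "(\<alpha>, \<beta>) \<noteq> (0,0)" "\<And>p. p \<in> A \<Longrightarrow> \<alpha> * fst (\<phi> p) + \<beta> * snd (\<phi> p) \<le> m" for \<alpha> \<beta> m :: int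
  proof -
    define \<eta> where "\<eta> = (real_of_int (\<alpha> * a + \<beta> * c), real_of_int (\<alpha> * b + \<beta> * d))"
    have \<eta>: "\<eta> \<bullet> pt p = real_of_int (\<alpha> * fst (\<phi> p) + \<beta> * snd (\<phi> p)) - of_int (\<alpha> * r + \<beta> * s)" for p
      by (simp add: \<eta>_def pt_def \<phi>_eq algebra_simps)
    have "\<eta> \<noteq> 0"
    proof
      assume "\<eta> = 0"
      then have 0: "\<alpha> * a + \<beta> * c = 0" "\<alpha> * b + \<beta> * d = 0"
        by (simp_all add: \<eta>_def zero_prod_def del: of_int_add of_int_mult)
      have "\<alpha> * (a * d - b * c) = (\<alpha> * a + \<beta> * c) * d - (\<alpha> * b + \<beta> * d) * c"
        "\<beta> * (a * d - b * c) = (\<alpha> * b + \<beta> * d) * a - (\<alpha> * a + \<beta> * c) * b"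
        by (simp_all add: algebra_simps)
      with 0 unim_cases that(1) show False
        by auto
    qed
    moreover have "convex hull (pt ` A) \<subseteq> {x. \<eta> \<bullet> x \<le> real_of_int m - of_int (\<alpha> * r + \<beta> * s)}"
    proof (intro hull_minimal convex_halfspace_le subsetI)
      fix x assume "x \<in> pt ` A"
      then obtain p where p: "p \<in> A" "x = pt p"
        by blast
      show "x \<in> {x. \<eta> \<bullet> x \<le> real_of_int m - of_int (\<alpha> * r + \<beta> * s)}"
        using that(2)[OF p(1)] unfolding p(2) mem_Collect_eq \<eta> by (simp only: of_int_le_iff diff_right_mono)
    qed
    ultimately have "\<eta> \<bullet> pt \<omega> < real_of_int m - of_int (\<alpha> * r + \<beta> * s)"
      by (intro interior_strict[OF \<omega>_interior]) blast+
    then show ?thesis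
      unfolding \<eta> by linarith
  qed
  have sh: "\<phi> p \<in> shape_points \<sigma>" if "p \<in> A" for p
    using shape that by auto
  have nonneg: "0 \<le> fst (\<phi> p) \<and> 0 \<le> snd (\<phi> p)" if "p \<in> A" for p
    using sh[OF that] by (cases \<sigma>) (simp_all add: mem_shape_points del: shape_points.simps)
  have "1 \<le> fst (\<phi> \<omega>)" "1 \<le> snd (\<phi> \<omega>)"
    using strict[of "-1" 0 0] strict[of 0 "-1" 0] nonneg by simp_all
  moreover have "fst (\<phi> \<omega>) \<le> 1 \<and> snd (\<phi> \<omega>) \<le> 1"
  proof (cases \<sigma>)
    case Triangle_42
    have "fst (\<phi> \<omega>) + 2 * snd (\<phi> \<omega>) < 4"
      using strict[of 1 2 4] sh by (simp add: Triangle_42 mem_shape_points del: shape_points.simps)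
    with \<open>1 \<le> fst (\<phi> \<omega>)\<close> \<open>1 \<le> snd (\<phi> \<omega>)\<close> show ?thesis
      by linarith
  next
    case Square
    have "fst (\<phi> \<omega>) < 2" "snd (\<phi> \<omega>) < 2"
      using strict[of 1 0 2] strict[of 0 1 2] sh by (simp_all add: Square mem_shape_points del: shape_points.simps)
    then show ?thesis
      by linarith
  next
    case Triangle_33
    have "fst (\<phi> \<omega>) + snd (\<phi> \<omega>) < 3"
      using strict[of 1 1 3] sh by (simp add: Triangle_33 mem_shape_points del: shape_points.simps)
    with \<open>1 \<le> fst (\<phi> \<omega>)\<close> \<open>1 \<le> snd (\<phi> \<omega>)\<close> show ?thesis
      by linarith
  qed
  ultimately show ?thesis
    by (simp add: prod_eq_iff)
qed

lemma bij_\<phi>: "bij \<phi>"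
proof -
  define D where "D = a * d - b * c"
  have U: "unimod (a, b, c, d)"
    using unim by (simp add: unimod_def)
  note inv = lin_inverse[OF U D_def]
  have \<phi>_lin: "\<phi> p = (fst (lin (a, b, c, d) p) + r, snd (lin (a, b, c, d) p) + s)" for p
    by (simp add: \<phi>_eq lin_def)
  show ?thesis
  proof (rule o_bij)
    show "(\<lambda>q. lin (D * d, - D * b, - D * c, D * a) (fst q - r, snd q - s)) \<circ> \<phi> = id"
      by (rule ext) (simp only: o_apply \<phi>_lin fst_conv snd_conv add_diff_cancel_right' prod.collapse inv id_apply)
    show "\<phi> \<circ> (\<lambda>q. lin (D * d, - D * b, - D * c, D * a) (fst q - r, snd q - s)) = id"
      by (rule ext) (simp only: o_apply \<phi>_lin inv fst_conv snd_conv diff_add_cancel prod.collapse id_apply)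
  qed
qed

definition \<psi> :: "lpt \<Rightarrow> lpt" where "\<psi> = inv \<phi>"

lemma \<psi>_\<phi> [simp]: "\<psi> (\<phi> p) = p"
  using bij_\<phi> by (simp add: \<psi>_def bij_is_inj)

lemma inj_\<psi>: "inj \<psi>"
  using bij_\<phi> by (simp add: \<psi>_def bij_imp_bij_inv bij_is_inj)

lemma \<psi>_1: "\<psi> (1,1) = \<omega>"
  using \<psi>_\<phi>[of \<omega>] by (simp add: \<phi>_\<omega>)

definition ctr :: "lpt \<Rightarrow> lpt" where "ctr p = (fst (\<phi> p) - 1, snd (\<phi> p) - 1)"

definition X :: "lpt set" where "X = ctr ` (A - {\<omega>})"

definition height :: "(lpt \<Rightarrow> real) \<Rightarrow> lpt \<Rightarrow> real" where
  "height u q = u (\<psi> (fst q + 1, snd q + 1)) - u \<omega>"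

text \<open>The transpose of the linear part of \<open>\<phi>\<close> and its inverse.\<close>

definition dual_map :: "real \<times> real \<Rightarrow> real \<times> real" where
  "dual_map w = (of_int a * fst w + of_int c * snd w, of_int b * fst w + of_int d * snd w)"

definition dt :: real where "dt = real_of_int (a * d - b * c)"

definition dual_inv :: "real \<times> real \<Rightarrow> real \<times> real" where
  "dual_inv w = dt *\<^sub>R (of_int d * fst w - of_int c * snd w, of_int a * snd w - of_int b * fst w)"

lemma height_ctr [simp]: "height u (ctr p) = u p - u \<omega>"
  by (simp add: height_def ctr_def)

lemma ctr_eq: "ctr p = (a * (fst p - fst \<omega>) + b * (snd p - snd \<omega>), c * (fst p - fst \<omega>) + d * (snd p - snd \<omega>))"
  using \<phi>_\<omega> by (simp add: ctr_def \<phi>_eq algebra_simps)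

lemma pairing_ctr: "pairing (ctr p) w = (pt p - pt \<omega>) \<bullet> dual_map w"
  by (simp add: ctr_eq pairing_def pt_def dual_map_def algebra_simps)

lemma dt: "dt * dt = 1" "\<bar>dt\<bar> = 1"
  using unim_cases by (auto simp: dt_def simp del: of_int_diff of_int_mult)

lemma dual_map_inv: "dual_map (dual_inv w) = w" "dual_inv (dual_map w) = w"
proof -
  have "dual_map (dual_inv w) = (dt * dt) *\<^sub>R w" "dual_inv (dual_map w) = (dt * dt) *\<^sub>R w"
    by (simp_all add: dual_map_def dual_inv_def prod_eq_iff) (simp_all add: dt_def algebra_simps)
  with dt show "dual_map (dual_inv w) = w" "dual_inv (dual_map w) = w"
    by simp_all
qed

lemma linear_dual_inv: "linear dual_inv"
  by (intro linearI) (simp_all add: dual_inv_def algebra_simps)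

lemma X_boundary: "X \<subseteq> set (boundary \<sigma>)"
proof
  fix q assume "q \<in> X"
  then obtain p where p: "p \<in> A" "p \<noteq> \<omega>" "q = ctr p"
    by (auto simp: X_def)
  have "\<phi> p \<noteq> (1,1)"
    using p(2) \<psi>_\<phi>[of p] \<psi>_1 by metis
  then show "q \<in> set (boundary \<sigma>)"
    using shape_points_boundary[of "\<phi> p" \<sigma>] shape p by (auto simp: ctr_def)
qed

lemma inj_ctr: "inj ctr"
proof (rule injI)
  fix p q assume "ctr p = ctr q"
  then have "\<phi> p = \<phi> q"
    by (simp add: ctr_def prod_eq_iff)
  then show "p = q"
    using \<psi>_\<phi> by metis
qed

lemma mem_minimizers_\<omega>:
  assumes "\<omega> \<in> A"
  shows "\<omega> \<in> minimizers A u w \<longleftrightarrow> (\<forall>p\<in>A. u \<omega> \<le> u p + (pt p - pt \<omega>) \<bullet> w)"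
  using assms by (auto simp: minimizers_def trop_term_eq inner_diff_left algebra_simps)

text \<open>\<open>P\<close> is the region of the tropical plane where the term of
  \<open>\<omega>\<close> attains the minimum, in the coordinates dual to the normal form.\<close>

lemma feasible_iff:
  assumes "\<omega> \<in> A"
  shows "w \<in> feasible X (height u) \<longleftrightarrow> \<omega> \<in> minimizers A u (dual_map w)"
proof -
  have "w \<in> feasible X (height u) \<longleftrightarrow> (\<forall>p\<in>A - {\<omega>}. u \<omega> \<le> u p + (pt p - pt \<omega>) \<bullet> dual_map w)"
    unfolding feasible_def X_def mem_Collect_eq ball_simps pairing_ctr height_ctr by (auto simp: algebra_simps)
  also have "\<dots> \<longleftrightarrow> (\<forall>p\<in>A. u \<omega> \<le> u p + (pt p - pt \<omega>) \<bullet> dual_map w)"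
    by auto
  finally show ?thesis
    by (simp add: mem_minimizers_\<omega>[OF assms])
qed

lemma tight_iff:
  assumes "\<omega> \<in> A" "p \<in> A"
  shows "w \<in> tight X (height u) (ctr p) \<longleftrightarrow> \<omega> \<in> minimizers A u (dual_map w) \<and> p \<in> minimizers A u (dual_map w)"
proof -
  have "w \<in> tight X (height u) (ctr p) \<longleftrightarrow>
      \<omega> \<in> minimizers A u (dual_map w) \<and> u p + (pt p - pt \<omega>) \<bullet> dual_map w = u \<omega>"
    unfolding tight_def mem_Collect_eq feasible_iff[OF assms(1)] pairing_ctr height_ctr by (auto simp: algebra_simps)
  also have "\<dots> \<longleftrightarrow> \<omega> \<in> minimizers A u (dual_map w) \<and> trop_term u p (dual_map w) = trop_term u \<omega> (dual_map w)"
    by (auto simp: trop_term_eq inner_diff_left algebra_simps)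
  also have "\<dots> \<longleftrightarrow> \<omega> \<in> minimizers A u (dual_map w) \<and> p \<in> minimizers A u (dual_map w)"
    using assms trop_fun_minimizer[OF fin] trop_fun_eq_iff[OF fin assms(2)] by metis
  finally show ?thesis .
qed

lemma dual_image: "{w. P (dual_map w)} = dual_inv ` {w. P w}"
  by (auto simp: dual_map_inv intro!: image_eqI[where x = "dual_map _"])

lemma compact_feasible:
  assumes "\<omega> \<in> A"
  shows "compact (feasible X (height u))"
proof -
  have "feasible X (height u) = dual_inv ` {w. \<forall>p\<in>A. u \<omega> \<le> u p + (pt p - pt \<omega>) \<bullet> w}"
    unfolding dual_image[symmetric] using feasible_iff[OF assms] mem_minimizers_\<omega>[OF assms] by auto
  then show ?thesis
    using compact_superlevel[OF fin \<omega>_interior]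
    by (simp add: compact_continuous_image linear_continuous_on linear_dual_inv linear_linear)
qed

text \<open>The direction vector of the dual edge, carried over by \<open>dual_inv\<close>, pairs
  with the direction of the side to \<open>det2 (ctr p) dd = 1\<close> up to sign. So the projection
  measures exactly the lattice length.\<close>

lemma lattice_length_eq:
  assumes "\<omega> \<in> A" and p: "p \<in> A - {\<omega>}" and side: "sd \<in> set (frame \<sigma>)" "on_side sd (ctr p)"
  shows "lattice_length A u \<omega> p = measure lebesgue (pairing (fst (snd sd)) ` tight X (height u) (ctr p))"
proof -
  define dd where "dd = fst (snd sd)"
  define \<xi> where "\<xi> = pairing dd \<circ> dual_inv"
  define rr where "rr = direction_vector \<omega> p"
  have det: "det2 (ctr p) dd = 1"
    using side by (auto simp: on_side_def dd_def case_prod_beta)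
  let ?E = "dual_edge A u \<omega> p"
  have E: "?E = dual_map ` tight X (height u) (ctr p)"
  proof -
    have "tight X (height u) (ctr p) = {w. dual_map w \<in> ?E}"
      using tight_iff[OF assms(1), of p] p dual_edge_eq[OF fin assms(1), of p] by auto
    then show ?thesis
      by (auto simp: dual_map_inv intro!: image_eqI[where x = "dual_inv _"])
  qed
  have lin_map: "linear dual_map"
    by (intro linearI) (simp_all add: dual_map_def algebra_simps)
  have "compact ?E" "convex ?E"
    unfolding E using compact_tight[OF compact_feasible[OF assms(1)]] convex_tight lin_map
    by (simp_all add: compact_continuous_image linear_continuous_on linear_linear convex_linear_image)
  moreover have "rr \<noteq> 0"
    using p by (auto simp: rr_def direction_vector_def zero_prod_def prod_eq_iff)
  moreover have "\<exists>t. w' - w = t *\<^sub>R rr" if "w \<in> ?E" "w' \<in> ?E" for w w'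
  proof -
    have "trop_term u p w = trop_term u \<omega> w" "trop_term u p w' = trop_term u \<omega> w'"
      using that by (auto simp: dual_edge_def)
    then have "(pt p - pt \<omega>) \<bullet> (w' - w) = 0"
      by (simp add: trop_term_eq inner_diff_left inner_diff_right)
    moreover have "(pt p - pt \<omega>) \<bullet> rr = 0"
      by (simp add: rr_def direction_vector_def pt_def algebra_simps)
    moreover have "pt p - pt \<omega> \<noteq> 0"
      using p by auto
    ultimately show ?thesis
      using orthogonal_parallel[of "pt p - pt \<omega>" rr "w' - w"] \<open>rr \<noteq> 0\<close> by (metis inner_commute)
  qed
  moreover have "linear \<xi>"
    unfolding \<xi>_def by (intro linear_compose linear_dual_inv pairing_linear)
  moreover have "\<bar>\<xi> rr\<bar> = 1"
  proof -
    have "\<xi> rr = - dt * of_int (det2 (ctr p) dd)"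
      unfolding \<xi>_def o_apply dual_inv_def pairing_scaleR
      by (simp add: rr_def direction_vector_def pairing_def ctr_eq det2_def algebra_simps)
    then show ?thesis
      using dt det by simp
  qed
  ultimately have "diameter ?E / norm rr = measure lebesgue (\<xi> ` ?E)"
    by (intro segment_length) auto
  also have "\<xi> ` ?E = pairing dd ` tight X (height u) (ctr p)"
    unfolding E \<xi>_def image_comp by (simp add: dual_map_inv comp_def)
  finally show ?thesis
    by (simp add: lattice_length_def rr_def dd_def)
qed

lemma strict_point:
  assumes "determines_cycle A u \<omega>"
  obtains w0 where "\<And>q. q \<in> X \<Longrightarrow> 0 < height u q + pairing q w0"
proof -
  obtain w where w: "\<forall>p\<in>A - {\<omega>}. trop_term u \<omega> w < trop_term u p w"
    using strict_minimizer_if_cycle(2)[OF fin \<omega>_interior assms] by blast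
  have "0 < height u q + pairing q (dual_inv w)" if "q \<in> X" for q
    using that w by (auto simp: X_def pairing_ctr dual_map_inv trop_term_eq inner_diff_left algebra_simps)
  with that show thesis .
qed

lemma finite_X: "finite X"
  using fin by (simp add: X_def)

definition corner_minimizers :: "(lpt \<Rightarrow> real) \<Rightarrow> (real \<times> real) list \<Rightarrow> bool" where
  "corner_minimizers u ws \<longleftrightarrow> length ws = length (frame \<sigma>) \<and> (\<forall>i<length (frame \<sigma>).
     lexmin (feasible X (height u)) (fst (frame \<sigma> ! i)) (fst (snd (frame \<sigma> ! i))) (ws ! i))"

lemma corner_minimizersD:
  assumes "corner_minimizers u ws"
  shows "length ws = length (frame \<sigma>)" "w \<in> set ws \<Longrightarrow> w \<in> feasible X (height u)"
  using assms by (auto simp: corner_minimizers_def in_set_conv_nth lexmin_def)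

lemma corner_minimizers_exist:
  assumes "determines_cycle A u \<omega>"
  obtains ws where "corner_minimizers u ws"
proof -
  have "\<omega> \<in> A"
    using strict_minimizer_if_cycle(1)[OF fin \<omega>_interior assms] .
  obtain w0 where "\<And>q. q \<in> X \<Longrightarrow> 0 < height u q + pairing q w0"
    using strict_point[OF assms] by blast
  then have "w0 \<in> feasible X (height u)"
    unfolding feasible_def by (blast intro: less_imp_le)
  then have "feasible X (height u) \<noteq> {}"
    by blast
  then have "\<exists>w. lexmin (feasible X (height u)) v d' w" for v d'
    using lexmin_exists[OF compact_feasible[OF \<open>\<omega> \<in> A\<close>]] by metis
  then obtain W where "\<And>v d'. lexmin (feasible X (height u)) v d' (W v d')"
    by metis
  then have "corner_minimizers u (map (\<lambda>s. W (fst s) (fst (snd s))) (frame \<sigma>))"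
    by (simp add: corner_minimizers_def)
  with that show thesis .
qed

lemma j_trop_eq_excess:
  assumes cyc: "determines_cycle A u \<omega>" and ws: "corner_minimizers u ws"
  shows "j_trop A u = excess \<sigma> ws"
proof -
  have "\<omega> \<in> A"
    using strict_minimizer_if_cycle(1)[OF fin \<omega>_interior cyc] .
  have "j_trop A u = (\<Sum>p\<in>A - {\<omega>}. lattice_length A u \<omega> p)"
    by (rule j_trop_eq_sum[OF fin int cyc])
  also have "\<dots> = (\<Sum>q\<in>X. lattice_length A u \<omega> (inv ctr q))"
    unfolding X_def using inj_ctr by (subst sum.reindex) (auto intro: inj_on_subset)
  also have "\<dots> = excess \<sigma> ws"
  proof (rule perimeter[OF X_boundary compact_feasible[OF \<open>\<omega> \<in> A\<close>]])
    show "lattice_length A u \<omega> (inv ctr q) = measure lebesgue (pairing (fst (snd s)) ` tight X (height u) q)"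
      if "q \<in> X" "s \<in> set (frame \<sigma>)" "on_side s q" for q s
    proof -
      obtain p where p: "p \<in> A - {\<omega>}" "q = ctr p"
        using \<open>q \<in> X\<close> by (auto simp: X_def)
      with lattice_length_eq[OF \<open>\<omega> \<in> A\<close> p(1) that(2), of u] that(3) inj_ctr show ?thesis
        by simp
    qed
  qed (use ws in \<open>auto simp: corner_minimizers_def\<close>)
  finally show ?thesis .
qed

section \<open>The generic discriminant and its leading monomial\<close>

abbreviation coeffs :: "lpt \<Rightarrow> coeff_poly" where "coeffs \<equiv> generic_coeff A \<phi>"

abbreviation disc :: coeff_poly where "disc \<equiv> weier_disc (shape_weier \<sigma> coeffs)"

abbreviation numerator :: coeff_poly where "numerator \<equiv> weier_c4 (shape_weier \<sigma> coeffs) ^ 3"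

lemma coeffs_eq: "coeffs q = (if q \<in> \<phi> ` A then coeff_var (\<psi> q) else 0)"
proof (cases "q \<in> \<phi> ` A")
  case True
  then obtain p where p: "p \<in> A" "q = \<phi> p"
    by blast
  then have "{p' \<in> A. \<phi> p' = q} = {p}"
    by (auto simp: inj_eq[OF bij_is_inj[OF bij_\<phi>]])
  with p show ?thesis
    by (auto simp: generic_coeff_def)
next
  case False
  then have empty: "{p \<in> A. \<phi> p = q} = {}"
    by blast
  show ?thesis
    unfolding generic_coeff_def empty using False by simp
qed

lemma positive_bound:
  fixes g :: "'a \<Rightarrow> real"
  assumes "finite F" "\<And>x. x \<in> F \<Longrightarrow> 0 < g x"
  obtains \<epsilon> where "0 < \<epsilon>" "\<And>x. x \<in> F \<Longrightarrow> \<epsilon> \<le> g x"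
proof -
  have "0 < Min (insert 1 (g ` F))" "\<And>x. x \<in> F \<Longrightarrow> Min (insert 1 (g ` F)) \<le> g x"
    using assms by auto
  with that show thesis
    by blast
qed

lemma disc_facts:
  assumes cyc: "determines_cycle A u \<omega>" and len: "length ws = length (frame \<sigma>)"
    and ws: "\<And>w. w \<in> set ws \<Longrightarrow> w \<in> feasible X (height u)"
  shows "disc \<in> heavy A u (12 * u \<omega> + excess \<sigma> ws)"
    and "\<exists>\<epsilon>>0. numerator - coeff_var \<omega> ^ 12 \<in> heavy A u (12 * u \<omega> + \<epsilon>)"
    and "set n \<subseteq> \<phi> ` A \<Longrightarrow> (1,1) \<notin> set n \<Longrightarrow> length n \<le> 12 \<Longrightarrow>
      weight A u (expo \<psi> (n @ replicate (12 - length n) (1,1))) = 12 * u \<omega> + excess \<sigma> ws \<Longrightarrow>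
      Poly_Mapping.lookup disc (expo \<psi> (n @ replicate (12 - length n) (1,1))) = disc_coeff \<sigma> n"
proof -
  have "\<omega> \<in> A"
    using strict_minimizer_if_cycle(1)[OF fin \<omega>_interior cyc] .
  then have S: "(1,1) \<in> \<phi> ` A" "\<psi> ` \<phi> ` A \<subseteq> A"
    using imageI[of \<omega> A \<phi>] by (auto simp: \<phi>_\<omega>)
  obtain w0 where w0: "\<And>q. q \<in> X \<Longrightarrow> 0 < height u q + pairing q w0"
    using strict_point[OF cyc] by blast
  obtain \<epsilon> where \<epsilon>: "0 < \<epsilon>" "\<And>q. q \<in> X \<Longrightarrow> \<epsilon> \<le> height u q + pairing q w0"
    using positive_bound[OF finite_X, of "\<lambda>q. height u q + pairing q w0"] w0 by blast
  have mem_X: "(fst q - 1, snd q - 1) \<in> X" if "q \<in> \<phi> ` A - {(1,1)}" for q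
  proof -
    from that obtain p where p: "p \<in> A" "q = \<phi> p" "\<phi> p \<noteq> (1,1)"
      by blast
    with \<phi>_\<omega> have "p \<in> A - {\<omega>}"
      by auto
    then show ?thesis
      unfolding X_def p(2) ctr_def by blast
  qed
  have height: "height u (fst q - 1, snd q - 1) = u (\<psi> q) - u \<omega>" for q
    by (simp add: height_def)
  have ws': "u (\<psi> (1,1)) - pairing (fst q - 1, snd q - 1) w \<le> u (\<psi> q)" if "q \<in> \<phi> ` A" "w \<in> set ws" for q w
  proof (cases "q = (1,1)")
    case False
    then show ?thesis
      using ws[OF that(2)] mem_X[of q] that(1) height[of q] by (auto simp: feasible_def \<psi>_1 dest!: bspec)
  qed (simp add: pairing_def)
  have w0': "u (\<psi> (1,1)) - pairing (fst q - 1, snd q - 1) w0 + \<epsilon> \<le> u (\<psi> q)" if "q \<in> \<phi> ` A - {(1,1)}" for q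
    using \<epsilon>(2)[OF mem_X[OF that]] height[of q] by (simp add: \<psi>_1)
  note main = lookup_disc[OF fin inj_\<psi> coeffs_eq S(2) _ S(1) _ _ len \<epsilon>(1) ws' w0']
  show "disc \<in> heavy A u (12 * u \<omega> + excess \<sigma> ws)"
    using main(1)[of "[]"] by (simp add: \<psi>_1)
  have "numerator - coeff_var \<omega> ^ 12 \<in> heavy A u (12 * u \<omega> + \<epsilon>)"
  proof -
    have "coeffs (1,1) = coeff_var \<omega>"
      using S(1) unfolding coeffs_eq \<psi>_1 by simp
    then show ?thesis
      using main(3)[of "[]"] by (simp add: \<psi>_1)
  qed
  with \<epsilon>(1) show "\<exists>\<epsilon>>0. numerator - coeff_var \<omega> ^ 12 \<in> heavy A u (12 * u \<omega> + \<epsilon>)"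
    by blast
  show "Poly_Mapping.lookup disc (expo \<psi> (n @ replicate (12 - length n) (1,1))) = disc_coeff \<sigma> n"
    if "set n \<subseteq> \<phi> ` A" "(1,1) \<notin> set n" "length n \<le> 12"
      "weight A u (expo \<psi> (n @ replicate (12 - length n) (1,1))) = 12 * u \<omega> + excess \<sigma> ws"
    using main(2)[OF that(1-3)] that(4) by (simp add: \<psi>_1)
qed

text \<open>The monomial is determined by the normal cones at the corner minimizers, that is, by
  marked points of the cells dual to them. A vector \<open>u'\<close> with the same subdivision has
  vertices with the same minimizing terms, so the lower bound is attained by the same
  monomial.\<close>

theorem leading_term:
  assumes cyc: "determines_cycle A u \<omega>"
  obtains M where "\<bar>Poly_Mapping.lookup disc M\<bar> = 1"
    "weight A u M = 12 * u \<omega> + j_trop A u"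
    "\<And>u' e. marked_subdivision A u' = marked_subdivision A u \<Longrightarrow> e \<in> Poly_Mapping.keys disc \<Longrightarrow>
       weight A u' M \<le> weight A u' e"
proof -
  have "\<omega> \<in> A"
    using strict_minimizer_if_cycle(1)[OF fin \<omega>_interior cyc] .
  obtain w0 where w0: "\<And>q. q \<in> X \<Longrightarrow> 0 < height u q + pairing q w0"
    using strict_point[OF cyc] by blast
  obtain ws where ws: "corner_minimizers u ws"
    using corner_minimizers_exist[OF cyc] .
  let ?K = "length (frame \<sigma>)"
  have lex: "length ws = ?K" "\<And>i. i < ?K \<Longrightarrow>
      lexmin (feasible X (height u)) (fst (frame \<sigma> ! i)) (fst (snd (frame \<sigma> ! i))) (ws ! i)"
    using ws by (auto simp: corner_minimizers_def)
  obtain n ps where n: "(\<lambda>q. (fst q - 1, snd q - 1)) ` set n \<subseteq> X" "length n \<le> 12" "\<bar>disc_coeff \<sigma> n\<bar> = 1"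
    and ps: "length ps = ?K" "\<And>i. i < ?K \<Longrightarrow> extreme_pair X (height u) (ws ! i) (ps ! i)"
    and sum: "\<And>h' ws'. length ws' = ?K \<Longrightarrow>
      (\<And>i q. i < ?K \<Longrightarrow> q = fst (ps ! i) \<or> q = snd (ps ! i) \<Longrightarrow> h' q + pairing q (ws' ! i) = 0) \<Longrightarrow>
      (\<Sum>q\<leftarrow>n. h' (fst q - 1, snd q - 1)) = excess \<sigma> ws'"
    by (rule leading_monomial_exists[OF X_boundary lex w0]) (assumption | rule that | simp)+
  define M where "M = expo \<psi> (n @ replicate (12 - length n) (1,1))"
  have n_A: "set n \<subseteq> \<phi> ` A" "(1,1) \<notin> set n"
  proof -
    have "q \<in> \<phi> ` (A - {\<omega>})" if "q \<in> set n" for q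
    proof -
      have "(fst q - 1, snd q - 1) \<in> X"
        using n(1) that by blast
      then obtain p where p: "p \<in> A - {\<omega>}" "(fst q - 1, snd q - 1) = ctr p"
        by (auto simp: X_def)
      then have "q = \<phi> p"
        by (simp add: ctr_def prod_eq_iff)
      with p(1) show ?thesis
        by blast
    qed
    moreover have "(1,1) \<notin> \<phi> ` (A - {\<omega>})"
      using \<psi>_\<phi> \<psi>_1 by (metis DiffD2 imageE singletonI)
    ultimately show "set n \<subseteq> \<phi> ` A" "(1,1) \<notin> set n"
      by blast+
  qed
  have weight: "weight A u' M = 12 * u' \<omega> + excess \<sigma> ws'"
    if "length ws' = ?K" "\<And>i q. i < ?K \<Longrightarrow> q = fst (ps ! i) \<or> q = snd (ps ! i) \<Longrightarrow> height u' q + pairing q (ws' ! i) = 0"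
    for u' ws'
  proof -
    have "weight A u' M = (\<Sum>q\<leftarrow>n @ replicate (12 - length n) (1,1). u' (\<psi> q))"
      unfolding M_def using n_A(1) \<open>\<omega> \<in> A\<close> by (intro weight_expo fin) (auto simp: \<psi>_1)
    also have "\<dots> = (\<Sum>q\<leftarrow>n. u' (\<psi> q)) + (12 - real (length n)) * u' \<omega>"
      using n(2) by (simp add: \<psi>_1 sum_list_replicate of_nat_diff)
    also have "(\<Sum>q\<leftarrow>n. u' (\<psi> q)) = (\<Sum>q\<leftarrow>n. height u' (fst q - 1, snd q - 1)) + real (length n) * u' \<omega>"
    proof -
      have "(\<Sum>q\<leftarrow>xs. u' (\<psi> q)) = (\<Sum>q\<leftarrow>xs. height u' (fst q - 1, snd q - 1)) + real (length xs) * u' \<omega>" for xs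
        by (induction xs) (simp_all add: height_def algebra_simps)
      then show ?thesis .
    qed
    also have "(\<Sum>q\<leftarrow>n. height u' (fst q - 1, snd q - 1)) = excess \<sigma> ws'"
      using that by (rule sum)
    finally show ?thesis
      by (simp add: algebra_simps)
  qed
  have tight: "fst (ps ! i) \<in> X" "snd (ps ! i) \<in> X" "ws ! i \<in> tight X (height u) (fst (ps ! i))"
      "ws ! i \<in> tight X (height u) (snd (ps ! i))" "0 < det2 (fst (ps ! i)) (snd (ps ! i))" if "i < ?K" for i
    using ps(2)[OF that] by (auto simp: extreme_pair_def)
  have wM: "weight A u M = 12 * u \<omega> + excess \<sigma> ws"
    using tight by (intro weight lex(1)) (auto simp: tight_def)
  show thesis
  proof
    have "w \<in> feasible X (height u)" if "w \<in> set ws" for w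
      using that lex by (auto simp: in_set_conv_nth lexmin_def)
    then show "\<bar>Poly_Mapping.lookup disc M\<bar> = 1"
      using disc_facts(3)[OF cyc lex(1) _ n_A n(2) wM[unfolded M_def]] n(3) by (simp add: M_def)
    show "weight A u M = 12 * u \<omega> + j_trop A u"
      using wM j_trop_eq_excess[OF cyc ws] by simp
    show "weight A u' M \<le> weight A u' e"
      if ms: "marked_subdivision A u' = marked_subdivision A u" and e: "e \<in> Poly_Mapping.keys disc" for u' e
    proof -
      have cyc': "determines_cycle A u' \<omega>"
        using cyc by (simp add: determines_cycle_def ms)
      have "\<exists>w'. minimizers A u' w' = minimizers A u (dual_map (ws ! i))" if i: "i < ?K" for i
      proof -
        let ?m = "minimizers A u (dual_map (ws ! i))"
        obtain p q where pq: "p \<in> A - {\<omega>}" "fst (ps ! i) = ctr p" "q \<in> A - {\<omega>}" "snd (ps ! i) = ctr q"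
          using tight(1,2)[OF i] by (auto simp: X_def)
        have m: "\<omega> \<in> ?m" "p \<in> ?m" "q \<in> ?m"
          using tight(3,4)[OF i] pq tight_iff[OF \<open>\<omega> \<in> A\<close>] by auto
        \<comment> \<open>The cell contains \<open>\<omega>\<close> and two marked points in
          independent directions, so it is a polygon of the subdivision for \<open>u\<close>, and
          hence for \<open>u'\<close>.\<close>
        have "interior (convex hull (pt ` ?m)) \<noteq> {}"
        proof
          assume "interior (convex hull (pt ` ?m)) = {}"
          then obtain \<eta> \<beta> where \<eta>: "\<eta> \<noteq> 0" "convex hull (pt ` ?m) \<subseteq> {x. \<eta> \<bullet> x = \<beta>}"
            using empty_interior_subset_hyperplane[OF convex_convex_hull] by metis
          have "\<eta> \<bullet> pt x = \<beta>" if "x \<in> ?m" for x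
            using \<eta>(2) hull_inc[of "pt x" "pt ` ?m" convex] that by auto
          then have "(pt p - pt \<omega>) \<bullet> \<eta> = 0" "(pt q - pt \<omega>) \<bullet> \<eta> = 0"
            using m by (simp_all add: inner_commute[of _ \<eta>] inner_diff_right)
          then have 0: "pairing (ctr p) (dual_inv \<eta>) = 0" "pairing (ctr q) (dual_inv \<eta>) = 0"
            by (simp_all add: pairing_ctr dual_map_inv)
          define z where "z = dual_inv \<eta>"
          have "of_int (det2 (ctr p) (ctr q)) * fst z = of_int (snd (ctr q)) * pairing (ctr p) z - of_int (snd (ctr p)) * pairing (ctr q) z"
            "of_int (det2 (ctr p) (ctr q)) * snd z = of_int (fst (ctr p)) * pairing (ctr q) z - of_int (fst (ctr q)) * pairing (ctr p) z"
            by (simp_all add: det2_def pairing_def algebra_simps)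
          then have "z = 0"
            using 0 tight(5)[OF i] pq by (simp add: z_def[symmetric] prod_eq_iff)
          then have "\<eta> = 0"
            using dual_map_inv(1)[of \<eta>] by (simp add: z_def dual_map_def zero_prod_def)
          with \<eta>(1) show False ..
        qed
        then have "(convex hull (pt ` ?m), ?m) \<in> marked_subdivision A u'"
          unfolding ms unfolding marked_subdivision_eq[OF fin] by blast
        then obtain w' where "(convex hull (pt ` ?m), ?m) = (convex hull (pt ` minimizers A u' w'), minimizers A u' w')"
          unfolding marked_subdivision_eq[OF fin] by blast
        then show ?thesis
          by blast
      qed
      then obtain W where W: "\<And>i. i < ?K \<Longrightarrow> minimizers A u' (W i) = minimizers A u (dual_map (ws ! i))"
        by metis
      define ws' where "ws' = map (\<lambda>i. dual_inv (W i)) [0..<?K]"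
      have len': "length ws' = ?K"
        by (simp add: ws'_def)
      have ws'_nth: "dual_map (ws' ! i) = W i" if "i < ?K" for i
        using that by (simp add: ws'_def dual_map_inv)
      have t': "ws' ! i \<in> tight X (height u') q" if "i < ?K" "q = fst (ps ! i) \<or> q = snd (ps ! i)" for i q
      proof -
        have "q \<in> X" "ws ! i \<in> tight X (height u) q"
          using that tight by auto
        then obtain p where "p \<in> A" "q = ctr p" "ws ! i \<in> tight X (height u) (ctr p)"
          by (auto simp: X_def)
        then show ?thesis
          using tight_iff[OF \<open>\<omega> \<in> A\<close>] W[OF that(1)] ws'_nth[OF that(1)] by simp
      qed
      have "weight A u' M = 12 * u' \<omega> + excess \<sigma> ws'"
        using t' by (intro weight len') (simp add: tight_def)
      moreover have "w \<in> feasible X (height u')" if "w \<in> set ws'" for w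
      proof -
        obtain i where "i < ?K" "w = ws' ! i"
          using \<open>w \<in> set ws'\<close> len' by (metis in_set_conv_nth)
        then show ?thesis
          using t'[of i "fst (ps ! i)"] by (simp add: tight_def)
      qed
      then have "disc \<in> heavy A u' (12 * u' \<omega> + excess \<sigma> ws')"
        by (rule disc_facts(1)[OF cyc' len'])
      ultimately show ?thesis
        using e by (auto simp: heavy_def)
    qed
  qed
qed

lemma keys_disc:
  assumes "determines_cycle A u \<omega>" "e \<in> Poly_Mapping.keys disc"
  shows "Poly_Mapping.keys e \<subseteq> A"
proof -
  obtain ws where ws: "corner_minimizers u ws"
    using corner_minimizers_exist[OF assms(1)] .
  then have "disc \<in> heavy A u (12 * u \<omega> + excess \<sigma> ws)"
    by (intro disc_facts(1)[OF assms(1)] corner_minimizersD)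
  with assms(2) show ?thesis
    by (auto simp: heavy_def)
qed

theorem numerator_leading_term:
  assumes cyc: "determines_cycle A u \<omega>"
  defines "M \<equiv> Poly_Mapping.single \<omega> 12"
  shows "Poly_Mapping.lookup numerator M = 1" "weight A u M = 12 * u \<omega>"
    "\<And>e. e \<in> Poly_Mapping.keys numerator \<Longrightarrow> e \<noteq> M \<Longrightarrow> Poly_Mapping.keys e \<subseteq> A \<and> weight A u M < weight A u e"
proof -
  have "\<omega> \<in> A"
    using strict_minimizer_if_cycle(1)[OF fin \<omega>_interior cyc] .
  then show wM: "weight A u M = 12 * u \<omega>"
    using weight_single[OF fin] by (simp add: M_def)
  obtain ws where ws: "corner_minimizers u ws"
    using corner_minimizers_exist[OF cyc] .
  then obtain \<epsilon> where \<epsilon>: "0 < \<epsilon>" "numerator - coeff_var \<omega> ^ 12 \<in> heavy A u (12 * u \<omega> + \<epsilon>)"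
    using disc_facts(2)[OF cyc corner_minimizersD[OF ws]] by blast
  define H where "H = numerator - coeff_var \<omega> ^ 12"
  have "coeff_var \<omega> ^ k = Poly_Mapping.single (Poly_Mapping.single \<omega> k) 1" for k
    by (induction k) (simp_all add: coeff_var_def mult_single single_add[symmetric])
  then have num: "numerator = H + Poly_Mapping.single M 1"
    by (simp add: H_def M_def)
  have heavy: "Poly_Mapping.keys e \<subseteq> A \<and> weight A u M < weight A u e" if "e \<in> Poly_Mapping.keys H" for e
    using \<epsilon> that unfolding H_def[symmetric] wM by (auto simp: heavy_def)
  then have "M \<notin> Poly_Mapping.keys H"
    by blast
  then show "Poly_Mapping.lookup numerator M = 1"
    unfolding num by (simp add: lookup_add in_keys_iff)
  show "Poly_Mapping.keys e \<subseteq> A \<and> weight A u M < weight A u e"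
    if "e \<in> Poly_Mapping.keys numerator" "e \<noteq> M" for e
    using that heavy[of e] unfolding num by (simp add: in_keys_iff lookup_add lookup_single when_def)
qed

end

section \<open>Valuations\<close>

context
  fixes val :: "'k::field \<Rightarrow> ereal"
  assumes val: "nonarch_valuation val"
begin

lemma val_eq_PInf [simp]: "val x = \<infinity> \<longleftrightarrow> x = 0"
  and val_neq_MInf [simp]: "val x \<noteq> - \<infinity>"
  and val_mult: "val (x * y) = val x + val y"
  and val_add: "min (val x) (val y) \<le> val (x + y)"
  using val by (auto simp: nonarch_valuation_def)

lemma val_0 [simp]: "val 0 = \<infinity>"
  by simp

lemma val_idempotent: "x * x = x \<Longrightarrow> x \<noteq> 0 \<Longrightarrow> val x = 0"
  using val_mult[of x x] val_eq_PInf[of x] val_neq_MInf[of x] by (cases "val x") auto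

lemma val_1 [simp]: "val 1 = 0"
  by (rule val_idempotent) simp_all

lemma val_minus_1: "val (- 1) = 0"
  using val_mult[of "- 1" "- 1"] val_eq_PInf[of "- 1"] val_neq_MInf[of "- 1"] by (cases "val (- 1)") auto

lemma val_uminus [simp]: "val (- x) = val x"
  using val_mult[of "- 1" x] by (simp add: val_minus_1)

lemma val_of_int_nonneg: "0 \<le> val (of_int n)"
proof -
  have nat: "0 \<le> val (of_nat m)" for m
  proof (induction m)
    case (Suc m)
    then show ?case
      using val_add[of 1 "of_nat m"] by (simp add: min_def split: if_splits)
  qed simp
  show ?thesis
    using nat by (cases n) (simp_all del: of_nat_Suc)
qed

lemma val_of_int_unit: "\<bar>n\<bar> = 1 \<Longrightarrow> val (of_int n) = 0"
  by (auto simp: abs_if split: if_splits)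

lemma val_add_eq:
  assumes "val x < val y"
  shows "val (x + y) = val x"
proof (rule antisym)
  show "val x \<le> val (x + y)"
    using val_add[of x y] assms by (simp add: min_def split: if_splits)
  have "min (val (x + y)) (val y) \<le> val x"
    using val_add[of "x + y" "- y"] by simp
  with assms show "val (x + y) \<le> val x"
    by (simp add: min_def split: if_splits)
qed

lemma val_sum_gt:
  assumes "\<And>i. i \<in> F \<Longrightarrow> ereal r < val (g i)"
  shows "ereal r < val (\<Sum>i\<in>F. g i)"
  using assms
proof (induction F rule: infinite_finite_induct)
  case (insert i F)
  then have "ereal r < min (val (g i)) (val (\<Sum>i\<in>F. g i))"
    by simp
  also have "\<dots> \<le> val (\<Sum>i\<in>insert i F. g i)"
    using insert val_add by simp
  finally show ?case .
qed simp_all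

lemma val_monomial:
  assumes "finite A" "Poly_Mapping.keys e \<subseteq> A" "\<And>p. p \<in> A \<Longrightarrow> val (x p) = ereal (u p)"
  shows "val (\<Prod>p\<in>Poly_Mapping.keys e. x p ^ Poly_Mapping.lookup e p) = ereal (weight A u e)"
proof -
  have pow: "val (y ^ n) = ereal (v * real n)" if "val y = ereal v" for y v n
    using that by (induction n) (simp_all add: val_mult algebra_simps zero_ereal_def)
  have "val (\<Prod>p\<in>F. x p ^ Poly_Mapping.lookup e p) = ereal (\<Sum>p\<in>F. u p * real (Poly_Mapping.lookup e p))" if "F \<subseteq> A" for F
    using finite_subset[OF that assms(1)] that
    by (induction F rule: finite_induct) (simp_all add: val_mult pow[OF assms(3)] zero_ereal_def)
  then have "val (\<Prod>p\<in>Poly_Mapping.keys e. x p ^ Poly_Mapping.lookup e p)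
      = ereal (\<Sum>p\<in>Poly_Mapping.keys e. u p * real (Poly_Mapping.lookup e p))"
    using assms(2) by blast
  also have "(\<Sum>p\<in>Poly_Mapping.keys e. u p * real (Poly_Mapping.lookup e p)) = weight A u e"
    unfolding weight_def using assms(1,2) by (intro sum.mono_neutral_left) (auto simp: in_keys_iff)
  finally show ?thesis .
qed

text \<open>Integers have nonnegative valuation, and \<open>1\<close> and \<open>-1\<close> have
  valuation \<open>0\<close> whatever the residue characteristic, so the strictly lightest term
  determines the valuation.\<close>

lemma val_eval_coeff_poly:
  assumes "finite A" "\<And>p. p \<in> A \<Longrightarrow> val (x p) = ereal (u p)"
    and M: "\<bar>Poly_Mapping.lookup H M\<bar> = 1" "Poly_Mapping.keys M \<subseteq> A"
    and gt: "\<And>e. e \<in> Poly_Mapping.keys H \<Longrightarrow> e \<noteq> M \<Longrightarrow> Poly_Mapping.keys e \<subseteq> A \<and> weight A u M < weight A u e"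
  shows "val (eval_coeff_poly x H) = ereal (weight A u M)"
proof -
  define T where "T e = of_int (Poly_Mapping.lookup H e) * (\<Prod>p\<in>Poly_Mapping.keys e. x p ^ Poly_Mapping.lookup e p)" for e
  have T: "val (T e) = val (of_int (Poly_Mapping.lookup H e) :: 'k) + ereal (weight A u e)" if "Poly_Mapping.keys e \<subseteq> A" for e
    unfolding T_def val_mult using val_monomial[where e = e, OF assms(1) that assms(2)] by simp
  have "M \<in> Poly_Mapping.keys H"
    using M(1) by (auto simp: in_keys_iff)
  then have "eval_coeff_poly x H = T M + (\<Sum>e\<in>Poly_Mapping.keys H - {M}. T e)"
    unfolding eval_coeff_poly_def T_def by (simp add: sum.remove)
  moreover have TM: "val (T M) = ereal (weight A u M)"
    using T[OF M(2)] val_of_int_unit[OF M(1)] by simp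
  moreover have "ereal (weight A u M) < val (\<Sum>e\<in>Poly_Mapping.keys H - {M}. T e)"
  proof (rule val_sum_gt)
    fix e assume e: "e \<in> Poly_Mapping.keys H - {M}"
    then have "ereal (weight A u M) < 0 + ereal (weight A u e)"
      using gt[of e] by simp
    also have "\<dots> \<le> val (T e)"
      using T[of e] gt[of e] e add_right_mono[OF val_of_int_nonneg, of "ereal (weight A u e)" "Poly_Mapping.lookup H e"]
      by simp
    finally show "ereal (weight A u M) < val (T e)" .
  qed
  ultimately show ?thesis
    using val_add_eq[of "T M"] by simp
qed

lemma val_divide:
  assumes "val x = ereal r" "val y = ereal s"
  shows "val (x / y) = ereal (r - s)"
proof -
  have "y \<noteq> 0"
    using assms(2) by auto
  then have "val x = val (x / y) + ereal s"
    using val_mult[of "x / y" y] assms(2) by simp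
  then show ?thesis
    using assms(1) by (cases "val (x / y)") auto
qed

end

lemma val_poly_eq:
  assumes "M \<in> Poly_Mapping.keys H" "\<And>e. e \<in> Poly_Mapping.keys H \<Longrightarrow> weight A u M \<le> weight A u e"
  shows "val_poly A H u = weight A u M"
  unfolding val_poly_def weight_def[symmetric] using assms by (intro Min_eqI) auto

section \<open>The valuation of the j-invariant\<close>

context marked_normal_form
begin

lemma val_poly_disc:
  assumes cyc: "determines_cycle A u \<omega>"
  shows "val_poly A disc u = 12 * u \<omega> + j_trop A u"
proof -
  obtain M where M: "\<bar>Poly_Mapping.lookup disc M\<bar> = 1" "weight A u M = 12 * u \<omega> + j_trop A u"
    "\<And>e. e \<in> Poly_Mapping.keys disc \<Longrightarrow> weight A u M \<le> weight A u e"
    using leading_term[OF cyc] by metis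
  have "val_poly A disc u = weight A u M"
    using M(1,3) by (intro val_poly_eq) (auto simp: in_keys_iff)
  with M(2) show ?thesis
    by simp
qed

lemma val_j_eq:
  assumes cyc: "determines_cycle A u \<omega>"
  shows "val_poly A numerator u - val_poly A disc u = - j_trop A u"
proof -
  have "val_poly A numerator u = weight A u (Poly_Mapping.single \<omega> 12)"
  proof (rule val_poly_eq)
    show "Poly_Mapping.single \<omega> 12 \<in> Poly_Mapping.keys numerator"
      using numerator_leading_term(1)[OF cyc] by (simp add: in_keys_iff)
    show "weight A u (Poly_Mapping.single \<omega> 12) \<le> weight A u e" if "e \<in> Poly_Mapping.keys numerator" for e
      using numerator_leading_term(3)[OF cyc that] by (cases "e = Poly_Mapping.single \<omega> 12") auto
  qed
  then show ?thesis
    using val_poly_disc[OF cyc] numerator_leading_term(2)[OF cyc] by simp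
qed

lemma continuous_on_coordinate: "continuous_on S (\<lambda>u :: lpt \<Rightarrow> real. u p)"
  by (rule continuous_on_subset[OF continuous_on_product_coordinates]) simp

lemma continuous_on_weight: "continuous_on S (\<lambda>u. weight A u e)"
  unfolding weight_def by (intro continuous_intros continuous_on_coordinate)

text \<open>
  On the interior of a top-dimensional cone two keys of minimal weight would have weights that
  agree on an open set, so the minimal key is unique.
\<close>

theorem val_disc:
  assumes val: "nonarch_valuation val" and cyc: "determines_cycle A u \<omega>"
    and u: "u \<in> interior (closure {u'. marked_subdivision A u' = marked_subdivision A u0})"
    and x: "\<And>p. p \<in> A \<Longrightarrow> val (x p) = ereal (u p)"
  shows "val (eval_coeff_poly x disc) = ereal (12 * u \<omega> + j_trop A u)"
proof -
  define K where "K = {u'. marked_subdivision A u' = marked_subdivision A u0}"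
  have "\<omega> \<in> A"
    using strict_minimizer_if_cycle(1)[OF fin \<omega>_interior cyc] .
  obtain w0 where w0: "\<forall>p\<in>A - {\<omega>}. trop_term u \<omega> w0 < trop_term u p w0"
    using strict_minimizer_if_cycle(2)[OF fin \<omega>_interior cyc] by blast
  \<comment> \<open>The vector \<open>u\<close> is only known to lie in the interior of a closure.
    Strict minimality of the term of \<open>\<omega>\<close> at \<open>w0\<close> is an open
    condition, so some \<open>u1\<close> inducing the subdivision of this cone has a cycle
    too.\<close>
  define W where "W = (\<Inter>p\<in>A - {\<omega>}. {u'. trop_term u' \<omega> w0 < trop_term u' p w0})"
  have "open W"
    unfolding W_def trop_term_def using fin
    by (intro open_INT ballI open_Collect_less continuous_intros continuous_on_coordinate) auto
  moreover have "u \<in> W" "u \<in> closure K"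
    using w0 u interior_subset by (auto simp: W_def K_def)
  ultimately obtain u1 where u1: "u1 \<in> W" "u1 \<in> K"
    using open_Int_closure_eq_empty[of W K] by blast
  have cyc1: "determines_cycle A u1 \<omega>"
    using u1(1) by (intro cycle_if_strict_minimizer[OF fin \<open>\<omega> \<in> A\<close> \<omega>_interior, of u1 w0]) (auto simp: W_def)
  obtain M where M: "\<bar>Poly_Mapping.lookup disc M\<bar> = 1"
    and le1: "\<And>u' e. marked_subdivision A u' = marked_subdivision A u1 \<Longrightarrow> e \<in> Poly_Mapping.keys disc \<Longrightarrow>
       weight A u' M \<le> weight A u' e"
    using leading_term[OF cyc1] by metis
  \<comment> \<open>A closed condition that holds for all vectors with the given subdivision extends
    to the whole cone.\<close>
  have le: "weight A u' M \<le> weight A u' e" if "u' \<in> closure K" "e \<in> Poly_Mapping.keys disc" for u' e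
  proof -
    have "closed {u'. weight A u' M \<le> weight A u' e}"
      by (intro closed_Collect_le continuous_on_weight)
    moreover have "K \<subseteq> {u'. weight A u' M \<le> weight A u' e}"
      using le1[OF _ that(2)] u1(2) by (auto simp: K_def)
    ultimately show ?thesis
      using closure_minimal that(1) by blast
  qed
  have M_key: "M \<in> Poly_Mapping.keys disc"
    using M by (auto simp: in_keys_iff)
  have unique: "weight A u M < weight A u e" if e: "e \<in> Poly_Mapping.keys disc" "e \<noteq> M" for e
  proof (rule ccontr)
    assume "\<not> weight A u M < weight A u e"
    then have eq: "weight A u e = weight A u M"
      using le[OF \<open>u \<in> closure K\<close> e(1)] by simp
    obtain p where p: "Poly_Mapping.lookup e p \<noteq> Poly_Mapping.lookup M p"
      using e(2) by (metis poly_mapping_eqI)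
    then have "p \<in> A"
      using keys_disc[OF cyc e(1)] keys_disc[OF cyc M_key] by (metis in_keys_iff subsetD)
    \<comment> \<open>Moving \<open>u\<close> both ways in a coordinate where the exponents differ
      stays in the cone, and one of the two moves would make \<open>e\<close> lighter than
      \<open>M\<close>.\<close>
    define l where "l t = u(p := u p + t)" for t
    have "continuous_on UNIV l"
    proof (intro continuous_on_coordinatewise_then_product)
      show "continuous_on UNIV (\<lambda>t. l t i)" for i
        by (cases "i = p") (simp_all add: l_def continuous_intros)
    qed
    then have "open (l -` interior (closure K))"
      by (simp add: open_vimage)
    moreover have "0 \<in> l -` interior (closure K)"
      using u by (simp add: l_def K_def)
    ultimately obtain \<delta> where \<delta>: "0 < \<delta>" "ball 0 \<delta> \<subseteq> l -` interior (closure K)"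
      using open_contains_ball by blast
    have wl: "weight A (l t) k = weight A u k + t * real (Poly_Mapping.lookup k p)" for t k
    proof -
      have "weight A (l t) k = (\<Sum>q\<in>A. u q * real (Poly_Mapping.lookup k q) + (if q = p then t * real (Poly_Mapping.lookup k p) else 0))"
        unfolding weight_def l_def by (rule sum.cong) (auto simp: algebra_simps)
      then show ?thesis
        using fin \<open>p \<in> A\<close> by (simp add: sum.distrib weight_def)
    qed
    have "t * real (Poly_Mapping.lookup M p) \<le> t * real (Poly_Mapping.lookup e p)" if "\<bar>t\<bar> < \<delta>" for t
    proof -
      have "l t \<in> closure K"
        using \<delta>(2) that interior_subset by (auto simp: subset_iff)
      from le[OF this e(1)] show ?thesis
        by (simp add: wl eq)
    qed
    from this[of "\<delta> / 2"] this[of "- \<delta> / 2"] \<delta>(1) p show False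
      by simp
  qed
  have "val (eval_coeff_poly x disc) = ereal (weight A u M)"
  proof (rule val_eval_coeff_poly[OF val fin x M])
    show "Poly_Mapping.keys M \<subseteq> A"
      using keys_disc[OF cyc M_key] .
    show "Poly_Mapping.keys e \<subseteq> A \<and> weight A u M < weight A u e"
      if "e \<in> Poly_Mapping.keys disc" "e \<noteq> M" for e
      using keys_disc[OF cyc that(1)] unique[OF that] by blast
  qed
  also have "weight A u M = val_poly A disc u"
    using M_key le[OF \<open>u \<in> closure K\<close>] by (intro val_poly_eq[symmetric])
  also have "\<dots> = 12 * u \<omega> + j_trop A u"
    using val_poly_disc[OF cyc] .
  finally show ?thesis .
qed

lemma val_numerator:
  assumes "nonarch_valuation val" "determines_cycle A u \<omega>" "\<And>p. p \<in> A \<Longrightarrow> val (x p) = ereal (u p)"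
  shows "val (eval_coeff_poly x numerator) = ereal (12 * u \<omega>)"
proof -
  have "\<omega> \<in> A"
    using strict_minimizer_if_cycle(1)[OF fin \<omega>_interior assms(2)] .
  then have "val (eval_coeff_poly x numerator) = ereal (weight A u (Poly_Mapping.single \<omega> 12))"
    using numerator_leading_term[OF assms(2)]
    by (intro val_eval_coeff_poly[OF assms(1) fin assms(3)]) auto
  then show ?thesis
    using numerator_leading_term(2)[OF assms(2)] by simp
qed

text \<open>Allows \<open>u\<close> to be replaced by the valuations of the coefficients, which
  agree with it only on \<open>A\<close>.\<close>

lemma j_trop_cong:
  assumes "determines_cycle A u \<omega>" "\<And>p. p \<in> A \<Longrightarrow> u p = u' p"
  shows "j_trop A u = j_trop A u'"
proof -
  have lift: "lift_pt u ` A = lift_pt u' ` A"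
    using assms by (intro image_cong) (auto simp: lift_pt_def)
  have lf: "lower_faces A u = lower_faces A u'"
    by (simp add: lower_faces_def lift)
  have "{p \<in> A. lift_pt u p \<in> L} = {p \<in> A. lift_pt u' p \<in> L}" for L
    using assms by (auto simp: lift_pt_def)
  then have ms: "marked_subdivision A u = marked_subdivision A u'"
    by (simp add: marked_subdivision_def lf)
  then have "determines_cycle A u' \<omega>"
    using assms(1) by (simp add: determines_cycle_def)
  moreover have "trop_fun A u = trop_fun A u'"
  proof
    show "trop_fun A u w = trop_fun A u' w" for w
      unfolding trop_fun_def using assms(2) by (intro arg_cong[of _ _ Min] image_cong) (auto simp: trop_term_def)
  qed
  then have "lattice_length A u \<omega> q = lattice_length A u' \<omega> q" if "q \<in> A" for q
    using that assms(2) strict_minimizer_if_cycle(1)[OF fin \<omega>_interior assms(1)]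
    by (simp add: lattice_length_def dual_edge_def trop_term_def)
  ultimately show ?thesis
    using assms(1) by (simp add: j_trop_eq_sum[OF fin int])
qed

end

text \<open>A bounded set contains finitely many lattice points, and a compact convex set is the
  hull of its extreme points.\<close>

lemma finite_marked:
  assumes "marked_polygon Q A"
  shows "finite A" and "convex hull (pt ` A) = Q"
proof -
  obtain V where V: "finite V" "Q = convex hull (pt ` V)"
    using assms by (auto simp: marked_polygon_def lattice_polygon_def)
  have Q: "compact Q" "convex Q"
    using V by (auto simp: finite_imp_compact_convex_hull convex_convex_hull)
  have A: "pt ` A \<subseteq> Q" "{v. v extreme_point_of Q} \<subseteq> pt ` A"
    using assms by (auto simp: marked_polygon_def)
  obtain C where C: "\<And>x. x \<in> Q \<Longrightarrow> norm x \<le> C"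
    using compact_imp_bounded[OF Q(1)] bounded_iff by blast
  have "A \<subseteq> {- \<lceil>C\<rceil>..\<lceil>C\<rceil>} \<times> {- \<lceil>C\<rceil>..\<lceil>C\<rceil>}"
  proof
    fix p assume "p \<in> A"
    then have "norm (pt p) \<le> C"
      using A(1) C by blast
    then have "\<bar>real_of_int (fst p)\<bar> \<le> C" "\<bar>real_of_int (snd p)\<bar> \<le> C"
      using norm_fst_le[of "fst (pt p)" "snd (pt p)"] norm_snd_le[of "snd (pt p)" "fst (pt p)"] by (simp_all add: pt_def)
    then have "\<bar>fst p\<bar> \<le> \<lceil>C\<rceil>" "\<bar>snd p\<bar> \<le> \<lceil>C\<rceil>"
      by linarith+
    then show "p \<in> {- \<lceil>C\<rceil>..\<lceil>C\<rceil>} \<times> {- \<lceil>C\<rceil>..\<lceil>C\<rceil>}"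
      by (cases p) auto
  qed
  then show "finite A"
    by (rule finite_subset) simp
  have "Q \<subseteq> convex hull (pt ` A)"
    using Krein_Milman_Minkowski[OF Q] hull_mono[OF A(2), of convex] by simp
  then show "convex hull (pt ` A) = Q"
    using A(1) Q(2) by (simp add: hull_minimal subset_antisym)
qed

theorem theorem6p4:
  fixes Q :: "(real \<times> real) set" and A :: "(int \<times> int) set" and u :: "int \<times> int \<Rightarrow> real"
    and val :: "'k::field \<Rightarrow> ereal"
  assumes "marked_polygon Q A"
    and "card (interior_lattice_points Q) = 1"
    and "nonarch_valuation val"
    and "has_cycle A u"
  shows "val_j A u = - j_trop A u \<and>
    (\<forall>f :: int \<times> int \<Rightarrow>\<^sub>0 'k.
       (\<exists>\<sigma> \<in> secondary_fan A. top_dimensional \<sigma> \<and> u \<in> interior \<sigma>) \<and>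
       Poly_Mapping.keys f \<subseteq> A \<and>
       (\<forall>p \<in> A. val (Poly_Mapping.lookup f p) = ereal (u p)) \<longrightarrow>
       val (j_invariant A f) = ereal (- j_trop A u) \<and> - j_trop A u = - j_trop_Trop val f)"
proof -
  note hull = finite_marked[OF assms(1)]
  obtain \<omega> where int: "interior_lattice_points (convex hull (pt ` A)) = {\<omega>}"
    using assms(2) hull(2) by (metis card_1_singletonE)
  have cyc: "determines_cycle A u \<omega>"
    using assms(4) int by (auto simp: has_cycle_def determines_cycle_def newton_polygon_def)
  \<comment> \<open>The same choice as in \<open>generic_weier\<close>, so that the locale speaks of
    the very polynomials that define the j-invariant.\<close>
  define N where "N = (SOME N. normal_form A N)"
  have "normal_form A N"
    unfolding N_def using normal_form_exists[OF hull(1) int] by (metis someI)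
  then obtain a b c d r s where N: "\<bar>a * d - b * c\<bar> = 1"
      "\<And>i j. snd N (i, j) = (a * i + b * j + r, c * i + d * j + s)" "snd N ` A \<subseteq> shape_points (fst N)"
    unfolding normal_form_def unimodular_affine_def by blast
  interpret marked_normal_form A \<omega> "fst N" "snd N" a b c d r s
    by unfold_locales (use hull int N in auto)
  have j: "j_numerator A = numerator" "j_denominator A = disc"
    by (simp_all add: j_numerator_def j_denominator_def generic_weier_def N_def Let_def)
  show ?thesis
  proof (intro conjI allI impI)
    show "val_j A u = - j_trop A u"
      unfolding val_j_def j by (rule val_j_eq[OF cyc])
  next
    fix f :: "int \<times> int \<Rightarrow>\<^sub>0 'k"
    assume f: "(\<exists>\<sigma> \<in> secondary_fan A. top_dimensional \<sigma> \<and> u \<in> interior \<sigma>) \<and> Poly_Mapping.keys f \<subseteq> A \<and>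
       (\<forall>p \<in> A. val (Poly_Mapping.lookup f p) = ereal (u p))"
    then obtain u0 where "u \<in> interior (closure {u'. marked_subdivision A u' = marked_subdivision A u0})"
      by (auto simp: secondary_fan_def)
    then have "val (eval_coeff_poly (Poly_Mapping.lookup f) disc) = ereal (12 * u \<omega> + j_trop A u)"
      using f by (intro val_disc[OF assms(3) cyc]) auto
    moreover have "val (eval_coeff_poly (Poly_Mapping.lookup f) numerator) = ereal (12 * u \<omega>)"
      using f by (intro val_numerator[OF assms(3) cyc]) auto
    ultimately show "val (j_invariant A f) = ereal (- j_trop A u)"
      unfolding j_invariant_def j using val_divide[OF assms(3)] by fastforce
    \<comment> \<open>A finite valuation means a nonzero coefficient, so the support of
      \<open>f\<close> is all of \<open>A\<close>.\<close>
    have "p \<in> Poly_Mapping.keys f" if "p \<in> A" for p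
      using f that val_eq_PInf[OF assms(3), of "Poly_Mapping.lookup f p"] by (auto simp: in_keys_iff)
    with f have "Poly_Mapping.keys f = A"
      by blast
    then have "j_trop_Trop val f = j_trop A (\<lambda>p. real_of_ereal (val (Poly_Mapping.lookup f p)))"
      by (simp add: j_trop_Trop_def)
    also have "\<dots> = j_trop A u"
      using f by (intro j_trop_cong[OF cyc, symmetric]) simp
    finally have "j_trop_Trop val f = j_trop A u" .
    then show "- j_trop A u = - j_trop_Trop val f"
      by simp
  qed
qed

end
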